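(* Let $R$ be a set of $r$ red points and $B$ a set of $b$ blue points in the plane such that $S=R\cup B$ is in general position, and suppose $r=3b$ or $b=3r$. Then all points of $S$ can be $K_{1,3}$-covered, and such a $K_{1,3}$-covering can be computed in $O(N^{4/3}\log^3 N)$ time, where $N=r+b$.
   Context: General position: no three points collinear. A set $X$ of red and blue points can be $K_{1,3}$-covered if $X$ can be partitioned into subsets of size $4$, each consisting of one point (the center) of one color and three points of the other color, such that the straight-line segments joining each center to the three other points of its subset are pairwise non-crossing (no two of these segments intersect except at a common endpoint). Such a partition together with its segments is a $K_{1,3}$-covering. *)

theory Defs
  imports "HOL-Analysis.Analysis" "HOL-Library.Landau_Symbols"
begin

type_synonym point = "real \<times> real"

definition general_position :: "point set \<Rightarrow> bool" where
  "general_position S \<longleftrightarrow> (\<forall>T. T \<subseteq> S \<and> card T = 3 \<longrightarrow> \<not> collinear T)"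

text \<open>A star \<open>(c, L)\<close> consists of its center \<open>c\<close> and its set \<open>L\<close> of leaves.\<close>

definition K13_star :: "point set \<Rightarrow> point set \<Rightarrow> point \<times> point set \<Rightarrow> bool" where
  "K13_star R B = (\<lambda>(c, L). card L = 3 \<and> (c \<in> R \<and> L \<subseteq> B \<or> c \<in> B \<and> L \<subseteq> R))"

definition star_edges :: "(point \<times> point set) set \<Rightarrow> (point \<times> point) set" where
  "star_edges C = {(c, p). \<exists>L. (c, L) \<in> C \<and> p \<in> L}"

definition non_crossing :: "(point \<times> point) set \<Rightarrow> bool" where
  "non_crossing E \<longleftrightarrow>
     (\<forall>(p, q) \<in> E. \<forall>(u, v) \<in> E. (p, q) \<noteq> (u, v) \<longrightarrow>
        closed_segment p q \<inter> closed_segment u v \<subseteq> {p, q} \<inter> {u, v})"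

definition K13_covering :: "point set \<Rightarrow> point set \<Rightarrow> (point \<times> point set) set \<Rightarrow> bool" where
  "K13_covering R B C \<longleftrightarrow>
     (\<forall>s \<in> C. K13_star R B s) \<and>
     disjoint_family_on (\<lambda>(c, L). insert c L) C \<and>
     (\<Union>(c, L) \<in> C. insert c L) = R \<union> B \<and>
     non_crossing (star_edges C)"

definition K13_coverable :: "point set \<Rightarrow> point set \<Rightarrow> bool" where
  "K13_coverable R B \<longleftrightarrow> (\<exists>C. K13_covering R B C)"

text \<open>
  Running time is the number of unit-cost instructions of a real RAM. The machine has word
  registers and a word memory, holding integers of \<open>w\<close> bits, and real registers and a real memory,
  holding exact reals. Memory is addressed by words. Words can be converted to reals but not
  conversely, reals influence control flow only through comparisons, and there are no real
  constants in programs, so that a program is a finite discrete object.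
\<close>

datatype word_op = WAdd | WSub | WMul | WDiv | WMod

datatype real_op = RAdd | RSub | RMul | RDiv

datatype instr =
    WConst nat nat
  | WArith word_op nat nat nat
  | WLoad nat nat
  | WStore nat nat
  | RCast nat nat
  | RArith real_op nat nat nat
  | RLoad nat nat
  | RStore nat nat
  | Jump nat
  | JumpWLess nat nat nat
  | JumpRLess nat nat nat

record config =
  pc :: nat
  wreg :: "nat \<Rightarrow> nat"
  rreg :: "nat \<Rightarrow> real"
  wmem :: "nat \<Rightarrow> nat"
  rmem :: "nat \<Rightarrow> real"

text \<open>Word arithmetic wraps around modulo \<open>2 ^ w\<close>; division by zero yields zero on both sorts
  (and \<open>x mod 0 = x\<close>).\<close>

fun word_arith :: "nat \<Rightarrow> word_op \<Rightarrow> nat \<Rightarrow> nat \<Rightarrow> nat" where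
  "word_arith w WAdd x y = (x + y) mod 2 ^ w"
| "word_arith w WSub x y = nat ((int x - int y) mod 2 ^ w)"
| "word_arith w WMul x y = (x * y) mod 2 ^ w"
| "word_arith w WDiv x y = x div y"
| "word_arith w WMod x y = x mod y"

fun real_arith :: "real_op \<Rightarrow> real \<Rightarrow> real \<Rightarrow> real" where
  "real_arith RAdd x y = x + y"
| "real_arith RSub x y = x - y"
| "real_arith RMul x y = x * y"
| "real_arith RDiv x y = x / y"

fun exec_instr :: "nat \<Rightarrow> instr \<Rightarrow> config \<Rightarrow> config" where
  "exec_instr w (WConst i k) s =
     s\<lparr>pc := pc s + 1, wreg := (wreg s)(i := k mod 2 ^ w)\<rparr>"
| "exec_instr w (WArith f i j k) s =
     s\<lparr>pc := pc s + 1, wreg := (wreg s)(i := word_arith w f (wreg s j) (wreg s k))\<rparr>"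
| "exec_instr w (WLoad i j) s =
     s\<lparr>pc := pc s + 1, wreg := (wreg s)(i := wmem s (wreg s j))\<rparr>"
| "exec_instr w (WStore i j) s =
     s\<lparr>pc := pc s + 1, wmem := (wmem s)(wreg s i := wreg s j)\<rparr>"
| "exec_instr w (RCast i j) s =
     s\<lparr>pc := pc s + 1, rreg := (rreg s)(i := real (wreg s j))\<rparr>"
| "exec_instr w (RArith f i j k) s =
     s\<lparr>pc := pc s + 1, rreg := (rreg s)(i := real_arith f (rreg s j) (rreg s k))\<rparr>"
| "exec_instr w (RLoad i j) s =
     s\<lparr>pc := pc s + 1, rreg := (rreg s)(i := rmem s (wreg s j))\<rparr>"
| "exec_instr w (RStore i j) s =
     s\<lparr>pc := pc s + 1, rmem := (rmem s)(wreg s i := rreg s j)\<rparr>"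
| "exec_instr w (Jump l) s = s\<lparr>pc := l\<rparr>"
| "exec_instr w (JumpWLess i j l) s =
     s\<lparr>pc := (if wreg s i < wreg s j then l else pc s + 1)\<rparr>"
| "exec_instr w (JumpRLess i j l) s =
     s\<lparr>pc := (if rreg s i < rreg s j then l else pc s + 1)\<rparr>"

definition halted :: "instr list \<Rightarrow> config \<Rightarrow> bool" where
  "halted P s \<longleftrightarrow> length P \<le> pc s"

definition step :: "nat \<Rightarrow> instr list \<Rightarrow> config \<Rightarrow> config" where
  "step w P s = (if halted P s then s else exec_instr w (P ! pc s) s)"

text \<open>The input lists the red points and then the blue points: point number \<open>k\<close> has its coordinates
  in cells \<open>2 * k\<close> and \<open>2 * k + 1\<close> of the real memory, and the numbers of red and blue points
  are in word registers 0 and 1. Everything else is zero.\<close>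

definition init_config :: "point list \<Rightarrow> point list \<Rightarrow> config" where
  "init_config rs bs =
     \<lparr>pc = 0,
      wreg = (\<lambda>_. 0)(0 := length rs, 1 := length bs),
      rreg = (\<lambda>_. 0),
      wmem = (\<lambda>_. 0),
      rmem = (\<lambda>a. if a < 2 * (length rs + length bs)
                  then (if even a then fst else snd) ((rs @ bs) ! (a div 2)) else 0)\<rparr>"

text \<open>The output consists of point numbers in the first \<open>N\<close> cells of the word memory: star
  number \<open>i\<close> has its center in cell \<open>4 * i\<close> and its leaves in the three cells after it.\<close>

definition output_stars :: "point list \<Rightarrow> config \<Rightarrow> (point \<times> point set) set" where
  "output_stars ps s =
     (\<lambda>i. (ps ! wmem s (4 * i), (\<lambda>j. ps ! wmem s (4 * i + j)) ` {1, 2, 3})) ` {..<length ps div 4}"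

definition valid_output :: "point list \<Rightarrow> point list \<Rightarrow> config \<Rightarrow> bool" where
  "valid_output rs bs s \<longleftrightarrow>
     (\<forall>a < length (rs @ bs). wmem s a < length (rs @ bs)) \<and>
     K13_covering (set rs) (set bs) (output_stars (rs @ bs) s)"

definition K13_instance :: "point set \<Rightarrow> point set \<Rightarrow> bool" where
  "K13_instance R B \<longleftrightarrow>
     finite R \<and> finite B \<and> R \<inter> B = {} \<and> general_position (R \<union> B) \<and>
     (card R = 3 * card B \<or> card B = 3 * card R)"

text \<open>Words have \<open>O(log N)\<close> bits, the constant \<open>d\<close> being chosen along with the program.\<close>

definition word_size :: "nat \<Rightarrow> nat \<Rightarrow> nat" where
  "word_size d N = d * nat \<lceil>log 2 (real (N + 2))\<rceil>"

definition K13_computable_in_time :: "(nat \<Rightarrow> nat) \<Rightarrow> bool" where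
  "K13_computable_in_time T \<longleftrightarrow>
     (\<exists>P d. \<forall>rs bs. distinct rs \<and> distinct bs \<and> K13_instance (set rs) (set bs) \<longrightarrow>
        (let N = length rs + length bs in
         \<exists>t \<le> T N. let s = (step (word_size d N) P ^^ t) (init_config rs bs) in
           halted P s \<and> valid_output rs bs s))"

end

theory Submission
  imports Defs "HOL-Real_Asymp.Real_Asymp"
begin

text \<open>
  Replace every centre by three coincident copies. A non-crossing perfect matching between the
  copies and the leaves collapses to a \<open>K\<^sub>1\<^sub>,\<^sub>3\<close>-covering, so with weights \<open>1\<close> for copies and
  \<open>-1\<close> for leaves it suffices to cut a block of total weight zero by a line into two
  non-empty blocks of weight zero and to recurse.

  Rotate a line about a point \<open>c\<close> by half a turn. Every item changes sides exactly once, so the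
  weight \<open>w\<close> on one side moves in unit steps from \<open>w\<close> to \<open>-w\<close> and vanishes on the way. The cut is
  balanced if \<open>c\<close> is deep: take a vertical line with half of the items on either side, match the
  items of the two halves arbitrarily, and let \<open>c\<close> be the median of the points where the
  connecting segments meet the vertical line. If both ends of a segment lie strictly on one side
  of a line through \<open>c\<close>, then so does its crossing point; as half of the crossing points are not
  above \<open>c\<close> and half are not below, each closed half-plane bounded by a line through \<open>c\<close>
  contains a quarter of the items. For small blocks \<open>c\<close> is
  a leftmost item instead, and if it and the first item met by the rotating line have different
  colours, this pair is cut off. At most two points lie on the line, and at most one of them has
  copies on both sides, so edges on different sides meet at most in a common endpoint.

  A cut costs at most three sorts, hence the algorithm takes \<open>O(N log\<^sup>2 N)\<close> steps.
\<close>

section \<open>A structured language compiled to the real RAM\<close>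

text \<open>Copies of a centre coincide, so general position says nothing about them, and the
  rotating line may stop after passing only some copies of a point. Items are therefore sorted by
  key and then by number: the copies of a point stay together, and a cut can divide the copies of
  one point only. Depth makes both sides non-empty only if a quarter of the block exceeds the items
  on the line, of which there are at most six (two points, three copies each). From
  \<open>n = 48\<close> on, \<open>n / 4 - 6\<close> is at least \<open>n / 8\<close>; this is the
  origin of the threshold 49. Below it the balance of a cut is irrelevant for the time, but an empty
  side would stop progress. With a leftmost pivot all items start above the line, and the two
  trivial balanced positions, at the start and at the end of the half turn, can be told apart from
  the useful ones. The recursion needs no stack: a cut permutes a segment of one array in place and
  records where the two parts end, and in the final order the items at positions
  \<open>2 * k\<close> and \<open>2 * k + 1\<close> form an edge. The time is charged to the
  potential \<open>n * ln n\<close>, which drops by at least \<open>n / 48\<close> at every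
  cut.\<close>

datatype atom =
    Cst nat nat
  | Mov nat nat
  | Add nat nat nat
  | AddI nat nat nat
  | Sub nat nat nat
  | SubI nat nat nat
  | Half nat nat
  | Ld nat nat nat
  | St nat nat nat
  | RLd nat nat nat
  | RSt nat nat nat
  | Cast nat nat
  | Rop real_op nat nat nat

datatype com =
    At atom
  | Skip
  | Seq com com (infixr \<open>;;\<close> 60)
  | IfW nat nat com com
  | IfR nat nat com com
  | While nat nat com

record st =
  wv :: "nat \<Rightarrow> nat"
  rv :: "nat \<Rightarrow> real"
  wa :: "nat \<Rightarrow> nat \<Rightarrow> nat"
  ra :: "nat \<Rightarrow> nat \<Rightarrow> real"

fun aexec :: "atom \<Rightarrow> st \<Rightarrow> st" where
  "aexec (Cst x k) s = s\<lparr>wv := (wv s)(x := k)\<rparr>"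
| "aexec (Mov x y) s = s\<lparr>wv := (wv s)(x := wv s y)\<rparr>"
| "aexec (Add x y z) s = s\<lparr>wv := (wv s)(x := wv s y + wv s z)\<rparr>"
| "aexec (AddI x y k) s = s\<lparr>wv := (wv s)(x := wv s y + k)\<rparr>"
| "aexec (Sub x y z) s = s\<lparr>wv := (wv s)(x := wv s y - wv s z)\<rparr>"
| "aexec (SubI x y k) s = s\<lparr>wv := (wv s)(x := wv s y - k)\<rparr>"
| "aexec (Half x y) s = s\<lparr>wv := (wv s)(x := wv s y div 2)\<rparr>"
| "aexec (Ld x a i) s = s\<lparr>wv := (wv s)(x := wa s a (wv s i))\<rparr>"
| "aexec (St a i x) s = s\<lparr>wa := (wa s)(a := (wa s a)(wv s i := wv s x))\<rparr>"
| "aexec (RLd f a i) s = s\<lparr>rv := (rv s)(f := ra s a (wv s i))\<rparr>"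
| "aexec (RSt a i f) s = s\<lparr>ra := (ra s)(a := (ra s a)(wv s i := rv s f))\<rparr>"
| "aexec (Cast f x) s = s\<lparr>rv := (rv s)(f := real (wv s x))\<rparr>"
| "aexec (Rop p f g h) s = s\<lparr>rv := (rv s)(f := real_arith p (rv s g) (rv s h))\<rparr>"

text \<open>Machine registers 0 to 6 hold the base addresses of the arrays, register 7 an immediate
  operand, register 8 an address, register 9 the constant zero.\<close>

fun acomp :: "atom \<Rightarrow> instr list" where
  "acomp (Cst x k) = [WConst (x + 10) k]"
| "acomp (Mov x y) = [WArith WAdd (x + 10) (y + 10) 9]"
| "acomp (Add x y z) = [WArith WAdd (x + 10) (y + 10) (z + 10)]"
| "acomp (AddI x y k) = [WConst 7 k, WArith WAdd (x + 10) (y + 10) 7]"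
| "acomp (Sub x y z) = [WArith WSub (x + 10) (y + 10) (z + 10)]"
| "acomp (SubI x y k) = [WConst 7 k, WArith WSub (x + 10) (y + 10) 7]"
| "acomp (Half x y) = [WConst 7 2, WArith WDiv (x + 10) (y + 10) 7]"
| "acomp (Ld x a i) = [WArith WAdd 8 a (i + 10), WLoad (x + 10) 8]"
| "acomp (St a i x) = [WArith WAdd 8 a (i + 10), WStore 8 (x + 10)]"
| "acomp (RLd f a i) = [WArith WAdd 8 a (i + 10), RLoad f 8]"
| "acomp (RSt a i f) = [WArith WAdd 8 a (i + 10), RStore 8 f]"
| "acomp (Cast f x) = [RCast f (x + 10)]"
| "acomp (Rop p f g h) = [RArith p f g h]"

fun len :: "com \<Rightarrow> nat" where
  "len (At a) = length (acomp a)"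
| "len Skip = 0"
| "len (c ;; d) = len c + len d"
| "len (IfW x y c d) = len c + len d + 2"
| "len (IfR x y c d) = len c + len d + 2"
| "len (While x y c) = len c + 3"

text \<open>\<open>k\<close> is the address at which the code will stand, as jump targets are
  absolute. A conditional jump is taken when the test succeeds, so the code of the second branch
  comes first.\<close>

fun compile :: "nat \<Rightarrow> com \<Rightarrow> instr list" where
  "compile k (At a) = acomp a"
| "compile k Skip = []"
| "compile k (c ;; d) = compile k c @ compile (k + len c) d"
| "compile k (IfW x y c d) =
     JumpWLess (x + 10) (y + 10) (k + len d + 2) # compile (k + 1) d @
     Jump (k + len d + 2 + len c) # compile (k + len d + 2) c"
| "compile k (IfR x y c d) =
     JumpRLess x y (k + len d + 2) # compile (k + 1) d @
     Jump (k + len d + 2 + len c) # compile (k + len d + 2) c"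
| "compile k (While x y c) =
     JumpWLess (x + 10) (y + 10) (k + 2) # Jump (k + 3 + len c) # compile (k + 2) c @ [Jump k]"

lemma length_compile [simp]: "length (compile k c) = len c"
  by (induction c arbitrary: k) auto

text \<open>\<open>Q\<close> is the length of each of the seven arrays, which lie one after another,
  so addresses stay below \<open>7 * Q\<close>. The factor 64 leaves room for sums and doublings of
  indices and covers the immediate operands.\<close>

locale ram =
  fixes wbits Q :: nat
  assumes Q_pos: "0 < Q" and Q_bound: "64 * Q \<le> 2 ^ wbits" and wbits_ge: "(64::nat) \<le> 2 ^ wbits"
begin

text \<open>Excludes index errors and wrap-around of word arithmetic.\<close>

fun aok :: "atom \<Rightarrow> st \<Rightarrow> bool" where
  "aok (Cst x k) s \<longleftrightarrow> k < 64"
| "aok (Mov x y) s \<longleftrightarrow> wv s y < 64 * Q"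
| "aok (Add x y z) s \<longleftrightarrow> wv s y + wv s z < 64 * Q"
| "aok (AddI x y k) s \<longleftrightarrow> wv s y + k < 64 * Q"
| "aok (Sub x y z) s \<longleftrightarrow> wv s z \<le> wv s y \<and> wv s y < 64 * Q"
| "aok (SubI x y k) s \<longleftrightarrow> k \<le> wv s y \<and> wv s y < 64 * Q"
| "aok (Half x y) s \<longleftrightarrow> True"
| "aok (Ld x a i) s \<longleftrightarrow> a \<le> 6 \<and> wv s i < Q"
| "aok (St a i x) s \<longleftrightarrow> a \<le> 6 \<and> wv s i < Q"
| "aok (RLd f a i) s \<longleftrightarrow> a \<le> 6 \<and> wv s i < Q"
| "aok (RSt a i f) s \<longleftrightarrow> a \<le> 6 \<and> wv s i < Q"
| "aok (Cast f x) s \<longleftrightarrow> True"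
| "aok (Rop p f g h) s \<longleftrightarrow> True"

text \<open>The costs are upper bounds for the number of steps of the compiled code.\<close>

inductive big :: "com \<Rightarrow> st \<Rightarrow> nat \<Rightarrow> st \<Rightarrow> bool" where
  big_At: "aok a s \<Longrightarrow> big (At a) s 2 (aexec a s)"
| big_Skip: "big Skip s 0 s"
| big_Seq: "big c s t s' \<Longrightarrow> big d s' t' s'' \<Longrightarrow> big (c ;; d) s (t + t') s''"
| big_IfW1: "wv s x < wv s y \<Longrightarrow> big c s t s' \<Longrightarrow> big (IfW x y c d) s (t + 2) s'"
| big_IfW2: "\<not> wv s x < wv s y \<Longrightarrow> big d s t s' \<Longrightarrow> big (IfW x y c d) s (t + 2) s'"
| big_IfR1: "rv s x < rv s y \<Longrightarrow> big c s t s' \<Longrightarrow> big (IfR x y c d) s (t + 2) s'"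
| big_IfR2: "\<not> rv s x < rv s y \<Longrightarrow> big d s t s' \<Longrightarrow> big (IfR x y c d) s (t + 2) s'"
| big_While1: "wv s x < wv s y \<Longrightarrow> big c s t s' \<Longrightarrow> big (While x y c) s' t' s'' \<Longrightarrow>
    big (While x y c) s (t + t' + 2) s''"
| big_While2: "\<not> wv s x < wv s y \<Longrightarrow> big (While x y c) s 2 s"

section \<open>Correctness of the translation\<close>

text \<open>Word and real arrays of the same index share a base address, because the two memories
  are separate. As array 0 has base 0, the input already is real array 0 and the output is word
  array 0. Registers 7 and 8 are scratch and stay unconstrained, as does the program
  counter.\<close>

definition sim :: "st \<Rightarrow> config \<Rightarrow> bool" where
  "sim s \<sigma> \<longleftrightarrow> (\<forall>r. wreg \<sigma> (r + 10) = wv s r) \<and> rreg \<sigma> = rv s \<and>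
     (\<forall>a\<le>6. wreg \<sigma> a = a * Q) \<and> wreg \<sigma> 9 = 0 \<and>
     (\<forall>a\<le>6. \<forall>i<Q. wmem \<sigma> (a * Q + i) = wa s a i \<and> rmem \<sigma> (a * Q + i) = ra s a i)"

text \<open>Quotient and remainder by \<open>Q\<close> are unique. Hence different cells have
  different addresses, and a store affects no other cell.\<close>

lemma base_offset_eq_iff:
  fixes a b i j :: nat
  assumes "i < Q" "j < Q"
  shows "a * Q + i = b * Q + j \<longleftrightarrow> a = b \<and> i = j"
proof
  assume eq: "a * Q + i = b * Q + j"
  have "(a * Q + i) div Q = a" "(b * Q + j) div Q = b" using assms by auto
  with eq show "a = b \<and> i = j" by auto
qed auto

lemma address_small: "a \<le> 6 \<Longrightarrow> i < Q \<Longrightarrow> (a * Q + i) mod 2 ^ wbits = a * Q + i"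
proof -
  assume "a \<le> 6" "i < Q"
  then have "a * Q \<le> 6 * Q" by (intro mult_right_mono) auto
  with \<open>i < Q\<close> have "a * Q + i < 64 * Q" by linarith
  with Q_bound show ?thesis by (intro mod_less) linarith
qed

lemma word_small: "n < 64 * Q \<Longrightarrow> n mod 2 ^ wbits = n"
  using Q_bound by (intro mod_less) linarith

lemma word_sub_small:
  fixes x y :: nat
  assumes "y \<le> x" "x < 64 * Q"
  shows "nat ((int x - int y) mod 2 ^ wbits) = x - y"
proof -
  have "int x - int y = int (x - y)" using assms by simp
  moreover have "(2::int) ^ wbits = int (2 ^ wbits)" by simp
  ultimately have "(int x - int y) mod 2 ^ wbits = int ((x - y) mod 2 ^ wbits)"
    by (simp only: zmod_int)
  then show ?thesis using word_small[of "x - y"] assms by simp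
qed

lemma acomp_sim:
  assumes "aok a s" "sim s \<sigma>"
  shows "\<exists>\<sigma>'. fold (exec_instr wbits) (acomp a) \<sigma> = \<sigma>' \<and> sim (aexec a s) \<sigma>' \<and>
    pc \<sigma>' = pc \<sigma> + length (acomp a)"
  using assms Q_bound wbits_ge
  by (cases a)
     (auto simp: sim_def word_small word_sub_small address_small base_offset_eq_iff
        split: if_splits)

lemma length_acomp: "length (acomp a) \<le> 2"
  by (cases a) auto

lemma step_exec:
  "P = pre @ i # post \<Longrightarrow> pc \<sigma> = length pre \<Longrightarrow> step wbits P \<sigma> = exec_instr wbits i \<sigma>"
  by (simp add: step_def halted_def)

lemma pc_exec_acomp:
  "i \<in> set (acomp a) \<Longrightarrow> pc (exec_instr wbits i \<sigma>) = pc \<sigma> + 1"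
  by (cases a) auto

lemma steps_straight_line:
  assumes "P = pre @ is @ post" "pc \<sigma> = length pre"
    and "\<And>i \<sigma>. i \<in> set is \<Longrightarrow> pc (exec_instr wbits i \<sigma>) = pc \<sigma> + 1"
  shows "(step wbits P ^^ length is) \<sigma> = fold (exec_instr wbits) is \<sigma>"
  using assms
proof (induction "is" arbitrary: pre \<sigma>)
  case Nil
  then show ?case by simp
next
  case (Cons i "is")
  have "step wbits P \<sigma> = exec_instr wbits i \<sigma>"
    using Cons.prems(1,2) by (intro step_exec[of _ pre i "is @ post"]) auto
  moreover have "(step wbits P ^^ length is) (exec_instr wbits i \<sigma>) =
      fold (exec_instr wbits) is (exec_instr wbits i \<sigma>)"
    using Cons.prems by (intro Cons.IH[of "pre @ [i]"]) auto
  ultimately show ?case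
    by (simp add: funpow_swap1)
qed

lemma sim_pc_update [simp]: "sim s (\<sigma>\<lparr>pc := k\<rparr>) = sim s \<sigma>"
  by (simp add: sim_def)

text \<open>\<open>t\<close> only bounds the number of steps, because \<open>big_At\<close> charges
  two even for an atom that becomes a single instruction.\<close>

definition reaches :: "instr list \<Rightarrow> nat \<Rightarrow> config \<Rightarrow> st \<Rightarrow> nat \<Rightarrow> bool" where
  "reaches P t \<sigma> s k \<longleftrightarrow> (\<exists>t'\<le>t. sim s ((step wbits P ^^ t') \<sigma>) \<and> pc ((step wbits P ^^ t') \<sigma>) = k)"

lemma reaches_refl: "sim s \<sigma> \<Longrightarrow> pc \<sigma> = k \<Longrightarrow> reaches P t \<sigma> s k"
  unfolding reaches_def by (intro exI[of _ 0]) auto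

lemma reaches_step: "reaches P t (step wbits P \<sigma>) s k \<Longrightarrow> reaches P (Suc t) \<sigma> s k"
  unfolding reaches_def
  by (metis Suc_le_mono comp_apply funpow_Suc_right)

lemma reaches_trans:
  assumes "reaches P t \<sigma> s k"
    and "\<And>\<sigma>'. sim s \<sigma>' \<Longrightarrow> pc \<sigma>' = k \<Longrightarrow> reaches P u \<sigma>' s' k'"
  shows "reaches P (t + u) \<sigma> s' k'"
proof -
  obtain t' where t': "t' \<le> t" "sim s ((step wbits P ^^ t') \<sigma>)" "pc ((step wbits P ^^ t') \<sigma>) = k"
    using assms(1) unfolding reaches_def by auto
  obtain u' where u': "u' \<le> u" "sim s' ((step wbits P ^^ u') ((step wbits P ^^ t') \<sigma>))"
    "pc ((step wbits P ^^ u') ((step wbits P ^^ t') \<sigma>)) = k'"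
    using assms(2)[OF t'(2,3)] unfolding reaches_def by auto
  then show ?thesis unfolding reaches_def using t'(1)
    by (intro exI[of _ "u' + t'"]) (auto simp: funpow_add)
qed

lemma reaches_mono: "reaches P t \<sigma> s k \<Longrightarrow> t \<le> u \<Longrightarrow> reaches P u \<sigma> s k"
  unfolding reaches_def using order_trans by blast

text \<open>Code works only at the address for which it was compiled. \<open>pre\<close> and
  \<open>post\<close> are arbitrary so that the induction hypotheses apply to subprograms in
  place.\<close>

lemma compile_sim:
  assumes "big c s t s'" "sim s \<sigma>" "P = pre @ compile (length pre) c @ post" "pc \<sigma> = length pre"
  shows "reaches P t \<sigma> s' (length pre + len c)"
  using assms
proof (induction arbitrary: \<sigma> pre post rule: big.induct)
  case (big_At a s)
  have "(step wbits P ^^ length (acomp a)) \<sigma> = fold (exec_instr wbits) (acomp a) \<sigma>"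
    using big_At by (intro steps_straight_line[of P pre _ post] pc_exec_acomp) auto
  with acomp_sim[OF big_At(1,2)] big_At(4) length_acomp[of a] show ?case
    unfolding reaches_def by (intro exI[of _ "length (acomp a)"]) auto
next
  case (big_Skip s)
  then show ?case by (intro reaches_refl) auto
next
  case (big_Seq c s t s' d t' s'')
  have "reaches P t \<sigma> s' (length pre + len c)"
    using big_Seq.prems by (intro big_Seq.IH(1)[where post = "compile (length pre + len c) d @ post"]) auto
  then have "reaches P (t + t') \<sigma> s'' (length (pre @ compile (length pre) c) + len d)"
    using big_Seq.prems by (elim reaches_trans) (intro big_Seq.IH(2)[where post = post], auto)
  then show ?case by (simp add: add.assoc)
next
  case (big_IfW1 s x y c t s' d)
  \<comment> \<open>The code of \<open>d\<close> stands before that of \<open>c\<close> and belongs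
    to the prefix here.\<close>
  let ?pre = "pre @ JumpWLess (x + 10) (y + 10) (length pre + len d + 2) # compile (length pre + 1) d @
    [Jump (length pre + len d + 2 + len c)]"
  have st: "step wbits P \<sigma> = \<sigma>\<lparr>pc := length pre + len d + 2\<rparr>"
    using big_IfW1.prems big_IfW1.hyps
    by (subst step_exec[of P pre]) (auto simp: sim_def)
  have "reaches P t (step wbits P \<sigma>) s' (length ?pre + len c)"
    using big_IfW1.prems unfolding st by (intro big_IfW1.IH[where post = post]) (auto simp: algebra_simps)
  from reaches_step[OF this] show ?case by (auto elim!: reaches_mono simp: algebra_simps)
next
  case (big_IfW2 s x y d t s' c)
  let ?pre = "pre @ [JumpWLess (x + 10) (y + 10) (length pre + len d + 2)]"
  have st: "step wbits P \<sigma> = \<sigma>\<lparr>pc := length pre + 1\<rparr>"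
    using big_IfW2.prems big_IfW2.hyps
    by (subst step_exec[of P pre]) (auto simp: sim_def)
  have "reaches P t (step wbits P \<sigma>) s' (length ?pre + len d)"
    using big_IfW2.prems unfolding st
    by (intro big_IfW2.IH[where post = "Jump (length pre + len d + 2 + len c) #
      compile (length pre + len d + 2) c @ post"]) (auto simp: algebra_simps)
  from reaches_step[OF this] have "reaches P (Suc t) \<sigma> s' (length ?pre + len d)" .
  \<comment> \<open>One step for the test and one for the jump over the code of \<open>c\<close> are
    the two units charged on top of \<open>t\<close>.\<close>
  then have "reaches P (Suc t + 1) \<sigma> s' (length pre + len (IfW x y c d))"
  proof (rule reaches_trans)
    fix \<sigma>' assume *: "sim s' \<sigma>'" "pc \<sigma>' = length ?pre + len d"
    have "step wbits P \<sigma>' = \<sigma>'\<lparr>pc := length pre + len d + 2 + len c\<rparr>"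
      using big_IfW2.prems *
      by (subst step_exec[of P "?pre @ compile (length pre + 1) d"]) auto
    then have "reaches P (Suc 0) \<sigma>' s' (length pre + len (IfW x y c d))"
      using * by (intro reaches_step reaches_refl) auto
    then show "reaches P 1 \<sigma>' s' (length pre + len (IfW x y c d))"
      by simp
  qed
  then show ?case by simp
next
  case (big_IfR1 s x y c t s' d)
  let ?pre = "pre @ JumpRLess x y (length pre + len d + 2) # compile (length pre + 1) d @
    [Jump (length pre + len d + 2 + len c)]"
  have st: "step wbits P \<sigma> = \<sigma>\<lparr>pc := length pre + len d + 2\<rparr>"
    using big_IfR1.prems big_IfR1.hyps
    by (subst step_exec[of P pre]) (auto simp: sim_def)
  have "reaches P t (step wbits P \<sigma>) s' (length ?pre + len c)"
    using big_IfR1.prems unfolding st by (intro big_IfR1.IH[where post = post]) (auto simp: algebra_simps)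
  from reaches_step[OF this] show ?case by (auto elim!: reaches_mono simp: algebra_simps)
next
  case (big_IfR2 s x y d t s' c)
  let ?pre = "pre @ [JumpRLess x y (length pre + len d + 2)]"
  have st: "step wbits P \<sigma> = \<sigma>\<lparr>pc := length pre + 1\<rparr>"
    using big_IfR2.prems big_IfR2.hyps
    by (subst step_exec[of P pre]) (auto simp: sim_def)
  have "reaches P t (step wbits P \<sigma>) s' (length ?pre + len d)"
    using big_IfR2.prems unfolding st
    by (intro big_IfR2.IH[where post = "Jump (length pre + len d + 2 + len c) #
      compile (length pre + len d + 2) c @ post"]) (auto simp: algebra_simps)
  from reaches_step[OF this] have "reaches P (Suc t) \<sigma> s' (length ?pre + len d)" .
  then have "reaches P (Suc t + 1) \<sigma> s' (length pre + len (IfR x y c d))"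
  proof (rule reaches_trans)
    fix \<sigma>' assume *: "sim s' \<sigma>'" "pc \<sigma>' = length ?pre + len d"
    have "step wbits P \<sigma>' = \<sigma>'\<lparr>pc := length pre + len d + 2 + len c\<rparr>"
      using big_IfR2.prems *
      by (subst step_exec[of P "?pre @ compile (length pre + 1) d"]) auto
    then have "reaches P (Suc 0) \<sigma>' s' (length pre + len (IfR x y c d))"
      using * by (intro reaches_step reaches_refl) auto
    then show "reaches P 1 \<sigma>' s' (length pre + len (IfR x y c d))"
      by simp
  qed
  then show ?case by simp
next
  case (big_While1 s x y c t s' t' s'')
  let ?pre = "pre @ [JumpWLess (x + 10) (y + 10) (length pre + 2), Jump (length pre + 3 + len c)]"
  have st: "step wbits P \<sigma> = \<sigma>\<lparr>pc := length pre + 2\<rparr>"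
    using big_While1.prems big_While1.hyps
    by (subst step_exec[of P pre]) (auto simp: sim_def)
  have "reaches P t (step wbits P \<sigma>) s' (length ?pre + len c)"
    using big_While1.prems unfolding st
    by (intro big_While1.IH(1)[where post = "Jump (length pre) # post"]) (auto simp: algebra_simps)
  from reaches_step[OF this] have "reaches P (Suc t) \<sigma> s' (length ?pre + len c)" .
  then have "reaches P (Suc t + Suc t') \<sigma> s'' (length pre + len (While x y c))"
  proof (rule reaches_trans)
    fix \<sigma>' assume *: "sim s' \<sigma>'" "pc \<sigma>' = length ?pre + len c"
    have "step wbits P \<sigma>' = \<sigma>'\<lparr>pc := length pre\<rparr>"
      using big_While1.prems *
      by (subst step_exec[of P "?pre @ compile (length pre + 2) c"]) auto
    then show "reaches P (Suc t') \<sigma>' s'' (length pre + len (While x y c))"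
      using * big_While1.prems by (intro reaches_step big_While1.IH(2)[where post = post]) auto
  qed
  then show ?case by simp
next
  case (big_While2 s x y c)
  let ?pre = "pre @ [JumpWLess (x + 10) (y + 10) (length pre + 2)]"
  have st: "step wbits P \<sigma> = \<sigma>\<lparr>pc := length pre + 1\<rparr>"
    using big_While2.prems big_While2.hyps
    by (subst step_exec[of P pre]) (auto simp: sim_def)
  have st2: "step wbits P (step wbits P \<sigma>) = \<sigma>\<lparr>pc := length pre + 3 + len c\<rparr>"
    unfolding st using big_While2.prems
    by (subst step_exec[of P ?pre "Jump (length pre + 3 + len c)" "compile (length pre + 2) c @ Jump (length pre) # post"])
      (auto simp: algebra_simps)
  have "reaches P (Suc (Suc 0)) \<sigma> s (length pre + len (While x y c))"
    by (intro reaches_step reaches_refl; unfold st2) (simp_all add: \<open>sim s \<sigma>\<close>)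
  then show ?case by (simp add: numeral_2_eq_2)
qed

section \<open>Program logic with a time counter\<close>

text \<open>The last argument of \<open>wp\<close> and of the postcondition is the time spent so far.\<close>

definition wp :: "com \<Rightarrow> (st \<Rightarrow> nat \<Rightarrow> bool) \<Rightarrow> st \<Rightarrow> nat \<Rightarrow> bool" where
  "wp c P s a \<longleftrightarrow> (\<exists>t s'. big c s t s' \<and> P s' (a + t))"

lemma wp_At: "wp (At i) P s a \<longleftrightarrow> aok i s \<and> P (aexec i s) (a + 2)"
  unfolding wp_def by (blast elim: big.cases intro: big_At)

lemma wp_Skip: "wp Skip P s a \<longleftrightarrow> P s a"
  unfolding wp_def by (force elim: big.cases intro: big_Skip)

lemma wp_Seq: "wp (c ;; d) P s a \<longleftrightarrow> wp c (wp d P) s a"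
  unfolding wp_def by (fastforce elim: big.cases intro: big_Seq simp: add.assoc)

lemma wp_IfW:
  "wp (IfW x y c d) P s a \<longleftrightarrow> (if wv s x < wv s y then wp c P s (a + 2) else wp d P s (a + 2))"
proof -
  have "big (IfW x y c d) s t s' \<longleftrightarrow>
      (\<exists>u. t = u + 2 \<and> (if wv s x < wv s y then big c s u s' else big d s u s'))" for t s'
    by (cases "wv s x < wv s y") (auto elim: big.cases intro: big_IfW1 big_IfW2 simp del: add_2_eq_Suc')
  moreover have "a + 2 + u = a + (u + 2)" for u by simp
  ultimately show ?thesis
    unfolding wp_def by (cases "wv s x < wv s y") (simp only: if_True if_False simp_thms, blast)+
qed

lemma wp_IfR:
  "wp (IfR x y c d) P s a \<longleftrightarrow> (if rv s x < rv s y then wp c P s (a + 2) else wp d P s (a + 2))"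
proof -
  have "big (IfR x y c d) s t s' \<longleftrightarrow>
      (\<exists>u. t = u + 2 \<and> (if rv s x < rv s y then big c s u s' else big d s u s'))" for t s'
    by (cases "rv s x < rv s y") (auto elim: big.cases intro: big_IfR1 big_IfR2 simp del: add_2_eq_Suc')
  moreover have "a + 2 + u = a + (u + 2)" for u by simp
  ultimately show ?thesis
    unfolding wp_def by (cases "rv s x < rv s y") (simp only: if_True if_False simp_thms, blast)+
qed

lemma wp_mono: "wp c P s a \<Longrightarrow> (\<And>s' a'. P s' a' \<Longrightarrow> P' s' a') \<Longrightarrow> wp c P' s a"
  unfolding wp_def by blast

lemma wp_While_enter:
  "wv s x < wv s y \<Longrightarrow> wp c (wp (While x y c) P) s (a + 2) \<Longrightarrow> wp (While x y c) P s a"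
  unfolding wp_def
proof (elim exE conjE)
  fix t s' t' s''
  assume "wv s x < wv s y" "big c s t s'" "big (While x y c) s' t' s''" "P s'' (a + 2 + t + t')"
  then show "\<exists>t s'. big (While x y c) s t s' \<and> P s' (a + t)"
    using big_While1[of s x y c t s' t' s'']
    by (intro exI[of _ "t + t' + 2"] exI[of _ s'']) (auto simp: ac_simps)
qed

lemma wp_While_exit:
  "\<not> wv s x < wv s y \<Longrightarrow> P s (a + 2) \<Longrightarrow> wp (While x y c) P s a"
  unfolding wp_def by (blast intro: big_While2)

text \<open>The number \<open>m\<close> of rounds is fixed in advance, and induction on the rounds
  that remain yields termination as well. Each round pays \<open>C\<close> for the body and two for
  its test; the failing test costs two more.\<close>

lemma wp_for:
  assumes init: "J 0 s"
    and cond: "\<And>k s'. J k s' \<Longrightarrow> wv s' x < wv s' y \<longleftrightarrow> k < m"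
    and body: "\<And>k s' a'. k < m \<Longrightarrow> J k s' \<Longrightarrow> wp c (\<lambda>s'' a''. J (Suc k) s'' \<and> a'' \<le> a' + C) s' a'"
    and fin: "\<And>s' a'. J m s' \<Longrightarrow> a' \<le> a + m * (C + 2) + 2 \<Longrightarrow> P s' a'"
  shows "wp (While x y c) P s a"
proof -
  have "wp (While x y c) P s' a'" if "J k s'" "k \<le> m" "a' \<le> a + k * (C + 2)" for k s' a'
    using that
  proof (induction "m - k" arbitrary: k s' a')
    case 0
    then have "k = m" by simp
    with 0 show ?case by (intro wp_While_exit fin) (auto simp: cond)
  next
    case (Suc j)
    then have "k < m" by simp
    have "wp c (\<lambda>s'' a''. J (Suc k) s'' \<and> a'' \<le> a' + 2 + C) s' (a' + 2)"
      using body[OF \<open>k < m\<close> Suc.prems(1)] .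
    then have "wp c (wp (While x y c) P) s' (a' + 2)"
    proof (rule wp_mono)
      fix s'' a'' assume "J (Suc k) s'' \<and> a'' \<le> a' + 2 + C"
      then show "wp (While x y c) P s'' a''"
        using Suc.prems Suc.hyps(2) \<open>k < m\<close> by (intro Suc.hyps(1)[of "Suc k"]) auto
    qed
    then show ?case using Suc.prems \<open>k < m\<close> by (intro wp_While_enter) (auto simp: cond)
  qed
  from this[of 0 s a] init show ?thesis by simp
qed

lemmas wp_simps = wp_At wp_Skip wp_Seq wp_IfW wp_IfR

end

declare add_2_eq_Suc [simp del] add_2_eq_Suc' [simp del]

section \<open>Merge sort\<close>

text \<open>Ties between keys are broken by the item number, so that copies of one point are
  contiguous after sorting even if another point lies on the same line through the pivot.
  \<open>sep_inU\<close> relies on this.\<close>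

definition kle :: "real \<times> nat \<Rightarrow> real \<times> nat \<Rightarrow> bool" where
  "kle x y \<longleftrightarrow> fst x < fst y \<or> fst x = fst y \<and> snd x \<le> snd y"

lemma kle_trans: "kle x y \<Longrightarrow> kle y z \<Longrightarrow> kle x z"
  by (auto simp: kle_def)

abbreviation kin :: "st \<Rightarrow> nat \<Rightarrow> real \<times> nat" where
  "kin s i \<equiv> (ra s 2 i, wa s 2 i)"

abbreviation kout :: "st \<Rightarrow> nat \<Rightarrow> real \<times> nat" where
  "kout s i \<equiv> (ra s 3 i, wa s 3 i)"

abbreviation (input) "vSize \<equiv> 40 :: nat"
abbreviation (input) "vWidth \<equiv> 41 :: nat"
abbreviation (input) "vStart \<equiv> 42 :: nat"
abbreviation (input) "vA \<equiv> 43 :: nat"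
abbreviation (input) "vEndA \<equiv> 44 :: nat"
abbreviation (input) "vB \<equiv> 45 :: nat"
abbreviation (input) "vEndB \<equiv> 46 :: nat"
abbreviation (input) "vOut \<equiv> 47 :: nat"
abbreviation (input) "vTake \<equiv> 48 :: nat"
abbreviation (input) "vP \<equiv> 49 :: nat"
abbreviation (input) "vP' \<equiv> 50 :: nat"

text \<open>The only tests are strict comparisons. Equality of two real keys shows as two failed
  tests, and only then are the item numbers compared.\<close>

definition merge_select :: com where
  "merge_select =
     (let takeA = At (Mov vTake vA) ;; At (AddI vA vA 1);
          takeB = At (Mov vTake vB) ;; At (AddI vB vB 1)
      in IfW vA vEndA
           (IfW vB vEndB
              (At (RLd 40 2 vB) ;; At (RLd 41 2 vA) ;;
               IfR 40 41 takeB
                 (IfR 41 40 takeA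
                    (At (Ld vP 2 vB) ;; At (Ld vP' 2 vA) ;; IfW vP vP' takeB takeA)))
              takeA)
           takeB)"

definition merge_step :: com where
  "merge_step = merge_select ;;
     At (RLd 40 2 vTake) ;; At (RSt 3 vOut 40) ;; At (Ld vP 2 vTake) ;; At (St 3 vOut vP) ;;
     At (AddI vOut vOut 1)"

definition merge_block :: com where
  "merge_block =
     At (Mov vA vStart) ;; At (Add vEndA vStart vWidth) ;;
     IfW vSize vEndA (At (Mov vEndA vSize)) Skip ;;
     At (Mov vB vEndA) ;; At (Add vEndB vEndA vWidth) ;;
     IfW vSize vEndB (At (Mov vEndB vSize)) Skip ;;
     At (Mov vOut vStart) ;;
     While vOut vEndB merge_step ;;
     At (Mov vStart vEndB)"

definition copy_back :: com where
  "copy_back = At (Cst vStart 0) ;;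
     While vStart vSize
       (At (RLd 40 3 vStart) ;; At (RSt 2 vStart 40) ;; At (Ld vP 3 vStart) ;; At (St 2 vStart vP) ;;
        At (AddI vStart vStart 1))"

definition sort_prog :: com where
  "sort_prog = At (Cst vWidth 1) ;;
     While vWidth vSize
       (At (Cst vStart 0) ;; While vStart vSize merge_block ;; copy_back ;;
        At (Add vWidth vWidth vWidth))"

text \<open>Registers below 40 belong to the callers of the sorting program.\<close>

definition sort_frame :: "st \<Rightarrow> st \<Rightarrow> bool" where
  "sort_frame s s' \<longleftrightarrow> (\<forall>r\<le>40. wv s' r = wv s r) \<and> (\<forall>r<40. rv s' r = rv s r) \<and>
     (\<forall>a. a \<noteq> 2 \<and> a \<noteq> 3 \<longrightarrow> wa s' a = wa s a \<and> ra s' a = ra s a)"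

lemma sort_frame_trans: "sort_frame s s' \<Longrightarrow> sort_frame s' s'' \<Longrightarrow> sort_frame s s''"
  by (auto simp: sort_frame_def)

lemma mset_map_upt_Suc:
  "i \<le> j \<Longrightarrow> mset (map f [i..<Suc j]) = add_mset (f j) (mset (map f [i..<j]))"
  by simp

lemma sorted_wrt_map_upt:
  "sorted_wrt R (map f [a..<b]) \<longleftrightarrow> (\<forall>i j. a \<le> i \<and> i < j \<and> j < b \<longrightarrow> R (f i) (f j))"
proof
  assume *: "sorted_wrt R (map f [a..<b])"
  show "\<forall>i j. a \<le> i \<and> i < j \<and> j < b \<longrightarrow> R (f i) (f j)"
  proof (intro allI impI)
    fix i j assume ij: "a \<le> i \<and> i < j \<and> j < b"
    then have "R (map f [a..<b] ! (i - a)) (map f [a..<b] ! (j - a))"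
      by (intro sorted_wrt_nth_less[OF *]) auto
    then show "R (f i) (f j)" using ij by auto
  qed
qed (auto simp: sorted_wrt_iff_nth_less)

context ram
begin

lemma merge_select_wp:
  assumes ne: "wv s vA < wv s vEndA \<or> wv s vB < wv s vEndB"
    and bd: "wv s vEndA < Q" "wv s vEndB < Q"
    and P: "\<And>s' t'. \<lbrakk>wa s' = wa s; ra s' = ra s;
      \<forall>r. r \<noteq> vA \<and> r \<noteq> vB \<and> r \<noteq> vTake \<and> r \<noteq> vP \<and> r \<noteq> vP' \<longrightarrow> wv s' r = wv s r;
      \<forall>r<40. rv s' r = rv s r; t' \<le> t + 22;
      wv s' vTake = wv s vA \<and> wv s' vA = wv s vA + 1 \<and> wv s' vB = wv s vB \<and>
        wv s vA < wv s vEndA \<and>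
        (wv s vB < wv s vEndB \<longrightarrow> kle (kin s (wv s vA)) (kin s (wv s vB))) \<or>
      wv s' vTake = wv s vB \<and> wv s' vB = wv s vB + 1 \<and> wv s' vA = wv s vA \<and>
        wv s vB < wv s vEndB \<and>
        (wv s vA < wv s vEndA \<longrightarrow> kle (kin s (wv s vB)) (kin s (wv s vA)))\<rbrakk> \<Longrightarrow> P s' t'"
  shows "wp merge_select P s t"
proof -
  have qA: "Suc (wv s vA) < 64 * Q" "wv s vA < 64 * Q" "wv s vA < Q" if "wv s vA < wv s vEndA"
    using bd that by linarith+
  have qB: "Suc (wv s vB) < 64 * Q" "wv s vB < 64 * Q" "wv s vB < Q" if "wv s vB < wv s vEndB"
    using bd that by linarith+
  consider "wv s vA < wv s vEndA" "wv s vB < wv s vEndB" "ra s 2 (wv s vB) < ra s 2 (wv s vA)"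
    | "wv s vA < wv s vEndA" "wv s vB < wv s vEndB" "ra s 2 (wv s vA) < ra s 2 (wv s vB)"
    | "wv s vA < wv s vEndA" "wv s vB < wv s vEndB" "ra s 2 (wv s vA) = ra s 2 (wv s vB)"
      "wa s 2 (wv s vB) < wa s 2 (wv s vA)"
    | "wv s vA < wv s vEndA" "wv s vB < wv s vEndB" "ra s 2 (wv s vA) = ra s 2 (wv s vB)"
      "\<not> wa s 2 (wv s vB) < wa s 2 (wv s vA)"
    | "wv s vA < wv s vEndA" "\<not> wv s vB < wv s vEndB"
    | "\<not> wv s vA < wv s vEndA" "wv s vB < wv s vEndB"
    using ne by argo
  then show ?thesis
    unfolding merge_select_def Let_def
    by cases (simp add: wp_simps qA qB, (rule P; simp add: kle_def))+
qed

lemma wp_min: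
  assumes "wv s x < 64 * Q"
    and "\<And>t'. t' \<le> t + 4 \<Longrightarrow> P (s\<lparr>wv := (wv s)(y := min (wv s x) (wv s y))\<rparr>) t'"
  shows "wp (IfW x y (At (Mov y x)) Skip) P s t"
proof -
  have "s\<lparr>wv := (wv s)(y := wv s y)\<rparr> = s" by simp
  with assms(1) assms(2)[of "t + 2"] assms(2)[of "t + 2 + 2"] show ?thesis
    by (auto simp: wp_IfW wp_At wp_Skip min_def split: if_splits)
qed

text \<open>The minima cut the two runs off at the end of the array; the second run may be
  empty.\<close>

lemma merge_block_wp:
  assumes n: "st0 < n" "n < Q" and wd: "0 < wd" "wd \<le> n"
    and v: "wv s vSize = n" "wv s vWidth = wd" "wv s vStart = st0"
    and srt: "sorted_wrt kle (map (kin s) [st0..<min n (st0 + wd)])"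
      "sorted_wrt kle (map (kin s) [min n (st0 + wd)..<min n (st0 + 2 * wd)])"
    and P: "\<And>s' t'. \<lbrakk>sort_frame s s'; wv s' vWidth = wd; wv s' vStart = min n (st0 + 2 * wd);
      wa s' 2 = wa s 2; ra s' 2 = ra s 2; \<And>i. i < st0 \<Longrightarrow> kout s' i = kout s i;
      sorted_wrt kle (map (kout s') [st0..<min n (st0 + 2 * wd)]);
      mset (map (kout s') [st0..<min n (st0 + 2 * wd)]) =
      mset (map (kin s) [st0..<min n (st0 + 2 * wd)]); t' \<le> t + 80 * wd + 40\<rbrakk> \<Longrightarrow> P s' t'"
  shows "wp merge_block P s t"
proof -
  define ea where "ea = min n (st0 + wd)"
  define eb where "eb = min n (st0 + 2 * wd)"
  have e: "st0 < ea" "ea \<le> eb" "eb < Q" "st0 \<le> eb" "eb \<le> st0 + 2 * wd"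
    using n wd by (auto simp: ea_def eb_def)
  have eb': "min n (ea + wd) = eb" using n wd by (auto simp: ea_def eb_def)
  \<comment> \<open>The last conjunct is what keeps the output sorted: whatever has been written is
    below whatever still waits in either run.\<close>
  define J where "J k s' \<longleftrightarrow> sort_frame s s' \<and> wv s' vWidth = wd \<and>
      wa s' 2 = wa s 2 \<and> ra s' 2 = ra s 2 \<and> (\<forall>i<st0. kout s' i = kout s i) \<and>
      wv s' vEndA = ea \<and> wv s' vEndB = eb \<and> wv s' vOut = st0 + k \<and>
      st0 \<le> wv s' vA \<and> wv s' vA \<le> ea \<and> ea \<le> wv s' vB \<and> wv s' vB \<le> eb \<and>
      (wv s' vA - st0) + (wv s' vB - ea) = k \<and>
      sorted_wrt kle (map (kout s') [st0..<st0 + k]) \<and>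
      mset (map (kout s') [st0..<st0 + k]) =
        mset (map (kin s) [st0..<wv s' vA]) + mset (map (kin s) [ea..<wv s' vB]) \<and>
      (\<forall>i\<in>{st0..<st0 + k}. \<forall>j\<in>{wv s' vA..<ea} \<union> {wv s' vB..<eb}. kle (kout s' i) (kin s j))"
    for k s'
  have inner: "wp (While vOut vEndB merge_step)
      (\<lambda>s' t'. J (eb - st0) s' \<and> t' \<le> t0 + (eb - st0) * 34 + 2) s' t0" if "J 0 s'" for s' t0
  proof (rule wp_for[where J = J and m = "eb - st0" and C = 32])
    show "J 0 s'" by fact
    show "(wv s' vOut < wv s' vEndB) = (k < eb - st0)" if "J k s'" for k s'
      using that by (auto simp: J_def)
    fix k s' t' assume k: "k < eb - st0" and J: "J k s'"
    let ?a = "wv s' vA" and ?b = "wv s' vB"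
    have vals: "wv s' vEndA = ea" "wv s' vEndB = eb" "wv s' vOut = st0 + k"
      and rng: "st0 \<le> ?a" "?a \<le> ea" "ea \<le> ?b" "?b \<le> eb" and sm: "(?a - st0) + (?b - ea) = k"
      and ar: "wa s' 2 = wa s 2" "ra s' 2 = ra s 2"
      and so: "sorted_wrt kle (map (kout s') [st0..<st0 + k])"
      and ms: "mset (map (kout s') [st0..<st0 + k]) =
        mset (map (kin s) [st0..<?a]) + mset (map (kin s) [ea..<?b])"
      and le: "\<forall>i\<in>{st0..<st0 + k}. \<forall>j\<in>{?a..<ea} \<union> {?b..<eb}. kle (kout s' i) (kin s j)"
      and low: "\<forall>i<st0. kout s' i = kout s i"
      using J by (auto simp: J_def)
    show "wp merge_step (\<lambda>s'' t''. J (Suc k) s'' \<and> t'' \<le> t' + 32) s' t'"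
      unfolding merge_step_def
    proof (subst wp_Seq, rule merge_select_wp)
      show "wv s' vA < wv s' vEndA \<or> wv s' vB < wv s' vEndB"
        unfolding vals using sm k rng by linarith
      show "wv s' vEndA < Q" "wv s' vEndB < Q" using vals e by auto
      fix s2 :: st and t2
      assume 2: "wa s2 = wa s'" "ra s2 = ra s'"
        "\<forall>r. r \<noteq> vA \<and> r \<noteq> vB \<and> r \<noteq> vTake \<and> r \<noteq> vP \<and> r \<noteq> vP' \<longrightarrow> wv s2 r = wv s' r"
        "\<forall>r<40. rv s2 r = rv s' r" "t2 \<le> t' + 22"
        "wv s2 vTake = ?a \<and> wv s2 vA = ?a + 1 \<and> wv s2 vB = ?b \<and> ?a < wv s' vEndA \<and>
          (?b < wv s' vEndB \<longrightarrow> kle (kin s' ?a) (kin s' ?b)) \<or>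
         wv s2 vTake = ?b \<and> wv s2 vB = ?b + 1 \<and> wv s2 vA = ?a \<and> ?b < wv s' vEndB \<and>
          (?a < wv s' vEndA \<longrightarrow> kle (kin s' ?b) (kin s' ?a))"
      define tk where "tk = wv s2 vTake"
      define a' where "a' = wv s2 vA"
      define b' where "b' = wv s2 vB"
      have tkQ: "tk < Q" using 2(6) vals e unfolding tk_def by auto
      have oQ: "st0 + k < Q" using k e by linarith
      have rng': "st0 \<le> a'" "a' \<le> ea" "ea \<le> b'" "b' \<le> eb" "(a' - st0) + (b' - ea) = Suc k"
        using 2(6) vals rng sm unfolding a'_def b'_def by auto
      have ms': "add_mset (kin s tk) (mset (map (kin s) [st0..<?a]) + mset (map (kin s) [ea..<?b])) =
          mset (map (kin s) [st0..<a']) + mset (map (kin s) [ea..<b'])"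
        using 2(6) vals rng unfolding a'_def b'_def tk_def by (auto simp del: mset_upt mset_map simp: mset_map_upt_Suc)
      have tkin: "tk \<in> {?a..<ea} \<union> {?b..<eb}"
        using 2(6) vals rng unfolding tk_def by auto
      have sA: "kle (kin s i) (kin s j)" if "st0 \<le> i" "i < j" "j < ea" for i j
        using srt(1) that unfolding ea_def[symmetric] sorted_wrt_map_upt by blast
      have sB: "kle (kin s i) (kin s j)" if "ea \<le> i" "i < j" "j < eb" for i j
        using srt(2) that unfolding ea_def[symmetric] eb_def[symmetric] sorted_wrt_map_upt by blast
      \<comment> \<open>The entry taken is a least one among those waiting: within its own run by
        sortedness, in the other run by the comparison of the two heads.\<close>
      have min: "kle (kin s tk) (kin s j)" if j: "j \<in> {a'..<ea} \<union> {b'..<eb}" for j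
      proof -
        have kin_eq: "kin s' i = kin s i" for i using ar by simp
        from 2(6) show ?thesis
        proof
          assume A: "wv s2 vTake = ?a \<and> wv s2 vA = ?a + 1 \<and> wv s2 vB = ?b \<and> ?a < wv s' vEndA \<and>
            (?b < wv s' vEndB \<longrightarrow> kle (kin s' ?a) (kin s' ?b))"
          then have tk: "tk = ?a" "a' = ?a + 1" "b' = ?b"
            and c: "?b < eb \<longrightarrow> kle (kin s ?a) (kin s ?b)"
            by (auto simp: tk_def a'_def b'_def kin_eq vals ar)
          show ?thesis
          proof (cases "j < ea \<and> a' \<le> j")
            case True
            then show ?thesis using sA[of ?a j] tk rng by auto
          next
            case False
            then have "?b \<le> j" "j < eb" using j tk by auto
            then show ?thesis using c sB[of ?b j] rng tk kle_trans by (cases "j = ?b") auto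
          qed
        next
          assume A: "wv s2 vTake = ?b \<and> wv s2 vB = ?b + 1 \<and> wv s2 vA = ?a \<and> ?b < wv s' vEndB \<and>
            (?a < wv s' vEndA \<longrightarrow> kle (kin s' ?b) (kin s' ?a))"
          then have tk: "tk = ?b" "a' = ?a" "b' = ?b + 1"
            and c: "?a < ea \<longrightarrow> kle (kin s ?b) (kin s ?a)"
            by (auto simp: tk_def a'_def b'_def kin_eq vals ar)
          show ?thesis
          proof (cases "j < eb \<and> b' \<le> j")
            case True
            then show ?thesis using sB[of ?b j] tk rng by auto
          next
            case False
            then have "?a \<le> j" "j < ea" using j tk by auto
            then show ?thesis using c sA[of ?a j] rng tk kle_trans by (cases "j = ?a") auto
          qed
        qed
      qed
      define s3 :: st where "s3 = s2\<lparr>wv := (wv s2)(vP := wa s 2 tk, vOut := Suc (st0 + k)),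
        rv := (rv s2)(40 := ra s 2 tk),
        ra := (ra s')(3 := (ra s' 3)(st0 + k := ra s 2 tk)),
        wa := (wa s')(3 := (wa s' 3)(st0 + k := wa s 2 tk))\<rparr>"
      have o3: "kout s3 i = (if i = st0 + k then kin s tk else kout s' i)" for i
        by (simp add: s3_def)
      have "J (Suc k) s3"
      proof -
        have fr: "sort_frame s s3"
          using J 2 unfolding J_def sort_frame_def s3_def by auto
        have m: "map (kout s3) [st0..<st0 + k] = map (kout s') [st0..<st0 + k]"
          using o3 by (intro map_cong) auto
        have m2: "map (kout s3) [st0..<st0 + Suc k] = map (kout s') [st0..<st0 + k] @ [kin s tk]"
          using m o3[of "st0 + k"] by simp
        have ms3: "mset (map (kout s3) [st0..<st0 + Suc k]) =
            mset (map (kin s) [st0..<a']) + mset (map (kin s) [ea..<b'])"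
          unfolding m2 using ms ms' by simp
        have so3: "sorted_wrt kle (map (kout s3) [st0..<st0 + Suc k])"
          unfolding m2 using so le tkin by (auto simp: sorted_wrt_append)
        have le3: "\<forall>i\<in>{st0..<st0 + Suc k}. \<forall>j\<in>{a'..<ea} \<union> {b'..<eb}. kle (kout s3 i) (kin s j)"
        proof (intro ballI)
          fix i j assume i: "i \<in> {st0..<st0 + Suc k}" and j: "j \<in> {a'..<ea} \<union> {b'..<eb}"
          have "?a \<le> a'" "?b \<le> b'" using 2(6) by (auto simp: a'_def b'_def)
          then have "j \<in> {?a..<ea} \<union> {?b..<eb}" using j by auto
          then show "kle (kout s3 i) (kin s j)"
            using i j le min[OF j] unfolding o3 by (cases "i = st0 + k") auto
        qed
        have vs: "wv s3 vWidth = wd" "wv s3 vEndA = ea" "wv s3 vEndB = eb" "wv s3 vA = a'"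
          "wv s3 vB = b'" "wv s3 vOut = st0 + Suc k" "wa s3 2 = wa s 2" "ra s3 2 = ra s 2"
          using 2 vals ar J by (auto simp: s3_def a'_def b'_def J_def)
        have "\<forall>i<st0. kout s3 i = kout s i" using low o3 by auto
        then show ?thesis using fr ms3 so3 le3 vs rng' unfolding J_def by simp
      qed
      moreover have "wp (At (RLd 40 2 vTake) ;; At (RSt 3 vOut 40) ;; At (Ld vP 2 vTake) ;;
          At (St 3 vOut vP) ;; At (AddI vOut vOut 1)) (\<lambda>s4 t4. s4 = s3 \<and> t4 = t2 + 10) s2 t2"
        using 2(1-5) vals tkQ oQ ar
        by (simp add: wp_simps s3_def flip: tk_def)
      ultimately show "wp (At (RLd 40 2 vTake) ;; At (RSt 3 vOut 40) ;; At (Ld vP 2 vTake) ;;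
          At (St 3 vOut vP) ;; At (AddI vOut vOut 1))
          (\<lambda>s'' t''. J (Suc k) s'' \<and> t'' \<le> t' + 32) s2 t2"
        using 2(5) by (auto elim!: wp_mono)
    qed
  next
    fix s' a' assume "J (eb - st0) s'" "a' \<le> t0 + (eb - st0) * (32 + 2) + 2"
    then show "J (eb - st0) s' \<and> a' \<le> t0 + (eb - st0) * 34 + 2" by simp
  qed
  have fin: "P s2 (t2 + 2)" if s2: "s2 = s'\<lparr>wv := (wv s')(vStart := eb)\<rparr>" and J: "J (eb - st0) s'"
    and t2: "t2 \<le> t + 20 + (eb - st0) * 34 + 2" for s' s2 t2
  proof (rule P)
    have ab: "wv s' vA = ea" "wv s' vB = eb" using J e by (auto simp: J_def)
    have eq: "st0 + (eb - st0) = eb" using e by simp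
    have sp: "[st0..<ea] @ [ea..<eb] = [st0..<eb]"
      using e by (metis less_imp_le_nat le_add_diff_inverse upt_add_eq_append)
    show "sort_frame s s2" using J by (auto simp: J_def s2 sort_frame_def)
    show "wv s2 vWidth = wd" "wv s2 vStart = min n (st0 + 2 * wd)" "wa s2 2 = wa s 2" "ra s2 2 = ra s 2"
      using J by (auto simp: J_def s2 eb_def)
    show "kout s2 i = kout s i" if "i < st0" for i using J that by (simp add: J_def s2)
    show "sorted_wrt kle (map (kout s2) [st0..<min n (st0 + 2 * wd)])"
      using J by (simp add: J_def s2 eb_def[symmetric] eq)
    show "mset (map (kout s2) [st0..<min n (st0 + 2 * wd)]) =
      mset (map (kin s) [st0..<min n (st0 + 2 * wd)])"
    proof -
      have "mset (map (kin s) [st0..<ea]) + mset (map (kin s) [ea..<eb]) = mset (map (kin s) [st0..<eb])"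
        by (metis sp map_append mset_append)
      then show ?thesis
        using J by (simp add: J_def s2 eb_def[symmetric] eq ab del: mset_upt mset_map)
    qed
    show "t2 + 2 \<le> t + 80 * wd + 40" using t2 e by linarith
  qed
  have "n + wd < 64 * Q" "st0 + wd < 64 * Q" "ea < 64 * Q" "eb < 64 * Q" "n < 64 * Q" "st0 < 64 * Q" "ea + wd < 64 * Q"
    using n wd e by linarith+
  moreover have J0: "J 0 s'" if "sort_frame s s'" "wv s' vWidth = wd"
      "wa s' = wa s" "ra s' = ra s" "wv s' vEndA = ea" "wv s' vEndB = eb"
      "wv s' vOut = st0" "wv s' vA = st0" "wv s' vB = ea" for s'
    using that e by (simp add: J_def)
  moreover have J_end: "wv s' vEndB = eb" if "J k s' \<and> X" for k s' X using that by (simp add: J_def)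
  ultimately show ?thesis
    unfolding merge_block_def
    apply (simp add: wp_Seq wp_At v)
    apply (rule wp_min; simp add: v wp_Seq wp_At flip: ea_def)
    apply (rule wp_min; simp add: v wp_Seq wp_At eb' flip: ea_def)
    apply (rule wp_mono[OF inner])
    apply (rule J0)
    apply (simp_all add: sort_frame_def v wp_At J_end)
    apply (rule fin[OF refl])
    apply auto
    done
qed

lemma copy_back_wp:
  assumes n: "n < Q" "wv s vSize = n"
    and P: "\<And>s' t'. \<lbrakk>sort_frame s s'; wv s' vWidth = wv s vWidth;
      \<And>i. i < n \<Longrightarrow> kin s' i = kout s i; t' \<le> t + 20 * n + 10\<rbrakk> \<Longrightarrow> P s' t'"
  shows "wp copy_back P s t"
proof -
  define J where "J k s' \<longleftrightarrow> sort_frame s s' \<and> wv s' vWidth = wv s vWidth \<and> wv s' vStart = k \<and> k \<le> n \<and>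
    wa s' 3 = wa s 3 \<and> ra s' 3 = ra s 3 \<and> (\<forall>i<k. kin s' i = kout s i)" for k s'
  have "wp (While vStart vSize
       (At (RLd 40 3 vStart) ;; At (RSt 2 vStart 40) ;; At (Ld vP 3 vStart) ;; At (St 2 vStart vP) ;;
        At (AddI vStart vStart 1))) P (s\<lparr>wv := (wv s)(vStart := 0)\<rparr>) (t + 2)"
  proof (rule wp_for[where J = J and m = n and C = 10])
    show "J 0 (s\<lparr>wv := (wv s)(vStart := 0)\<rparr>)" by (simp add: J_def sort_frame_def)
    show "(wv s' vStart < wv s' vSize) = (k < n)" if "J k s'" for k s'
      using that n by (simp add: J_def sort_frame_def)
    fix k s' t' assume "k < n" "J k s'"
    then show "wp (At (RLd 40 3 vStart) ;; At (RSt 2 vStart 40) ;; At (Ld vP 3 vStart) ;; At (St 2 vStart vP) ;;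
        At (AddI vStart vStart 1)) (\<lambda>s'' a''. J (Suc k) s'' \<and> a'' \<le> t' + 10) s' t'"
      using n by (auto simp: wp_simps J_def sort_frame_def less_Suc_eq)
  next
    fix s' t' assume "J n s'" "t' \<le> t + 2 + n * (10 + 2) + 2"
    then show "P s' t'" by (intro P) (auto simp: J_def)
  qed
  then show ?thesis unfolding copy_back_def by (simp add: wp_Seq wp_At)
qed

text \<open>Rewrites the test of a loop that increases \<open>g k\<close> until it reaches
  \<open>n\<close> into the form \<open>k < m\<close> that \<open>wp_for\<close> expects.\<close>

lemma less_Least_iff:
  fixes g :: "nat \<Rightarrow> nat"
  assumes "mono g" "n \<le> g k0"
  shows "k < (LEAST k. n \<le> g k) \<longleftrightarrow> g k < n"
proof
  assume "k < (LEAST k. n \<le> g k)"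
  then show "g k < n" using not_less_Least not_le by blast
next
  assume "g k < n"
  moreover have "n \<le> g (LEAST k. n \<le> g k)" using assms(2) by (rule LeastI)
  ultimately show "k < (LEAST k. n \<le> g k)"
    using monoD[OF assms(1), of "LEAST k. n \<le> g k" k] by linarith
qed

definition block_sorted :: "(nat \<Rightarrow> real \<times> nat) \<Rightarrow> nat \<Rightarrow> nat \<Rightarrow> bool" where
  "block_sorted f w n \<longleftrightarrow> (\<forall>i j. i < j \<and> j < n \<and> i div w = j div w \<longrightarrow> kle (f i) (f j))"

lemma merge_pass_wp:
  assumes n: "n < Q" "wv s vSize = n" "wv s vStart = 0" "wv s vWidth = wd" and wd: "0 < wd" "wd < n"
    and srt: "block_sorted (kin s) wd n"
    and P: "\<And>s' t'. \<lbrakk>sort_frame s s'; wv s' vWidth = wd; block_sorted (kout s') (2 * wd) n;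
      mset (map (kout s') [0..<n]) = mset (map (kin s) [0..<n]); t' \<le> t + 170 * n + 2\<rbrakk> \<Longrightarrow> P s' t'"
  shows "wp (While vStart vSize merge_block) P s t"
proof -
  define m where "m = (LEAST k. n \<le> 2 * wd * k)"
  have mono: "mono (\<lambda>k. 2 * wd * k)" by (auto simp: mono_def)
  have n0: "n \<le> 2 * wd * n" using wd by (cases wd) auto
  have m: "k < m \<longleftrightarrow> 2 * wd * k < n" for k
    unfolding m_def using less_Least_iff[OF mono, of n n k] n0 by simp
  have m_le: "m \<le> n" unfolding m_def using n0 by (rule Least_le)
  have nm: "n \<le> 2 * wd * m" using m[of m] by simp
  \<comment> \<open>By minimality of \<open>m\<close> the blocks reach beyond \<open>n\<close> by
    less than \<open>2 * wd\<close>, and \<open>wd < n\<close>.\<close>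
  have m_cost: "2 * wd * m \<le> 3 * n"
  proof (cases m)
    case (Suc j)
    then have "2 * wd * j < n" using m[of j] by simp
    then show ?thesis using Suc wd by (simp add: algebra_simps)
  qed simp
  define J where "J k s' \<longleftrightarrow> sort_frame s s' \<and> wv s' vWidth = wd \<and> wv s' vStart = min n (2 * wd * k) \<and>
    wa s' 2 = wa s 2 \<and> ra s' 2 = ra s 2 \<and> block_sorted (kout s') (2 * wd) (min n (2 * wd * k)) \<and>
    mset (map (kout s') [0..<min n (2 * wd * k)]) = mset (map (kin s) [0..<min n (2 * wd * k)])" for k s'
  show ?thesis
  proof (rule wp_for[where J = J and m = m and C = "80 * wd + 40"])
    show "J 0 s" using n by (simp add: J_def sort_frame_def block_sorted_def)
    show "(wv s' vStart < wv s' vSize) = (k < m)" if "J k s'" for k s'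
      using that n by (auto simp: J_def sort_frame_def m)
    fix k s' t' assume k: "k < m" and J: "J k s'"
    define u where "u = 2 * wd * k"
    define v where "v = min n (u + 2 * wd)"
    have u: "u < n" "min n u = u" "2 * wd * Suc k = u + 2 * wd" using k m by (auto simp: u_def)
    have uv: "u \<le> v" using u by (simp add: v_def)
    have kin_eq: "kin s' = kin s" using J by (auto simp: J_def)
    have divu: "i div (2 * wd) = k" if "u \<le> i" "i < v" for i
      using that wd by (intro div_nat_eqI) (auto simp: u_def v_def)
    show "wp merge_block (\<lambda>s'' a''. J (Suc k) s'' \<and> a'' \<le> t' + (80 * wd + 40)) s' t'"
    proof (rule merge_block_wp[where n = n and wd = wd and ?st0.0 = u])
      show "u < n" "n < Q" "0 < wd" "wd \<le> n" using u n wd by auto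
      show "wv s' vSize = n" "wv s' vWidth = wd" "wv s' vStart = u"
        using J n u by (auto simp: J_def sort_frame_def u_def[symmetric])
      have d1: "i div wd = 2 * k" if "u \<le> i" "i < u + wd" for i
        using that wd by (intro div_nat_eqI) (auto simp: u_def algebra_simps)
      have d2: "i div wd = 2 * k + 1" if "u + wd \<le> i" "i < u + 2 * wd" for i
        using that wd by (intro div_nat_eqI) (auto simp: u_def algebra_simps)
      show "sorted_wrt kle (map (kin s') [u..<min n (u + wd)])"
        unfolding sorted_wrt_map_upt kin_eq
      proof (intro allI impI)
        fix i j assume ij: "u \<le> i \<and> i < j \<and> j < min n (u + wd)"
        then have "i div wd = j div wd" using d1[of i] d1[of j] by auto
        then show "kle (kin s i) (kin s j)" using srt ij unfolding block_sorted_def by auto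
      qed
      show "sorted_wrt kle (map (kin s') [min n (u + wd)..<min n (u + 2 * wd)])"
        unfolding sorted_wrt_map_upt kin_eq
      proof (intro allI impI)
        fix i j assume ij: "min n (u + wd) \<le> i \<and> i < j \<and> j < min n (u + 2 * wd)"
        then have "i div wd = j div wd" using d2[of i] d2[of j] by auto
        then show "kle (kin s i) (kin s j)" using srt ij unfolding block_sorted_def by auto
      qed
      fix s2 :: st and t2
      assume 2: "sort_frame s' s2" "wv s2 vWidth = wd" "wv s2 vStart = min n (u + 2 * wd)"
        "wa s2 2 = wa s' 2" "ra s2 2 = ra s' 2" "\<And>i. i < u \<Longrightarrow> kout s2 i = kout s' i"
        "sorted_wrt kle (map (kout s2) [u..<min n (u + 2 * wd)])"
        "mset (map (kout s2) [u..<min n (u + 2 * wd)]) = mset (map (kin s') [u..<min n (u + 2 * wd)])"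
        "t2 \<le> t' + 80 * wd + 40"
      have ms: "mset (map (kout s') [0..<u]) = mset (map (kin s) [0..<u])"
        using J u unfolding J_def u_def[symmetric] by simp
      have sp: "[0..<v] = [0..<u] @ [u..<v]"
        using uv by (metis le_add_diff_inverse upt_add_eq_append zero_le)
      have low: "map (kout s2) [0..<u] = map (kout s') [0..<u]"
        using 2(6) by (intro map_cong) auto
      have "mset (map (kout s2) [0..<v]) = mset (map (kin s) [0..<v])"
        using ms low 2(8) unfolding sp v_def[symmetric] kin_eq map_append mset_append by (simp only:)
      moreover have "block_sorted (kout s2) (2 * wd) v"
        unfolding block_sorted_def
      proof (intro allI impI)
        fix i j assume ij: "i < j \<and> j < v \<and> i div (2 * wd) = j div (2 * wd)"
        show "kle (kout s2 i) (kout s2 j)"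
        proof (cases "j < u")
          case True
          then have "kle (kout s' i) (kout s' j)"
            using J ij u unfolding J_def u_def[symmetric] block_sorted_def by auto
          then show ?thesis using 2(6) True ij by simp
        next
          case False
          then have "i div (2 * wd) = k" using ij divu[of j] by auto
          then have "u \<le> i" unfolding u_def by (metis times_div_less_eq_dividend)
          then show ?thesis using 2(7) ij unfolding sorted_wrt_map_upt v_def by blast
        qed
      qed
      moreover have "sort_frame s s2" using J 2(1) sort_frame_trans unfolding J_def by blast
      moreover have "wa s2 2 = wa s 2" "ra s2 2 = ra s 2" using J 2(4,5) unfolding J_def by simp_all
      ultimately show "J (Suc k) s2 \<and> t2 \<le> t' + (80 * wd + 40)"
        using 2(2,3,9) unfolding J_def v_def u(3) by simp
    qed
  next
    fix s' t' assume J: "J m s'" and t': "t' \<le> t + m * (80 * wd + 40 + 2) + 2"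
    have nm': "min n (2 * wd * m) = n" using nm by simp
    have "m * (80 * wd + 40 + 2) = 40 * (2 * wd * m) + 42 * m" by (simp add: algebra_simps)
    then have "t' \<le> t + 170 * n + 2" using t' m_cost m_le by linarith
    then show "P s' t'" using J nm' unfolding J_def by (intro P) auto
  qed
qed

text \<open>After \<open>m\<close> doublings a single run covers all \<open>n\<close> entries, and
  \<open>block_sorted\<close> becomes sortedness. \<open>L\<close> is any upper bound for the number
  of doublings.\<close>

lemma sort_prog_wp:
  assumes n: "n < Q" "wv s vSize = n" "n \<le> 2 ^ L"
    and P: "\<And>s' t'. \<lbrakk>sort_frame s s'; sorted_wrt kle (map (kin s') [0..<n]);
      mset (map (kin s') [0..<n]) = mset (map (kin s) [0..<n]); t' \<le> t + 220 * (n + 1) * (L + 1)\<rbrakk> \<Longrightarrow> P s' t'"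
  shows "wp sort_prog P s t"
proof -
  define m where "m = (LEAST k. n \<le> 2 ^ k)"
  have mono: "mono (\<lambda>k. (2::nat) ^ k)" by (auto simp: mono_def)
  have m: "k < m \<longleftrightarrow> 2 ^ k < n" for k
    unfolding m_def using less_Least_iff[OF mono n(3), of k] by simp
  have m_le: "m \<le> L" unfolding m_def using n(3) by (rule Least_le)
  have nm: "n \<le> 2 ^ m" using m[of m] by simp
  define J where "J k s' \<longleftrightarrow> sort_frame s s' \<and> wv s' vWidth = 2 ^ k \<and> block_sorted (kin s') (2 ^ k) n \<and>
    mset (map (kin s') [0..<n]) = mset (map (kin s) [0..<n])" for k s'
  have "wp (While vWidth vSize
       (At (Cst vStart 0) ;; While vStart vSize merge_block ;; copy_back ;;
        At (Add vWidth vWidth vWidth))) P (s\<lparr>wv := (wv s)(vWidth := 1)\<rparr>) (t + 2)"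
  proof (rule wp_for[where J = J and m = m and C = "190 * n + 20"])
    show "J 0 (s\<lparr>wv := (wv s)(vWidth := 1)\<rparr>)"
      by (auto simp: J_def sort_frame_def block_sorted_def)
    show "(wv s' vWidth < wv s' vSize) = (k < m)" if "J k s'" for k s'
      using that n by (auto simp: J_def sort_frame_def m)
    fix k s' t' assume k: "k < m" and J: "J k s'"
    have wd: "2 ^ k < n" using k m by simp
    have "wp (While vStart vSize merge_block) (wp (copy_back ;; At (Add vWidth vWidth vWidth))
      (\<lambda>s'' a''. J (Suc k) s'' \<and> a'' \<le> t' + (190 * n + 20))) (s'\<lparr>wv := (wv s')(vStart := 0)\<rparr>) (t' + 2)"
    proof (rule merge_pass_wp[where n = n and wd = "2 ^ k"])
      show "n < Q" by fact
      fix s2 :: st and t2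
      assume 2: "sort_frame (s'\<lparr>wv := (wv s')(vStart := 0)\<rparr>) s2" "wv s2 vWidth = 2 ^ k"
        "block_sorted (kout s2) (2 * 2 ^ k) n"
        "mset (map (kout s2) [0..<n]) = mset (map (kin (s'\<lparr>wv := (wv s')(vStart := 0)\<rparr>)) [0..<n])"
        "t2 \<le> t' + 2 + 170 * n + 2"
      have fr: "sort_frame s s2" using J 2(1) by (auto simp: J_def sort_frame_def)
      show "wp (copy_back ;; At (Add vWidth vWidth vWidth))
          (\<lambda>s'' a''. J (Suc k) s'' \<and> a'' \<le> t' + (190 * n + 20)) s2 t2"
        unfolding wp_Seq
      proof (rule copy_back_wp[where n = n])
        show "n < Q" by fact
        show "wv s2 vSize = n" using fr n by (simp add: sort_frame_def)
        fix s3 :: st and t3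
        assume 3: "sort_frame s2 s3" "wv s3 vWidth = wv s2 vWidth" "\<And>i. i < n \<Longrightarrow> kin s3 i = kout s2 i"
          "t3 \<le> t2 + 20 * n + 10"
        have eq: "map (kin s3) [0..<n] = map (kout s2) [0..<n]" using 3(3) by (intro map_cong) auto
        have "block_sorted (kin s3) (2 * 2 ^ k) n"
          using 2(3) 3(3) unfolding block_sorted_def by simp
        moreover have "mset (map (kin s3) [0..<n]) = mset (map (kin s) [0..<n])"
          unfolding eq using 2(4) J by (simp add: J_def)
        moreover have "sort_frame s (s3\<lparr>wv := (wv s3)(vWidth := x)\<rparr>)" for x
          using sort_frame_trans[OF fr 3(1)] by (simp add: sort_frame_def)
        ultimately have "J (Suc k) (s3\<lparr>wv := (wv s3)(vWidth := 2 * 2 ^ k)\<rparr>)"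
          unfolding J_def by (simp del: mset_map mset_upt)
        moreover have "2 * 2 ^ k < 64 * Q" using wd n by linarith
        moreover have "wv s3 vWidth = 2 ^ k" using 2(2) 3(2) by simp
        moreover have "t3 + 2 \<le> t' + (190 * n + 20)" using 2(5) 3(4) by linarith
        ultimately show "wp (At (Add vWidth vWidth vWidth))
          (\<lambda>s'' a''. J (Suc k) s'' \<and> a'' \<le> t' + (190 * n + 20)) s3 t3"
          unfolding wp_At by (simp flip: mult_2)
      qed
    qed (use J n wd in \<open>simp_all add: J_def sort_frame_def\<close>)
    then show "wp (At (Cst vStart 0) ;; While vStart vSize merge_block ;; copy_back ;;
        At (Add vWidth vWidth vWidth)) (\<lambda>s'' a''. J (Suc k) s'' \<and> a'' \<le> t' + (190 * n + 20)) s' t'"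
      by (simp add: wp_Seq wp_At)
  next
    fix s' t' assume J: "J m s'" and t': "t' \<le> t + 2 + m * (190 * n + 20 + 2) + 2"
    have "m * (190 * n + 20 + 2) \<le> L * (190 * n + 20 + 2)" using m_le by (rule mult_right_mono) simp
    then have "t' \<le> t + 220 * (n + 1) * (L + 1)" using t' by (simp add: algebra_simps)
    moreover have "sorted_wrt kle (map (kin s') [0..<n])"
      unfolding sorted_wrt_map_upt
    proof (intro allI impI)
      fix i j assume ij: "0 \<le> i \<and> i < j \<and> j < n"
      then have "i div 2 ^ m = j div 2 ^ m" using nm by (simp add: div_less)
      then show "kle (kin s' i) (kin s' j)" using J ij unfolding J_def block_sorted_def by auto
    qed
    ultimately show "P s' t'" using J unfolding J_def by (intro P) blast+
  qed
  then show ?thesis unfolding sort_prog_def by (simp add: wp_Seq wp_At)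
qed

end

section \<open>Cutting by a rotating line\<close>

text \<open>The cross product of \<open>d\<close> and \<open>p - c\<close>: positive to the left of
  the line through \<open>c\<close> with direction \<open>d\<close>, zero on it.\<close>

definition side :: "point \<Rightarrow> point \<Rightarrow> point \<Rightarrow> real" where
  "side d c p = fst d * (snd p - snd c) - snd d * (fst p - fst c)"

definition noncr :: "point \<Rightarrow> point \<Rightarrow> point \<Rightarrow> point \<Rightarrow> bool" where
  "noncr p q u v \<longleftrightarrow> closed_segment p q \<inter> closed_segment u v \<subseteq> {p, q} \<inter> {u, v}"

lemma side_convex_combination:
  "side d c ((1 - t) *\<^sub>R p + t *\<^sub>R q) = (1 - t) * side d c p + t * side d c q"
  by (simp add: side_def algebra_simps)

lemma collinear_side_zero:
  assumes "d \<noteq> 0" "\<And>x. x \<in> S \<Longrightarrow> side d c x = 0"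
  shows "collinear S"
  unfolding collinear_def
proof (intro exI[of _ d] ballI)
  fix x y assume "x \<in> S" "y \<in> S"
  then have "side d c x = side d c y" using assms(2) by simp
  then have eq: "fst d * (snd x - snd y) = snd d * (fst x - fst y)"
    by (simp add: side_def algebra_simps)
  show "\<exists>r. x - y = r *\<^sub>R d"
  proof (cases "fst d = 0")
    case True
    then have "snd d \<noteq> 0" using assms(1) by (simp add: prod_eq_iff)
    then show ?thesis using eq True
      by (intro exI[of _ "(snd x - snd y) / snd d"]) (simp add: prod_eq_iff)
  next
    case False
    then show ?thesis using eq
      by (intro exI[of _ "(fst x - fst y) / fst d"]) (simp add: prod_eq_iff field_simps)
  qed
qed

text \<open>A convex combination of two numbers that do not have opposite signs vanishes only at an
  end of the segment or if both numbers vanish.\<close>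

lemma side_zero_on_segment:
  assumes "z \<in> closed_segment p q" "side d c z = 0"
    and "side d c p \<ge> 0 \<and> side d c q \<ge> 0 \<or> side d c p \<le> 0 \<and> side d c q \<le> 0"
  shows "z \<in> {p, q} \<or> side d c p = 0 \<and> side d c q = 0 \<and> p \<noteq> q"
proof -
  obtain t where t: "0 \<le> t" "t \<le> 1" "z = (1 - t) *\<^sub>R p + t *\<^sub>R q"
    using assms(1) by (auto simp: in_segment)
  have eq: "(1 - t) * side d c p + t * side d c q = 0"
    using assms(2) unfolding t(3) side_convex_combination .
  consider "t = 0" | "t = 1" | "0 < t" "t < 1" using t by linarith
  then show ?thesis
  proof cases
    case 3
    have "side d c p = 0 \<and> side d c q = 0"
    proof (cases "side d c p \<ge> 0 \<and> side d c q \<ge> 0")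
      case True
      then have "(1 - t) * side d c p \<ge> 0" "t * side d c q \<ge> 0" using 3 by auto
      with eq have "(1 - t) * side d c p = 0" "t * side d c q = 0" by linarith+
      with 3 show ?thesis by simp
    next
      case False
      then have "(1 - t) * side d c p \<le> 0" "t * side d c q \<le> 0"
        using 3 assms(3) by (auto intro!: mult_nonneg_nonpos)
      with eq have "(1 - t) * side d c p = 0" "t * side d c q = 0" by linarith+
      with 3 show ?thesis by simp
    qed
    then show ?thesis using t(3) by (cases "p = q") (auto simp flip: scaleR_left_distrib)
  qed (use t in auto)
qed

text \<open>A common point \<open>z\<close> must lie on the line. If it is an inner point of one
  segment, that segment lies on the line, and by \<open>two\<close> the line carries no third
  endpoint, so \<open>z\<close> cannot be an end of the other segment. Being inner to both is
  excluded by \<open>sh\<close>.\<close>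

lemma noncr_across_line:
  assumes A: "side d c p \<ge> 0" "side d c q \<ge> 0" and B: "side d c u \<le> 0" "side d c v \<le> 0"
    and two: "\<And>x y z. \<lbrakk>{x, y, z} \<subseteq> {p, q, u, v}; side d c x = 0; side d c y = 0; side d c z = 0\<rbrakk>
      \<Longrightarrow> x = y \<or> y = z \<or> x = z"
    and sh: "\<lbrakk>side d c p = 0; side d c q = 0; side d c u = 0; side d c v = 0; p \<noteq> q; u \<noteq> v\<rbrakk> \<Longrightarrow> False"
  shows "noncr p q u v"
  unfolding noncr_def
proof
  fix z assume "z \<in> closed_segment p q \<inter> closed_segment u v"
  then have z: "z \<in> closed_segment p q" "z \<in> closed_segment u v" by auto
  obtain t where t: "0 \<le> t" "t \<le> 1" "z = (1 - t) *\<^sub>R p + t *\<^sub>R q"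
    using z(1) by (auto simp: in_segment)
  obtain r where r: "0 \<le> r" "r \<le> 1" "z = (1 - r) *\<^sub>R u + r *\<^sub>R v"
    using z(2) by (auto simp: in_segment)
  have "side d c z \<ge> 0" unfolding t(3) side_convex_combination using t A by simp
  moreover have "side d c z \<le> 0" unfolding r(3) side_convex_combination using r B
    by (intro add_nonpos_nonpos mult_nonneg_nonpos) auto
  ultimately have z0: "side d c z = 0" by simp
  have 1: "z \<in> {p, q} \<or> side d c p = 0 \<and> side d c q = 0 \<and> p \<noteq> q"
    using side_zero_on_segment[OF z(1) z0] A by blast
  have 2: "z \<in> {u, v} \<or> side d c u = 0 \<and> side d c v = 0 \<and> u \<noteq> v"
    using side_zero_on_segment[OF z(2) z0] B by blast
  show "z \<in> {p, q} \<inter> {u, v}"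
  proof (cases "z \<in> {p, q}")
    case True
    then show ?thesis using 2 two[of z u v] z0 by auto
  next
    case False
    then have "z \<in> {u, v}" using 1 2 sh by blast
    then show ?thesis using 1 two[of z p q] z0 by auto
  qed
qed

section \<open>Slopes as sort keys\<close>

text \<open>A monotone function of the slope of the line through \<open>c\<close> and \<open>p\<close> with values in
  \<open>[-1, 1]\<close>. A vertical line gets \<open>1\<close> or \<open>-1\<close>, and \<open>p = c\<close> gives \<open>0 / 0 = 0\<close>.\<close>

definition slope_key :: "point \<Rightarrow> point \<Rightarrow> real" where
  "slope_key c p = (if fst p < fst c then - (snd p - snd c) else snd p - snd c) /
     (\<bar>fst p - fst c\<bar> + \<bar>snd p - snd c\<bar>)"

text \<open>The right half of the unit circle of the 1-norm, parametrized by the ordinate. A slope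
  key is the ordinate of the normalized direction in this half, so it is computed with field
  operations and comparisons alone.\<close>

definition key_dir :: "real \<Rightarrow> point" where
  "key_dir \<tau> = (1 - \<bar>\<tau>\<bar>, \<tau>)"

lemma key_dir_nonzero: "key_dir \<tau> \<noteq> 0"
  by (auto simp: key_dir_def prod_eq_iff)

lemma slope_key_bounds: "- 1 \<le> slope_key c p" "slope_key c p \<le> 1"
  unfolding slope_key_def by (auto simp: divide_le_eq le_divide_eq)

text \<open>Up to sign, \<open>p - c\<close> is its 1-norm \<open>D\<close> times
  \<open>key_dir \<kappa>\<close>, and \<open>g\<close> is the cross product of
  \<open>key_dir \<tau>\<close> and \<open>key_dir \<kappa>\<close>. On the right half circle the
  angle grows with the ordinate, so \<open>g\<close> has the sign of
  \<open>\<kappa> - \<tau>\<close>. Points left of \<open>c\<close> are reflected in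
  \<open>c\<close>, which reverses the sign.\<close>

lemma slope_key_side:
  assumes "\<bar>\<tau>\<bar> \<le> 1"
  shows "\<tau> \<le> slope_key c p \<Longrightarrow> fst c \<le> fst p \<Longrightarrow> side (key_dir \<tau>) c p \<ge> 0"
    and "slope_key c p \<le> \<tau> \<Longrightarrow> fst c \<le> fst p \<Longrightarrow> side (key_dir \<tau>) c p \<le> 0"
    and "\<tau> \<le> slope_key c p \<Longrightarrow> fst p < fst c \<Longrightarrow> side (key_dir \<tau>) c p \<le> 0"
    and "slope_key c p \<le> \<tau> \<Longrightarrow> fst p < fst c \<Longrightarrow> side (key_dir \<tau>) c p \<ge> 0"
proof -
  define \<kappa> where "\<kappa> = slope_key c p"
  define D where "D = \<bar>fst p - fst c\<bar> + \<bar>snd p - snd c\<bar>"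
  define g where "g = (1 - \<bar>\<tau>\<bar>) * \<kappa> - \<tau> * (1 - \<bar>\<kappa>\<bar>)"
  have D0: "D \<ge> 0" by (simp add: D_def)
  have \<kappa>1: "\<bar>\<kappa>\<bar> \<le> 1" using slope_key_bounds[of c p] by (auto simp: \<kappa>_def)
  have pos: "side (key_dir \<tau>) c p = D * g" if "fst c \<le> fst p"
  proof (cases "D = 0")
    case True
    then have "fst p = fst c" "snd p = snd c" by (auto simp: D_def)
    then show ?thesis using True by (simp add: side_def)
  next
    case False
    have k: "D * \<kappa> = snd p - snd c" using that False by (simp add: \<kappa>_def slope_key_def D_def)
    then have "D * \<bar>\<kappa>\<bar> = \<bar>snd p - snd c\<bar>" using D0 by (simp add: abs_mult flip: k)
    then have "D * (1 - \<bar>\<kappa>\<bar>) = fst p - fst c" using that by (simp add: D_def algebra_simps)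
    moreover have "D * g = (1 - \<bar>\<tau>\<bar>) * (D * \<kappa>) - \<tau> * (D * (1 - \<bar>\<kappa>\<bar>))"
      by (simp add: g_def algebra_simps)
    ultimately show ?thesis using k by (simp add: side_def key_dir_def)
  qed
  have neg: "side (key_dir \<tau>) c p = - (D * g)" if "fst p < fst c"
  proof -
    have "D \<noteq> 0" using that by (auto simp: D_def)
    then have k: "D * \<kappa> = - (snd p - snd c)" using that by (simp add: \<kappa>_def slope_key_def D_def)
    then have "D * \<bar>\<kappa>\<bar> = \<bar>snd p - snd c\<bar>" using D0 by (metis abs_minus abs_mult abs_of_nonneg)
    then have "D * (1 - \<bar>\<kappa>\<bar>) = - (fst p - fst c)" using that by (simp add: D_def algebra_simps)
    moreover have "D * g = (1 - \<bar>\<tau>\<bar>) * (D * \<kappa>) - \<tau> * (D * (1 - \<bar>\<kappa>\<bar>))"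
      by (simp add: g_def algebra_simps)
    ultimately have "D * g = (1 - \<bar>\<tau>\<bar>) * (- (snd p - snd c)) - \<tau> * (- (fst p - fst c))"
      using k by simp
    then show ?thesis by (simp add: side_def key_dir_def algebra_simps)
  qed
  have anti: "(1 - \<bar>a\<bar>) * b - a * (1 - \<bar>b\<bar>) \<ge> 0" if "\<bar>a\<bar> \<le> 1" "\<bar>b\<bar> \<le> 1" "a \<le> b" for a b :: real
  proof -
    consider "0 \<le> a" | "b \<le> 0" | "a < 0" "0 < b" by linarith
    then show ?thesis
    proof cases
      case 3
      then have "(1 - \<bar>a\<bar>) * b \<ge> 0" "(- a) * (1 - \<bar>b\<bar>) \<ge> 0"
        using that by (auto intro: mult_nonpos_nonneg)
      then show ?thesis by simp
    qed (use that in \<open>auto simp: algebra_simps\<close>)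
  qed
  have g1: "g \<ge> 0" if "\<tau> \<le> \<kappa>" unfolding g_def using anti[OF assms \<kappa>1 that] .
  have g2: "g \<le> 0" if "\<kappa> \<le> \<tau>" using anti[OF \<kappa>1 assms that] by (simp add: g_def algebra_simps)
  show "\<tau> \<le> slope_key c p \<Longrightarrow> fst c \<le> fst p \<Longrightarrow> side (key_dir \<tau>) c p \<ge> 0"
    "slope_key c p \<le> \<tau> \<Longrightarrow> fst c \<le> fst p \<Longrightarrow> side (key_dir \<tau>) c p \<le> 0"
    "\<tau> \<le> slope_key c p \<Longrightarrow> fst p < fst c \<Longrightarrow> side (key_dir \<tau>) c p \<le> 0"
    "slope_key c p \<le> \<tau> \<Longrightarrow> fst p < fst c \<Longrightarrow> side (key_dir \<tau>) c p \<ge> 0"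
    using pos neg g1 g2 D0 by (auto simp: \<kappa>_def mult_nonneg_nonpos)
qed

section \<open>Items of two colours and their separation by a line\<close>

definition wt :: "(nat \<Rightarrow> bool) \<Rightarrow> nat \<Rightarrow> int" where
  "wt C a = (if C a then 1 else - 1)"

locale bicolored =
  \<comment> \<open>\<open>C\<close> marks the centres. Copies of a centre are repetitions of its
    number in a list of items, which is why \<open>pt\<close> can be injective.\<close>
  fixes pt :: "nat \<Rightarrow> point" and N :: nat and C :: "nat \<Rightarrow> bool"
  assumes pt_inj: "inj_on pt {..<N}"
    and pt_gp: "\<And>a b c. \<lbrakk>a < N; b < N; c < N; a \<noteq> b; b \<noteq> c; a \<noteq> c\<rbrakk> \<Longrightarrow> \<not> collinear {pt a, pt b, pt c}"
begin

text \<open>All segments within \<open>X\<close> are compared with all segments within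
  \<open>Y\<close>, whatever the colours, so that the two parts of a cut can be matched
  independently of each other.\<close>

definition sep :: "nat set \<Rightarrow> nat set \<Rightarrow> bool" where
  "sep X Y \<longleftrightarrow> (\<forall>a\<in>X. \<forall>b\<in>X. \<forall>c\<in>Y. \<forall>d\<in>Y. noncr (pt a) (pt b) (pt c) (pt d))"

text \<open>General position leaves at most two points on the line. Two segments along it, one from
  each side, would have the same two ends, and both would be shared by \<open>X\<close> and
  \<open>Y\<close>, against \<open>sh\<close>.\<close>

lemma sep_across_line:
  assumes "d \<noteq> 0" "X \<subseteq> {..<N}" "Y \<subseteq> {..<N}"
    and "\<And>a. a \<in> X \<Longrightarrow> side d c (pt a) \<ge> 0" "\<And>a. a \<in> Y \<Longrightarrow> side d c (pt a) \<le> 0"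
    and sh: "\<And>a b. \<lbrakk>a \<in> X; a \<in> Y; b \<in> X; b \<in> Y\<rbrakk> \<Longrightarrow> a = b"
  shows "sep X Y"
  unfolding sep_def
proof (intro ballI)
  fix a a' b b' assume m: "a \<in> X" "a' \<in> X" "b \<in> Y" "b' \<in> Y"
  then have lt: "a < N" "a' < N" "b < N" "b' < N" using assms(2,3) by auto
  have three: "x = y \<or> y = z \<or> x = z"
    if "x < N" "y < N" "z < N" "side d c (pt x) = 0" "side d c (pt y) = 0" "side d c (pt z) = 0" for x y z
  proof -
    have "collinear {pt x, pt y, pt z}"
      using that by (intro collinear_side_zero[OF assms(1), where c = c]) (elim insertE emptyE; simp)
    then show ?thesis using pt_gp that(1-3) by blast
  qed
  show "noncr (pt a) (pt a') (pt b) (pt b')"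
  proof (rule noncr_across_line[where d = d and c = c])
    show "side d c (pt a) \<ge> 0" "side d c (pt a') \<ge> 0" "side d c (pt b) \<le> 0" "side d c (pt b') \<le> 0"
      using m assms(4,5) by auto
    fix x y z assume *: "{x, y, z} \<subseteq> {pt a, pt a', pt b, pt b'}"
      "side d c x = 0" "side d c y = 0" "side d c z = 0"
    then obtain i j k where "x = pt i" "y = pt j" "z = pt k" "i < N" "j < N" "k < N"
      using lt by auto
    then show "x = y \<or> y = z \<or> x = z" using three[of i j k] * by auto
  next
    assume *: "side d c (pt a) = 0" "side d c (pt a') = 0" "side d c (pt b) = 0" "side d c (pt b') = 0"
      "pt a \<noteq> pt a'" "pt b \<noteq> pt b'"
    then have "b = a \<or> b = a'" "b' = a \<or> b' = a'"
      using three[of a a' b] three[of a a' b'] lt by auto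
    then show False using sh[of a a'] m * by auto
  qed
qed

text \<open>Whether item \<open>i\<close> is above the rotating line after the first \<open>k\<close> items have changed sides; the
  line starts out vertical.\<close>

definition inU :: "point \<Rightarrow> nat list \<Rightarrow> nat \<Rightarrow> nat \<Rightarrow> bool" where
  "inU c zs k i \<longleftrightarrow> (if i < k then fst (pt (zs ! i)) < fst c else fst c \<le> fst (pt (zs ! i)))"

text \<open>The key of an item at the pivot \<open>c\<close>, which is always on the line, is arbitrary.\<close>

definition keyed :: "point \<Rightarrow> (nat \<Rightarrow> real) \<Rightarrow> nat list \<Rightarrow> bool" where
  "keyed c ky zs \<longleftrightarrow> (\<forall>a\<in>set zs. pt a \<noteq> c \<longrightarrow> ky a = slope_key c (pt a)) \<and>
     (\<forall>a\<in>set zs. - 1 \<le> ky a) \<and> sorted_wrt kle (map (\<lambda>a. (ky a, a)) zs) \<and> set zs \<subseteq> {..<N}"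

lemma keyed_nth:
  assumes "keyed c ky zs" "i \<le> j" "j < length zs"
  shows "ky (zs ! i) \<le> ky (zs ! j)" "ky (zs ! i) = ky (zs ! j) \<Longrightarrow> zs ! i \<le> zs ! j"
proof -
  have "i = j \<or> kle (map (\<lambda>a. (ky a, a)) zs ! i) (map (\<lambda>a. (ky a, a)) zs ! j)"
    using assms sorted_wrt_nth_less[of kle "map (\<lambda>a. (ky a, a)) zs" i j]
    by (auto simp: keyed_def order.order_iff_strict)
  then show "ky (zs ! i) \<le> ky (zs ! j)" "ky (zs ! i) = ky (zs ! j) \<Longrightarrow> zs ! i \<le> zs ! j"
    using assms by (auto simp: kle_def)
qed

text \<open>The line has the slope of the item passed last: items passed earlier have smaller or
  equal keys, the others larger or equal ones.\<close>

lemma inU_side: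
  assumes "keyed c ky zs" "0 < k" "k \<le> length zs"
  obtains \<tau> where "\<bar>\<tau>\<bar> \<le> 1"
    "\<And>i. i < length zs \<Longrightarrow> inU c zs k i \<Longrightarrow> side (key_dir \<tau>) c (pt (zs ! i)) \<ge> 0"
    "\<And>i. i < length zs \<Longrightarrow> \<not> inU c zs k i \<Longrightarrow> side (key_dir \<tau>) c (pt (zs ! i)) \<le> 0"
proof -
  \<comment> \<open>An item at the pivot may carry a key above 1, which is no direction. Clipping is
    harmless because all slope keys are at most 1.\<close>
  define \<tau> where "\<tau> = min 1 (ky (zs ! (k - 1)))"
  have k1: "k - 1 < length zs" using assms by simp
  have t1: "\<bar>\<tau>\<bar> \<le> 1" using assms(1) k1 by (auto simp: \<tau>_def keyed_def abs_le_iff)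
  have *: "(i < k \<longrightarrow> slope_key c (pt (zs ! i)) \<le> \<tau>) \<and> (k \<le> i \<longrightarrow> \<tau> \<le> slope_key c (pt (zs ! i)))"
    if "i < length zs" "pt (zs ! i) \<noteq> c" for i
  proof -
    have "ky (zs ! i) = slope_key c (pt (zs ! i))" using assms(1) that by (auto simp: keyed_def)
    moreover have "ky (zs ! i) \<le> ky (zs ! (k - 1))" if "i < k"
      using keyed_nth(1)[OF assms(1), of i "k - 1"] k1 that by simp
    moreover have "ky (zs ! (k - 1)) \<le> ky (zs ! i)" if "k \<le> i"
      using keyed_nth(1)[OF assms(1), of "k - 1" i] \<open>i < length zs\<close> that by simp
    ultimately show ?thesis
      using slope_key_bounds[of c "pt (zs ! i)"] unfolding \<tau>_def by (auto intro: min.coboundedI2)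
  qed
  have z: "side (key_dir \<tau>) c c = 0" by (simp add: side_def)
  show thesis
  proof (rule that[OF t1])
    fix i assume i: "i < length zs"
    show "side (key_dir \<tau>) c (pt (zs ! i)) \<ge> 0" if "inU c zs k i"
      using that *[OF i] slope_key_side[OF t1, of c "pt (zs ! i)"] z
      by (cases "pt (zs ! i) = c") (auto simp: inU_def split: if_splits)
    show "side (key_dir \<tau>) c (pt (zs ! i)) \<le> 0" if "\<not> inU c zs k i"
      using that *[OF i] slope_key_side[OF t1, of c "pt (zs ! i)"] z
      by (cases "pt (zs ! i) = c") (auto simp: inU_def split: if_splits)
  qed
qed

text \<open>Copies of an item on different sides differ only in whether they have been passed, so
  the item occurs both before position \<open>k\<close> and from \<open>k\<close> on. As equal keys
  are ordered by number, it must be the item at position \<open>k - 1\<close>; so at most one item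
  is shared.\<close>

lemma sep_inU:
  assumes kd: "keyed c ky zs" and k: "0 < k" "k \<le> length zs"
  shows "sep {zs ! i | i. i < length zs \<and> inU c zs k i} {zs ! i | i. i < length zs \<and> \<not> inU c zs k i}"
    (is "sep ?X ?Y")
proof -
  obtain \<tau> where \<tau>: "\<bar>\<tau>\<bar> \<le> 1"
    "\<And>i. i < length zs \<Longrightarrow> inU c zs k i \<Longrightarrow> side (key_dir \<tau>) c (pt (zs ! i)) \<ge> 0"
    "\<And>i. i < length zs \<Longrightarrow> \<not> inU c zs k i \<Longrightarrow> side (key_dir \<tau>) c (pt (zs ! i)) \<le> 0"
    using inU_side[OF assms] by metis
  have N: "set zs \<subseteq> {..<N}" using kd by (simp add: keyed_def)
  have sh: "a = zs ! (k - 1)" if a: "a \<in> ?X" "a \<in> ?Y" for a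
  proof -
    obtain i j where ij: "i < length zs" "inU c zs k i" "j < length zs" "\<not> inU c zs k j"
      "zs ! i = a" "zs ! j = a" using a by auto
    then have "i < k \<longleftrightarrow> \<not> j < k" by (auto simp: inU_def split: if_splits)
    then have "i \<le> k - 1 \<and> k - 1 \<le> j \<or> j \<le> k - 1 \<and> k - 1 \<le> i" using k by linarith
    then obtain i' j' where ij': "i' \<le> k - 1" "k - 1 \<le> j'" "j' < length zs" "zs ! i' = a" "zs ! j' = a"
      using ij by blast
    have "k - 1 < length zs" using k by simp
    have 1: "ky a \<le> ky (zs ! (k - 1))" "ky a = ky (zs ! (k - 1)) \<Longrightarrow> a \<le> zs ! (k - 1)"
      using keyed_nth[OF kd ij'(1)] ij' \<open>k - 1 < length zs\<close> by auto
    have 2: "ky (zs ! (k - 1)) \<le> ky a" "ky (zs ! (k - 1)) = ky a \<Longrightarrow> zs ! (k - 1) \<le> a"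
      using keyed_nth[OF kd ij'(2,3)] ij' by auto
    show ?thesis using 1 2 by auto
  qed
  show ?thesis
  proof (rule sep_across_line[OF key_dir_nonzero])
    show "?X \<subseteq> {..<N}" "?Y \<subseteq> {..<N}" using N nth_mem by blast+
    show "side (key_dir \<tau>) c (pt a) \<ge> 0" if "a \<in> ?X" for a using that \<tau>(2) by auto
    show "side (key_dir \<tau>) c (pt a) \<le> 0" if "a \<in> ?Y" for a using that \<tau>(3) by auto
    show "a = b" if "a \<in> ?X" "a \<in> ?Y" "b \<in> ?X" "b \<in> ?Y" for a b
      using sh[OF that(1,2)] sh[OF that(3,4)] by simp
  qed
qed

text \<open>The line from the leftmost pivot to the item of least slope supports the block: all
  other items are on or above it. By \<open>one\<close>, the pair leaves no copy of at least one of
  its two members behind, so the sides share at most one item.\<close>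

lemma sep_first_last:
  assumes kd: "keyed c ky zs" and n: "2 \<le> length zs" and c: "pt (last zs) = c" "hd zs \<noteq> last zs"
    and left: "\<And>a. a \<in> set zs \<Longrightarrow> fst c \<le> fst (pt a)"
    and one: "count (mset zs) (hd zs) = 1 \<or> count (mset zs) (last zs) = 1"
  shows "sep (set (butlast (tl zs))) {hd zs, last zs}"
proof -
  define p where "p = last zs"
  have zs: "zs = hd zs # butlast (tl zs) @ [p]"
    using n unfolding p_def by (cases zs) (auto split: if_splits)
  have N: "set zs \<subseteq> {..<N}" using kd by (simp add: keyed_def)
  have ne: "zs \<noteq> []" using n by auto
  then have lt: "hd zs < N" "p < N" using N hd_in_set last_in_set by (auto simp: p_def)
  define \<tau> where "\<tau> = slope_key c (pt (hd zs))"
  have hdc: "pt (hd zs) \<noteq> c" using c lt pt_inj unfolding p_def inj_on_def by auto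
  have t1: "\<bar>\<tau>\<bar> \<le> 1" unfolding \<tau>_def using slope_key_bounds by (simp add: abs_le_iff)
  have kyh: "ky (hd zs) = \<tau>" using kd hdc ne by (auto simp: keyed_def \<tau>_def)
  show ?thesis
  proof (rule sep_across_line[OF key_dir_nonzero])
    show "set (butlast (tl zs)) \<subseteq> {..<N}" "{hd zs, last zs} \<subseteq> {..<N}"
      using N lt by (auto simp: p_def dest!: in_set_butlastD list.set_sel(2)[OF ne])
    show "side (key_dir \<tau>) c (pt a) \<ge> 0" if "a \<in> set (butlast (tl zs))" for a
    proof (cases "pt a = c")
      case False
      have a: "a \<in> set zs" using that ne by (metis in_set_butlastD list.set_sel(2))
      then obtain i where i: "i < length zs" "zs ! i = a" by (auto simp: in_set_conv_nth)
      have "\<tau> \<le> ky a" using keyed_nth(1)[OF kd, of 0 i] i kyh ne by (simp add: hd_conv_nth)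
      then have "\<tau> \<le> slope_key c (pt a)" using kd a False by (auto simp: keyed_def)
      then show ?thesis using slope_key_side(1)[OF t1] left[OF a] by blast
    qed (simp add: side_def)
    show "side (key_dir \<tau>) c (pt a) \<le> 0" if "a \<in> {hd zs, last zs}" for a
      using that slope_key_side(2)[OF t1, of c "pt (hd zs)"] left[of "hd zs"] ne c
      by (auto simp: \<tau>_def side_def)
    have "hd zs \<notin> set (butlast (tl zs)) \<or> p \<notin> set (butlast (tl zs))"
    proof -
      have cnt: "count (mset zs) x = count (mset (hd zs # butlast (tl zs) @ [p])) x" for x
        using zs by metis
      have "count (mset (butlast (tl zs))) (hd zs) = 0 \<or> count (mset (butlast (tl zs))) p = 0"
        using one c(2) cnt[of "hd zs"] cnt[of p] unfolding p_def[symmetric] by auto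
      then show ?thesis by (simp add: count_eq_zero_iff)
    qed
    then show "a = b" if "a \<in> set (butlast (tl zs))" "a \<in> {hd zs, last zs}"
        "b \<in> set (butlast (tl zs))" "b \<in> {hd zs, last zs}" for a b
      using that by (auto simp: p_def)
  qed
qed

section \<open>Discrete intermediate values of the weight on one side\<close>

definition wsum :: "nat list \<Rightarrow> int" where
  "wsum xs = sum_list (map (wt C) xs)"

lemma wsum_append [simp]: "wsum (xs @ ys) = wsum xs + wsum ys"
  and wsum_Cons [simp]: "wsum (x # xs) = wt C x + wsum xs"
  and wsum_Nil [simp]: "wsum [] = 0"
  by (simp_all add: wsum_def)

lemma wsum_mset: "mset xs = mset ys \<Longrightarrow> wsum xs = wsum ys"
  unfolding wsum_def by (metis mset_map sum_mset_sum_list)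

lemma wsum_conv_sum: "wsum xs = (\<Sum>i<length xs. wt C (xs ! i))"
  unfolding wsum_def by (simp add: sum_list_sum_nth atLeast0LessThan)

definition usum :: "point \<Rightarrow> nat list \<Rightarrow> nat \<Rightarrow> int" where
  "usum c zs k = (\<Sum>i<length zs. if inU c zs k i then wt C (zs ! i) else 0)"

lemma usum_Suc:
  assumes "k < length zs"
  shows "usum c zs (Suc k) = usum c zs k +
    (if fst c \<le> fst (pt (zs ! k)) then - wt C (zs ! k) else wt C (zs ! k))"
proof -
  have "usum c zs (Suc k) - usum c zs k = (\<Sum>i<length zs. (if inU c zs (Suc k) i then wt C (zs ! i) else 0) -
      (if inU c zs k i then wt C (zs ! i) else 0))"
    by (simp add: usum_def sum_subtractf)
  also have "\<dots> = (\<Sum>i<length zs. if i = k then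
      (if fst c \<le> fst (pt (zs ! k)) then - wt C (zs ! k) else wt C (zs ! k)) else 0)"
    by (intro sum.cong) (auto simp: inU_def)
  also have "\<dots> = (if fst c \<le> fst (pt (zs ! k)) then - wt C (zs ! k) else wt C (zs ! k))"
    using assms by (simp add: sum.delta)
  finally show ?thesis by simp
qed

lemma usum_step: "k < length zs \<Longrightarrow> \<bar>usum c zs (Suc k) - usum c zs k\<bar> \<le> 1"
  by (auto simp: usum_Suc wt_def)

text \<open>After the half turn exactly those items are above the line that were not above it at the
  start.\<close>

lemma usum_ends: "usum c zs 0 + usum c zs (length zs) = wsum zs"
  unfolding usum_def wsum_conv_sum sum.distrib[symmetric]
  by (intro sum.cong) (auto simp: inU_def)

text \<open>The intermediate value theorem for integer sequences with steps of at most one, applied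
  to \<open>f\<close> or to its negative.\<close>

lemma int_sign_change:
  fixes f :: "nat \<Rightarrow> int"
  assumes "m \<le> n" "\<And>i. m \<le> i \<Longrightarrow> i < n \<Longrightarrow> \<bar>f (Suc i) - f i\<bar> \<le> 1" "f m = - f n"
  shows "\<exists>i. m \<le> i \<and> i \<le> n \<and> f i = 0"
proof (cases "f m \<le> 0")
  case True
  show ?thesis
    by (rule nat_intermed_int_val) (use assms True in simp_all)
next
  case False
  have "\<bar>- f (Suc i) - - f i\<bar> \<le> 1" if "m \<le> i" "i < n" for i
    using assms(2)[OF that] by linarith
  then have "\<exists>i. m \<le> i \<and> i \<le> n \<and> - f i = 0"
    by (intro nat_intermed_int_val) (use assms(1,3) False in simp_all)
  then show ?thesis by simp
qed

text \<open>\<open>k = 0\<close> is excluded because \<open>inU_side\<close> takes its direction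
  from item \<open>k - 1\<close>. If the sum vanishes at the start, it vanishes at the end of the
  half turn too.\<close>

lemma usum_zero_exists:
  assumes "wsum zs = 0" "zs \<noteq> []"
  shows "\<exists>k. 0 < k \<and> k \<le> length zs \<and> usum c zs k = 0"
proof (cases "usum c zs 0 = 0")
  case True
  then show ?thesis using usum_ends[of c zs] assms by (intro exI[of _ "length zs"]) auto
next
  case False
  have "\<exists>i. 0 \<le> i \<and> i \<le> length zs \<and> usum c zs i = 0"
    using usum_ends[of c zs] assms(1) by (intro int_sign_change usum_step) simp_all
  then obtain k where "k \<le> length zs" "usum c zs k = 0" by blast
  with False show ?thesis by (intro exI[of _ k]) (auto intro: gr0I)
qed

text \<open>With a leftmost pivot the sum vanishes at both ends of the turn, where one side is
  empty. It is minus the weight of the first item after the first step and the weight of the last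
  item before the last step. Equal colours make these values opposite, which forces a zero in
  between.\<close>

lemma usum_zero_exists_interior:
  assumes "wsum zs = 0" "2 \<le> length zs" "C (hd zs) = C (last zs)"
    and left: "\<And>a. a \<in> set zs \<Longrightarrow> fst c \<le> fst (pt a)"
  shows "\<exists>k. 0 < k \<and> k < length zs \<and> usum c zs k = 0"
proof -
  have ne: "zs \<noteq> []" using assms(2) by auto
  have "usum c zs 0 = wsum zs"
    unfolding usum_def wsum_conv_sum using left by (intro sum.cong) (auto simp: inU_def)
  then have 1: "usum c zs 1 = - wt C (hd zs)"
    using usum_Suc[of 0 zs c] ne left[of "zs ! 0"] assms(1) by (simp add: hd_conv_nth)
  have "usum c zs (length zs) = 0" using usum_ends[of c zs] \<open>usum c zs 0 = wsum zs\<close> by simp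
  then have 2: "usum c zs (length zs - 1) = wt C (last zs)"
    using usum_Suc[of "length zs - 1" zs c] ne left[of "last zs"] by (simp add: last_conv_nth)
  have "usum c zs 1 = - usum c zs (length zs - 1)" using 1 2 assms(3) by (simp add: wt_def)
  then have "\<exists>i. 1 \<le> i \<and> i \<le> length zs - 1 \<and> usum c zs i = 0"
    using assms(2) by (intro int_sign_change usum_step) simp_all
  then obtain k where "1 \<le> k" "k \<le> length zs - 1" "usum c zs k = 0" by blast
  then show ?thesis using assms(2) by (intro exI[of _ k]) auto
qed

section \<open>Sizes of the two sides\<close>

text \<open>At most two points are on the line, each with at most three copies.\<close>

lemma items_on_line:
  assumes "d \<noteq> 0" "set zs \<subseteq> {..<N}" "\<And>a. count (mset zs) a \<le> 3"
  shows "length (filter (\<lambda>a. side d c (pt a) = 0) zs) \<le> 6"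
proof -
  let ?Z = "{a \<in> set zs. side d c (pt a) = 0}"
  have three: "x = y \<or> y = z \<or> x = z" if "x \<in> ?Z" "y \<in> ?Z" "z \<in> ?Z" for x y z
  proof -
    have "collinear {pt x, pt y, pt z}"
      using that by (intro collinear_side_zero[OF assms(1), where c = c]) (elim insertE emptyE; simp)
    moreover have "x < N" "y < N" "z < N" using that assms(2) by auto
    ultimately show ?thesis using pt_gp by blast
  qed
  have "\<exists>a b. ?Z \<subseteq> {a, b}"
  proof (cases "\<exists>a b. a \<in> ?Z \<and> b \<in> ?Z \<and> a \<noteq> b")
    case True
    then obtain a b where ab: "a \<in> ?Z" "b \<in> ?Z" "a \<noteq> b" by blast
    have "?Z \<subseteq> {a, b}"
    proof
      fix x assume "x \<in> ?Z"
      then show "x \<in> {a, b}" using three[of x a b] ab by blast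
    qed
    then show ?thesis by blast
  next
    case False
    then show ?thesis by (cases "?Z = {}") blast+
  qed
  then obtain a b where ab: "?Z \<subseteq> {a, b}" by blast
  have "length (filter (\<lambda>a. side d c (pt a) = 0) zs) =
      size (filter_mset (\<lambda>a. side d c (pt a) = 0) (mset zs))"
    by (metis mset_filter size_mset)
  also have "\<dots> = (\<Sum>x\<in>?Z. count (filter_mset (\<lambda>a. side d c (pt a) = 0) (mset zs)) x)"
    by (simp add: size_multiset_overloaded_eq)
  also have "\<dots> \<le> (\<Sum>x\<in>?Z. 3)" using assms(3) by (intro sum_mono) auto
  also have "\<dots> = 3 * card ?Z" by simp
  also have "card ?Z \<le> card {a, b}" using ab by (intro card_mono) auto
  also have "card {a, b} \<le> 2" by (cases "a = b") auto
  finally show ?thesis by simp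
qed

text \<open>\<open>inU\<close> agrees with the geometric side for all items off the line. The at
  most six items on it may have gone either way, which costs \<open>2 * 6 = 12\<close>.\<close>

lemma inU_sizes:
  assumes kd: "keyed c ky zs" and k: "0 < k" "k \<le> length zs"
    and cnt: "\<And>a. count (mset zs) a \<le> 3"
    and deep: "\<And>\<tau>. \<bar>\<tau>\<bar> \<le> 1 \<Longrightarrow> H \<le> 2 * length (filter (\<lambda>a. side (key_dir \<tau>) c (pt a) \<ge> 0) zs)"
      "\<And>\<tau>. \<bar>\<tau>\<bar> \<le> 1 \<Longrightarrow> H \<le> 2 * length (filter (\<lambda>a. side (key_dir \<tau>) c (pt a) \<le> 0) zs)"
  shows "H \<le> 2 * card {i. i < length zs \<and> inU c zs k i} + 12"
    and "H \<le> 2 * card {i. i < length zs \<and> \<not> inU c zs k i} + 12"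
proof -
  obtain \<tau> where \<tau>: "\<bar>\<tau>\<bar> \<le> 1"
    "\<And>i. i < length zs \<Longrightarrow> inU c zs k i \<Longrightarrow> side (key_dir \<tau>) c (pt (zs ! i)) \<ge> 0"
    "\<And>i. i < length zs \<Longrightarrow> \<not> inU c zs k i \<Longrightarrow> side (key_dir \<tau>) c (pt (zs ! i)) \<le> 0"
    using inU_side[OF kd k] by metis
  let ?s = "\<lambda>i. side (key_dir \<tau>) c (pt (zs ! i))"
  have z: "card {i. i < length zs \<and> ?s i = 0} \<le> 6"
    using items_on_line[OF key_dir_nonzero, of zs \<tau> c] kd cnt
    by (simp add: keyed_def length_filter_conv_card)
  have *: "H \<le> 2 * card S + 12"
    if "H \<le> 2 * card {i. i < length zs \<and> Q i}" "{i. i < length zs \<and> Q i} \<subseteq> S \<union> {i. i < length zs \<and> ?s i = 0}"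
      "finite S" for Q S
  proof -
    have "card {i. i < length zs \<and> Q i} \<le> card (S \<union> {i. i < length zs \<and> ?s i = 0})"
      using that by (intro card_mono) auto
    also have "\<dots> \<le> card S + card {i. i < length zs \<and> ?s i = 0}" by (rule card_Un_le)
    finally show ?thesis using that(1) z by linarith
  qed
  show "H \<le> 2 * card {i. i < length zs \<and> inU c zs k i} + 12"
  proof (rule *[where Q = "\<lambda>i. ?s i \<ge> 0"])
    show "H \<le> 2 * card {i. i < length zs \<and> ?s i \<ge> 0}"
      using deep(1)[OF \<tau>(1)] by (simp only: length_filter_conv_card)
    show "{i. i < length zs \<and> ?s i \<ge> 0} \<subseteq>
        {i. i < length zs \<and> inU c zs k i} \<union> {i. i < length zs \<and> ?s i = 0}"
    proof
      fix i assume "i \<in> {i. i < length zs \<and> ?s i \<ge> 0}"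
      then show "i \<in> {i. i < length zs \<and> inU c zs k i} \<union> {i. i < length zs \<and> ?s i = 0}"
        using \<tau>(3)[of i] by (cases "inU c zs k i") simp_all
    qed
  qed simp
  show "H \<le> 2 * card {i. i < length zs \<and> \<not> inU c zs k i} + 12"
  proof (rule *[where Q = "\<lambda>i. ?s i \<le> 0"])
    show "H \<le> 2 * card {i. i < length zs \<and> ?s i \<le> 0}"
      using deep(2)[OF \<tau>(1)] by (simp only: length_filter_conv_card)
    show "{i. i < length zs \<and> ?s i \<le> 0} \<subseteq>
        {i. i < length zs \<and> \<not> inU c zs k i} \<union> {i. i < length zs \<and> ?s i = 0}"
    proof
      fix i assume "i \<in> {i. i < length zs \<and> ?s i \<le> 0}"
      then show "i \<in> {i. i < length zs \<and> \<not> inU c zs k i} \<union> {i. i < length zs \<and> ?s i = 0}"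
        using \<tau>(2)[of i] by (cases "inU c zs k i") simp_all
    qed
  qed simp
qed

end

text \<open>If the segment is vertical, division by zero makes this the ordinate of \<open>l\<close>, which lies on the segment.\<close>

definition crossing_height :: "real \<Rightarrow> point \<Rightarrow> point \<Rightarrow> real" where
  "crossing_height x l r = snd l + (x - fst l) * (snd r - snd l) / (fst r - fst l)"

lemma crossing_on_segment:
  assumes "fst l \<le> x" "x \<le> fst r"
  shows "\<exists>t. 0 \<le> t \<and> t \<le> 1 \<and> (x, crossing_height x l r) = (1 - t) *\<^sub>R l + t *\<^sub>R r"
proof (cases "fst l = fst r")
  case True
  then show ?thesis using assms by (intro exI[of _ 0]) (auto simp: crossing_height_def prod_eq_iff)
next
  case False
  then have pos: "fst r - fst l > 0" using assms by simp
  define t where "t = (x - fst l) / (fst r - fst l)"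
  have "t * (fst r - fst l) = x - fst l" using pos by (simp add: t_def)
  moreover have "crossing_height x l r = snd l + t * (snd r - snd l)"
    by (simp add: crossing_height_def t_def)
  moreover have "0 \<le> t" "t \<le> 1" using assms pos by (auto simp: t_def)
  ultimately show ?thesis
    by (intro exI[of _ t]) (auto simp: prod_eq_iff algebra_simps)
qed

text \<open>Each pair that passes the filter has a member satisfying \<open>P\<close>, and different
  pairs use different positions.\<close>

lemma length_filter_map2_le:
  assumes "length ls = length rs" "\<And>l r. l \<in> set ls \<Longrightarrow> r \<in> set rs \<Longrightarrow> R (f l r) \<Longrightarrow> P l \<or> P r"
  shows "length (filter R (map2 f ls rs)) \<le> length (filter P (ls @ rs))"
  using assms
proof (induction ls rs rule: list_induct2)
  case (Cons l ls r rs)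
  have "length (filter R (map2 f ls rs)) \<le> length (filter P (ls @ rs))"
    using Cons.prems by (intro Cons.IH) auto
  then show ?case using Cons.prems[of l r] by auto
qed simp

text \<open>For the upper median, \<open>H - H div 2\<close> positions come from it on and
  \<open>H div 2 + 1\<close> up to it; neither is less than half of \<open>H\<close>.\<close>

lemma median_filter:
  fixes ks :: "real list"
  assumes "sorted ks" "length ks = H" "0 < H"
  shows "H \<le> 2 * length (filter (\<lambda>y. ks ! (H div 2) \<le> y) ks)"
    and "H \<le> 2 * length (filter (\<lambda>y. y \<le> ks ! (H div 2)) ks)"
proof -
  have "{H div 2..<H} \<subseteq> {i. i < length ks \<and> ks ! (H div 2) \<le> ks ! i}"
    using assms by (auto intro: sorted_nth_mono)
  then have "card {H div 2..<H} \<le> length (filter (\<lambda>y. ks ! (H div 2) \<le> y) ks)"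
    unfolding length_filter_conv_card by (intro card_mono) auto
  then show "H \<le> 2 * length (filter (\<lambda>y. ks ! (H div 2) \<le> y) ks)" by simp
  have "H div 2 < H" using assms(3) by (intro div_less_dividend) auto
  have "{..H div 2} \<subseteq> {i. i < length ks \<and> ks ! i \<le> ks ! (H div 2)}"
  proof -
    have "i < length ks \<and> ks ! i \<le> ks ! (H div 2)" if "i \<le> H div 2" for i
      using that \<open>H div 2 < H\<close> assms(2) sorted_nth_mono[OF assms(1) that] by linarith
    then show ?thesis by blast
  qed
  then have "card {..H div 2} \<le> length (filter (\<lambda>y. y \<le> ks ! (H div 2)) ks)"
    unfolding length_filter_conv_card by (intro card_mono) auto
  then show "H \<le> 2 * length (filter (\<lambda>y. y \<le> ks ! (H div 2)) ks)" by simp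
qed

lemma deep_point:
  fixes pt :: "nat \<Rightarrow> point"
  assumes len: "length ls = H" "length rs = H" "0 < H"
    and x: "\<And>l. l \<in> set ls \<Longrightarrow> fst (pt l) \<le> x" "\<And>r. r \<in> set rs \<Longrightarrow> x \<le> fst (pt r)"
    and ks: "sorted ks" "mset ks = mset (map2 (\<lambda>l r. crossing_height x (pt l) (pt r)) ls rs)"
    and \<tau>: "\<bar>\<tau>\<bar> \<le> 1"
  shows "H \<le> 2 * length (filter (\<lambda>a. side (key_dir \<tau>) (x, ks ! (H div 2)) (pt a) \<ge> 0) (ls @ rs))"
    and "H \<le> 2 * length (filter (\<lambda>a. side (key_dir \<tau>) (x, ks ! (H div 2)) (pt a) \<le> 0) (ls @ rs))"
proof -
  let ?ys = "map2 (\<lambda>l r. crossing_height x (pt l) (pt r)) ls rs"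
  define c where "c = (x, ks ! (H div 2))"
  have lk: "length ks = H" using ks(2) len by (metis length_map length_zip min.idem size_mset)
  have fl: "length (filter P ks) = length (filter P ?ys)" for P
    using ks(2) by (metis mset_filter size_mset)
  \<comment> \<open>Both the crossing point and \<open>c\<close> lie on the vertical line, so
    \<open>side\<close> of the former is a nonnegative multiple of its height above
    \<open>c\<close>. Being affine along the segment, it is also a convex combination of the values
    at the ends, which therefore cannot both be strictly of the wrong sign.\<close>
  have conv: "\<exists>t. 0 \<le> t \<and> t \<le> 1 \<and>
      (1 - \<bar>\<tau>\<bar>) * (crossing_height x (pt l) (pt r) - ks ! (H div 2)) =
      (1 - t) * side (key_dir \<tau>) c (pt l) + t * side (key_dir \<tau>) c (pt r)"
    if lr: "l \<in> set ls" "r \<in> set rs" for l r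
  proof -
    obtain t where t: "0 \<le> t" "t \<le> 1"
      "(x, crossing_height x (pt l) (pt r)) = (1 - t) *\<^sub>R pt l + t *\<^sub>R pt r"
      using crossing_on_segment[OF x(1)[OF lr(1)] x(2)[OF lr(2)]] by blast
    have "side (key_dir \<tau>) c (x, crossing_height x (pt l) (pt r)) =
        (1 - \<bar>\<tau>\<bar>) * (crossing_height x (pt l) (pt r) - ks ! (H div 2))"
      by (simp add: side_def key_dir_def c_def)
    with t show ?thesis unfolding t(3) side_convex_combination by metis
  qed
  have "length (filter (\<lambda>y. ks ! (H div 2) \<le> y) ?ys) \<le>
      length (filter (\<lambda>a. side (key_dir \<tau>) c (pt a) \<ge> 0) (ls @ rs))"
  proof (rule length_filter_map2_le)
    fix l r assume lr: "l \<in> set ls" "r \<in> set rs" and y: "ks ! (H div 2) \<le> crossing_height x (pt l) (pt r)"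
    obtain t where t: "0 \<le> t" "t \<le> 1" "(1 - \<bar>\<tau>\<bar>) * (crossing_height x (pt l) (pt r) - ks ! (H div 2)) =
      (1 - t) * side (key_dir \<tau>) c (pt l) + t * side (key_dir \<tau>) c (pt r)" using conv[OF lr] by blast
    have "(1 - \<bar>\<tau>\<bar>) * (crossing_height x (pt l) (pt r) - ks ! (H div 2)) \<ge> 0" using y \<tau> by simp
    then show "side (key_dir \<tau>) c (pt l) \<ge> 0 \<or> side (key_dir \<tau>) c (pt r) \<ge> 0"
      using convex_bound_lt[of "side (key_dir \<tau>) c (pt l)" 0 "side (key_dir \<tau>) c (pt r)" "1 - t" t] t
      by force
  qed (use len in simp)
  then show "H \<le> 2 * length (filter (\<lambda>a. side (key_dir \<tau>) (x, ks ! (H div 2)) (pt a) \<ge> 0) (ls @ rs))"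
    using median_filter(1)[OF ks(1) lk len(3)] unfolding fl c_def by linarith
  have "length (filter (\<lambda>y. y \<le> ks ! (H div 2)) ?ys) \<le>
      length (filter (\<lambda>a. side (key_dir \<tau>) c (pt a) \<le> 0) (ls @ rs))"
  proof (rule length_filter_map2_le)
    fix l r assume lr: "l \<in> set ls" "r \<in> set rs" and y: "crossing_height x (pt l) (pt r) \<le> ks ! (H div 2)"
    obtain t where t: "0 \<le> t" "t \<le> 1" "(1 - \<bar>\<tau>\<bar>) * (crossing_height x (pt l) (pt r) - ks ! (H div 2)) =
      (1 - t) * side (key_dir \<tau>) c (pt l) + t * side (key_dir \<tau>) c (pt r)" using conv[OF lr] by blast
    have "(1 - \<bar>\<tau>\<bar>) * (crossing_height x (pt l) (pt r) - ks ! (H div 2)) \<le> 0"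
      using y \<tau> by (intro mult_nonneg_nonpos) auto
    then show "side (key_dir \<tau>) c (pt l) \<le> 0 \<or> side (key_dir \<tau>) c (pt r) \<le> 0"
      using convex_bound_lt[of "- side (key_dir \<tau>) c (pt l)" 0 "- side (key_dir \<tau>) c (pt r)" "1 - t" t] t
      by force
  qed (use len in simp)
  then show "H \<le> 2 * length (filter (\<lambda>a. side (key_dir \<tau>) (x, ks ! (H div 2)) (pt a) \<le> 0) (ls @ rs))"
    using median_filter(2)[OF ks(1) lk len(3)] unfolding fl c_def by linarith
qed

text \<open>The decrease of the potential \<open>n * ln n\<close> when a block is cut into parts of
  sizes \<open>a\<close> and \<open>b\<close>. It follows from \<open>ln x \<le> x - 1\<close> at
  the two fractions \<open>a / (a + b)\<close> and \<open>b / (a + b)\<close>.\<close>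

lemma entropy_split:
  fixes a b :: real
  assumes "a > 0" "b > 0"
  shows "a * ln a + b * ln b + 2 * a * b / (a + b) \<le> (a + b) * ln (a + b)"
proof -
  have *: "ln (a + b) - ln x \<ge> 1 - x / (a + b)" if "x > 0" for x
    using ln_le_minus_one[of "x / (a + b)"] that assms by (simp add: ln_div)
  have "a * (ln (a + b) - ln a) + b * (ln (a + b) - ln b) \<ge>
      a * (1 - a / (a + b)) + b * (1 - b / (a + b))"
    using assms * by (intro add_mono mult_left_mono) auto
  moreover have "a * (1 - a / (a + b)) + b * (1 - b / (a + b)) = 2 * a * b / (a + b)"
  proof -
    have "1 - a / (a + b) = b / (a + b)" "1 - b / (a + b) = a / (a + b)"
      using assms by (simp_all add: field_simps)
    then have "a * (1 - a / (a + b)) + b * (1 - b / (a + b)) = a * (b / (a + b)) + b * (a / (a + b))"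
      by (simp only:)
    also have "\<dots> = (a * b + b * a) / (a + b)" by (simp add: add_divide_distrib)
    finally show ?thesis by (simp add: mult.commute mult.left_commute)
  qed
  ultimately show ?thesis by (simp add: algebra_simps)
qed

section \<open>Splitting a block of items\<close>

definition mods :: "nat set \<Rightarrow> nat set \<Rightarrow> nat set \<Rightarrow> nat set \<Rightarrow> st \<Rightarrow> st \<Rightarrow> bool" where
  "mods W R A G s s' \<longleftrightarrow> (\<forall>r. r \<notin> W \<longrightarrow> wv s' r = wv s r) \<and> (\<forall>r. r \<notin> R \<longrightarrow> rv s' r = rv s r) \<and>
     (\<forall>a. a \<notin> A \<longrightarrow> wa s' a = wa s a) \<and> (\<forall>a. a \<notin> G \<longrightarrow> ra s' a = ra s a)"

abbreviation (input) "vN \<equiv> 2 :: nat"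
abbreviation (input) "vM \<equiv> 3 :: nat"
abbreviation (input) "vLo \<equiv> 6 :: nat"
abbreviation (input) "vHi \<equiv> 7 :: nat"
abbreviation (input) "vLen \<equiv> 10 :: nat"
abbreviation (input) "vI \<equiv> 11 :: nat"
abbreviation (input) "vItem \<equiv> 12 :: nat"
abbreviation (input) "vT \<equiv> 13 :: nat"
abbreviation (input) "vPiv \<equiv> 14 :: nat"
abbreviation (input) "vHalf \<equiv> 15 :: nat"
abbreviation (input) "vCol \<equiv> 18 :: nat"
abbreviation (input) "vH \<equiv> 19 :: nat"
abbreviation (input) "vK \<equiv> 20 :: nat"
abbreviation (input) "vGo \<equiv> 21 :: nat"
abbreviation (input) "vU \<equiv> 22 :: nat"
abbreviation (input) "vFront \<equiv> 23 :: nat"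
abbreviation (input) "vBack \<equiv> 24 :: nat"
abbreviation (input) "vConst \<equiv> 25 :: nat"
abbreviation (input) "vZero \<equiv> 28 :: nat"

text \<open>Array 2 is the one that \<open>sort_prog\<close> sorts, and \<open>aU\<close> is its
  scratch array 3, free again when the sides are recorded.\<close>

abbreviation (input) "aOut \<equiv> 0 :: nat"
abbreviation (input) "aItem \<equiv> 1 :: nat"
abbreviation (input) "aKey \<equiv> 2 :: nat"
abbreviation (input) "aU \<equiv> 3 :: nat"
abbreviation (input) "aNext \<equiv> 4 :: nat"
abbreviation (input) "aCol \<equiv> 5 :: nat"
abbreviation (input) "aCnt \<equiv> 6 :: nat"
abbreviation (input) "aXY \<equiv> 0 :: nat"

definition fill_x_body :: com where
  "fill_x_body =
      At (Add vT vLo vI) ;; At (Ld vItem aItem vT) ;; At (St aKey vI vItem) ;;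
      At (Add vT vItem vItem) ;; At (RLd 2 aXY vT) ;; At (RSt aKey vI 2) ;; At (AddI vI vI 1)"

definition fill_x :: com where
  "fill_x = At (Cst vI 0) ;; While vI vLen fill_x_body"

definition fill_heights_body :: com where
  "fill_heights_body =
      At (Ld vItem aKey vI) ;; At (Add vT vItem vItem) ;; At (RLd 2 aXY vT) ;;
      At (AddI vT vT 1) ;; At (RLd 3 aXY vT) ;;
      At (Add vT vHalf vI) ;; At (Ld vItem aKey vT) ;; At (Add vT vItem vItem) ;; At (RLd 4 aXY vT) ;;
      At (AddI vT vT 1) ;; At (RLd 5 aXY vT) ;;
      At (Rop RSub 6 0 2) ;; At (Rop RSub 5 5 3) ;; At (Rop RMul 6 6 5) ;; At (Rop RSub 4 4 2) ;;
      At (Rop RDiv 6 6 4) ;; At (Rop RAdd 6 3 6) ;; At (RSt aKey vI 6) ;; At (AddI vI vI 1)"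

definition fill_heights :: com where
  "fill_heights = At (Cst vI 0) ;; While vI vHalf fill_heights_body"

definition find_leftmost_body :: com where
  "find_leftmost_body =
      At (Ld vItem aItem vI) ;; At (Add vT vItem vItem) ;; At (RLd 2 aXY vT) ;;
      At (Add vT vPiv vPiv) ;; At (RLd 0 aXY vT) ;;
      IfR 2 0 (At (Mov vPiv vItem)) Skip ;; At (AddI vI vI 1)"

definition find_leftmost :: com where
  "find_leftmost = At (Ld vPiv aItem vLo) ;; At (Mov vI vLo) ;; While vI vHi find_leftmost_body"

text \<open>Real registers 8 and 9 hold 0 and 2. Adding register 8 serves as a move. The key 2
  exceeds every slope key and thus puts the copies of the pivot item last; two failed comparisons
  detect that item.\<close>

definition key_body :: com where
  "key_body =
     At (Add vT vLo vI) ;; At (Ld vItem aItem vT) ;; At (St aKey vI vItem) ;;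
     At (Add vT vItem vItem) ;; At (RLd 2 aXY vT) ;; At (AddI vT vT 1) ;; At (RLd 3 aXY vT) ;;
     At (Rop RSub 4 2 0) ;; At (Rop RSub 5 3 1) ;; At (Rop RSub 6 8 4) ;; At (Rop RSub 7 8 5) ;;
     IfR 4 8 (At (Rop RAdd 10 6 8) ;; At (Rop RAdd 11 7 8)) (At (Rop RAdd 10 4 8) ;; At (Rop RAdd 11 5 8)) ;;
     IfR 5 8 (At (Rop RAdd 12 7 8)) (At (Rop RAdd 12 5 8)) ;;
     At (Rop RAdd 12 10 12) ;; At (Rop RDiv 11 11 12) ;;
     IfW vItem vPiv Skip (IfW vPiv vItem Skip (At (Rop RAdd 11 9 8))) ;;
     At (RSt aKey vI 11) ;; At (AddI vI vI 1)"

definition fill_keys :: com where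
  "fill_keys = At (Cst vConst 0) ;; At (Cast 8 vConst) ;; At (Cst vConst 2) ;; At (Cast 9 vConst) ;;
     At (Cst vI 0) ;; While vI vLen key_body"

text \<open>Words are unsigned, so \<open>vH\<close> holds the weight above the line shifted by
  \<open>M\<close>, which exceeds or equals the absolute value of any such weight.\<close>

definition init_sides_body :: com where
  "init_sides_body =
      At (Ld vItem aKey vI) ;; At (Add vT vItem vItem) ;; At (RLd 2 aXY vT) ;; At (Ld vCol aCol vItem) ;;
      IfR 2 0 (At (Cst vU 0) ;; At (St aU vI vU))
        (At (Cst vU 1) ;; At (St aU vI vU) ;; IfW vZero vCol (At (AddI vH vH 1)) (At (SubI vH vH 1))) ;;
      At (AddI vI vI 1)"

definition init_sides :: com where
  "init_sides = At (Cst vZero 0) ;; At (Mov vH vM) ;; At (Cst vI 0) ;; While vI vLen init_sides_body"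

text \<open>Changing sides raises the weight above the line exactly if the side bit and the colour
  bit differ: a centre comes up or a leaf goes down. The balance is tested after the change, so a
  balanced starting position does not stop the loop.\<close>

definition flip_sides_body :: com where
  "flip_sides_body =
      At (Ld vItem aKey vK) ;; At (Ld vCol aCol vItem) ;; At (Ld vU aU vK) ;;
      IfW vU vCol (At (AddI vH vH 1)) (IfW vCol vU (At (AddI vH vH 1)) (At (SubI vH vH 1))) ;;
      At (Cst vConst 1) ;; At (Sub vU vConst vU) ;; At (St aU vK vU) ;; At (AddI vK vK 1) ;;
      IfW vH vM Skip (IfW vM vH Skip (At (Cst vGo 0)))"

definition flip_sides :: com where
  "flip_sides = At (Cst vK 0) ;; At (Cst vGo 1) ;; While vZero vGo flip_sides_body"

text \<open>The items are read from the sorted copy in \<open>aKey\<close>, so \<open>aItem\<close>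
  can be overwritten from both ends at once.\<close>

definition partition_items_body :: com where
  "partition_items_body =
      At (Ld vItem aKey vI) ;; At (Ld vU aU vI) ;;
      IfW vZero vU (At (St aItem vFront vItem) ;; At (AddI vFront vFront 1))
        (At (SubI vBack vBack 1) ;; At (St aItem vBack vItem)) ;;
      At (AddI vI vI 1)"

definition partition_items :: com where
  "partition_items = At (Mov vFront vLo) ;; At (Mov vBack vHi) ;; At (Cst vI 0) ;; While vI vLen partition_items_body"

section \<open>Verification of the phases of one cut\<close>

text \<open>An array has room for the \<open>2 * N\<close> coordinates. \<open>M\<close> counts the
  items: a quarter of the points are centres and count three times, the others once.\<close>

locale k13 = ram wbits Q + bicolored pt N C
  for wbits Q :: nat and pt :: "nat \<Rightarrow> point" and N :: nat and C :: "nat \<Rightarrow> bool" +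
  fixes M :: nat
  assumes QN: "Q = 2 * N + 2" and MN: "2 * M = 3 * N"
begin

lemma MQ: "M < Q" using QN MN by linarith

definition env :: "st \<Rightarrow> bool" where
  "env s \<longleftrightarrow> (\<forall>a<N. ra s aXY (2 * a) = fst (pt a) \<and> ra s aXY (Suc (2 * a)) = snd (pt a) \<and>
     wa s aCol a = (if C a then 1 else 0)) \<and> wv s vN = N \<and> wv s vM = M"

lemma fill_x_wp:
  assumes e: "env s" and v: "wv s vLo = lo" "wv s vLen = n" "lo + n \<le> M"
    and it: "\<And>i. i < n \<Longrightarrow> wa s aItem (lo + i) < N"
    and P: "\<And>s' t'. \<lbrakk>mods {11, 12, 13} {2} {2} {2} s s';
      \<And>i. i < n \<Longrightarrow> kin s' i = (fst (pt (wa s aItem (lo + i))), wa s aItem (lo + i));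
      t' \<le> t + 20 * n + 10\<rbrakk> \<Longrightarrow> P s' t'"
  shows "wp fill_x P s t"
proof -
  define J where "J k s' \<longleftrightarrow> mods {11, 12, 13} {2} {2} {2} s s' \<and> wv s' vI = k \<and> k \<le> n \<and>
    (\<forall>i<k. kin s' i = (fst (pt (wa s aItem (lo + i))), wa s aItem (lo + i)))" for k s'
  have "wp (While vI vLen fill_x_body) P (s\<lparr>wv := (wv s)(vI := 0)\<rparr>) (t + 2)"
  proof (rule wp_for[where J = J and m = n and C = 14])
    show "J 0 (s\<lparr>wv := (wv s)(11 := 0)\<rparr>)" by (simp add: J_def mods_def)
    show "(wv s' 11 < wv s' 10) = (k < n)" if "J k s'" for k s'
      using that v by (simp add: J_def mods_def)
    fix k s' t' assume k: "k < n" and J: "J k s'"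
    let ?a = "wa s aItem (lo + k)"
    have a: "?a < N" using it k by simp
    have b: "lo + k < Q" "lo + k < 64 * Q" "?a + ?a < Q" "?a + ?a < 64 * Q" "k < Q" "Suc k < 64 * Q"
      using k v MQ a QN by linarith+
    have x: "ra s aXY (?a + ?a) = fst (pt ?a)" using e a by (simp add: env_def flip: mult_2)
    show "wp fill_x_body (\<lambda>s'' a''. J (Suc k) s'' \<and> a'' \<le> t' + 14) s' t'"
      unfolding fill_x_body_def
      using J b v x k by (auto simp: wp_simps J_def mods_def less_Suc_eq)
  next
    fix s' t' assume "J n s'" "t' \<le> t + 2 + n * (14 + 2) + 2"
    then show "P s' t'" by (intro P) (auto simp: J_def)
  qed
  then show ?thesis unfolding fill_x_def by (simp add: wp_Seq wp_At)
qed

lemma fill_heights_wp: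
  assumes e: "env s" and v: "wv s vHalf = H" "2 * H \<le> M"
    and it: "\<And>i. i < 2 * H \<Longrightarrow> wa s aKey i < N"
    and P: "\<And>s' t'. \<lbrakk>mods {11, 12, 13} {2, 3, 4, 5, 6} {} {2} s s';
      \<And>i. i < H \<Longrightarrow> ra s' aKey i = crossing_height (rv s 0) (pt (wa s aKey i)) (pt (wa s aKey (H + i)));
      t' \<le> t + 40 * H + 10\<rbrakk> \<Longrightarrow> P s' t'"
  shows "wp fill_heights P s t"
proof -
  define J where "J k s' \<longleftrightarrow> mods {11, 12, 13} {2, 3, 4, 5, 6} {} {2} s s' \<and> wv s' vI = k \<and> k \<le> H \<and>
    (\<forall>i<k. ra s' aKey i = crossing_height (rv s 0) (pt (wa s aKey i)) (pt (wa s aKey (H + i))))" for k s'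
  have "wp (While vI vHalf fill_heights_body) P (s\<lparr>wv := (wv s)(vI := 0)\<rparr>) (t + 2)"
  proof (rule wp_for[where J = J and m = H and C = 38])
    show "J 0 (s\<lparr>wv := (wv s)(11 := 0)\<rparr>)" by (simp add: J_def mods_def)
    show "(wv s' 11 < wv s' 15) = (k < H)" if "J k s'" for k s'
      using that v by (simp add: J_def mods_def)
    fix k s' t' assume k: "k < H" and J: "J k s'"
    let ?a = "wa s aKey k" and ?b = "wa s aKey (H + k)"
    have a: "?a < N" "?b < N" using it k by simp_all
    have b: "k < Q" "H + k < Q" "H + k < 64 * Q" "?a + ?a < Q" "?a + ?a < 64 * Q" "Suc (?a + ?a) < Q"
      "Suc (?a + ?a) < 64 * Q" "?b + ?b < Q" "?b + ?b < 64 * Q" "Suc (?b + ?b) < Q"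
      "Suc (?b + ?b) < 64 * Q" "Suc k < 64 * Q"
      using k v MQ a QN by linarith+
    have x: "ra s aXY (?a + ?a) = fst (pt ?a)" "ra s aXY (Suc (?a + ?a)) = snd (pt ?a)"
      "ra s aXY (?b + ?b) = fst (pt ?b)" "ra s aXY (Suc (?b + ?b)) = snd (pt ?b)"
      using e a by (simp_all add: env_def flip: mult_2)
    show "wp fill_heights_body
        (\<lambda>s'' a''. J (Suc k) s'' \<and> a'' \<le> t' + 38) s' t'"
      unfolding fill_heights_body_def
      using J b v x k by (auto simp: wp_simps J_def mods_def less_Suc_eq crossing_height_def)
  next
    fix s' t' assume "J H s'" "t' \<le> t + 2 + H * (38 + 2) + 2"
    then show "P s' t'" by (intro P) (auto simp: J_def)
  qed
  then show ?thesis unfolding fill_heights_def by (simp add: wp_Seq wp_At)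
qed

lemma find_leftmost_wp:
  assumes e: "env s" and v: "wv s vLo = lo" "wv s vHi = lo + n" "0 < n" "lo + n \<le> M"
    and it: "\<And>i. i < n \<Longrightarrow> wa s aItem (lo + i) < N"
    and P: "\<And>s' t' p. \<lbrakk>mods {11, 12, 13, 14} {0, 2} {} {} s s';
      wv s' vPiv = p; \<exists>j<n. p = wa s aItem (lo + j);
      \<And>i. i < n \<Longrightarrow> fst (pt p) \<le> fst (pt (wa s aItem (lo + i)));
      t' \<le> t + 20 * n + 10\<rbrakk> \<Longrightarrow> P s' t'"
  shows "wp find_leftmost P s t"
proof -
  define J where "J k s' \<longleftrightarrow> mods {11, 12, 13, 14} {0, 2} {} {} s s' \<and> wv s' vI = lo + k \<and> k \<le> n \<and>
    (\<exists>j<n. wv s' vPiv = wa s aItem (lo + j)) \<and>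
    (\<forall>i<k. fst (pt (wv s' vPiv)) \<le> fst (pt (wa s aItem (lo + i))))" for k s'
  have loQ: "lo < Q" "lo < 64 * Q" using v MQ by linarith+
  have "wp (While vI vHi find_leftmost_body) P
    (s\<lparr>wv := (wv s)(vPiv := wa s aItem lo, vI := lo)\<rparr>) (t + 2 + 2)"
  proof (rule wp_for[where J = J and m = n and C = 18])
    show "J 0 (s\<lparr>wv := (wv s)(vPiv := wa s aItem lo, vI := lo)\<rparr>)"
      using v(3) by (auto simp: J_def mods_def intro!: exI[of _ 0])
    show "(wv s' vI < wv s' vHi) = (k < n)" if "J k s'" for k s'
      using that v by (simp add: J_def mods_def)
    fix k s' t' assume k: "k < n" and J: "J k s'"
    let ?a = "wa s aItem (lo + k)"
    define p where "p = wv s' vPiv"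
    obtain j where j: "j < n" "p = wa s aItem (lo + j)" using J by (auto simp: J_def p_def)
    have a: "?a < N" "p < N" using it[OF k] it[OF j(1)] j by simp_all
    have b: "lo + k < Q" "?a + ?a < Q" "?a + ?a < 64 * Q" "?a < 64 * Q"
      "p + p < Q" "p + p < 64 * Q" "Suc (lo + k) < 64 * Q"
      using k v MQ a QN by linarith+
    have x: "ra s aXY (?a + ?a) = fst (pt ?a)" "ra s aXY (p + p) = fst (pt p)"
      using e a by (simp_all add: env_def flip: mult_2)
    have m: "mods {11, 12, 13, 14} {0, 2} {} {} s s'" "wv s' vI = lo + k"
      and pm: "\<forall>i<k. fst (pt p) \<le> fst (pt (wa s aItem (lo + i)))"
      using J by (auto simp: J_def p_def)
    show "wp find_leftmost_body
      (\<lambda>s'' a''. J (Suc k) s'' \<and> a'' \<le> t' + 18) s' t'"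
    proof (cases "fst (pt ?a) < fst (pt p)")
      case True
      then have "\<forall>i<k. fst (pt ?a) \<le> fst (pt (wa s aItem (lo + i)))" using pm by force
      then show ?thesis
        using m b v x k True unfolding find_leftmost_body_def by (auto simp: wp_simps J_def mods_def less_Suc_eq p_def[symmetric])
    next
      case False
      then show ?thesis
        using m b v x k pm j unfolding find_leftmost_body_def by (auto simp: wp_simps J_def mods_def less_Suc_eq p_def[symmetric])
    qed
  next
    fix s' t' assume "J n s'" "t' \<le> t + 2 + 2 + n * (18 + 2) + 2"
    then show "P s' t'" by (intro P[of s' "wv s' vPiv"]) (auto simp: J_def)
  qed
  then show ?thesis unfolding find_leftmost_def using v loQ by (simp add: wp_Seq wp_At)
qed

lemma key_body_wp:
  assumes J: "wv s vLo + wv s vI < Q" "wv s vI < Q" "wa s aItem (wv s vLo + wv s vI) = a" "a < N"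
    and c: "c = (rv s 0, rv s 1)" "rv s 8 = 0" "rv s 9 = 2" and e: "env s"
    and P: "\<And>s' t'. \<lbrakk>mods {11, 12, 13} {2, 3, 4, 5, 6, 7, 10, 11, 12} {2} {2} s s'; wv s' vI = Suc (wv s vI);
      \<And>i. kin s' i = (if i = wv s vI then (if a = wv s vPiv then 2 else slope_key c (pt a), a) else kin s i);
      t' \<le> t + 60\<rbrakk> \<Longrightarrow> P s' t'"
  shows "wp key_body P s t"
proof -
  have b: "wv s vLo + wv s vI < 64 * Q" "a + a < Q" "a + a < 64 * Q" "Suc (a + a) < Q"
      "Suc (a + a) < 64 * Q" "Suc (wv s vI) < 64 * Q"
    using J QN by linarith+
  have x: "ra s aXY (a + a) = fst (pt a)" "ra s aXY (Suc (a + a)) = snd (pt a)"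
    using e J by (simp_all add: env_def flip: mult_2)
  show ?thesis
    unfolding key_body_def
    using J b x c
    by (simp add: wp_simps) (intro conjI impI; rule P; simp add: mods_def slope_key_def)
qed

lemma fill_keys_wp:
  assumes e: "env s" and v: "wv s vLo = lo" "wv s vLen = n" "lo + n \<le> M"
    and it: "\<And>i. i < n \<Longrightarrow> wa s aItem (lo + i) < N"
    and P: "\<And>s' t'. \<lbrakk>mods {11, 12, 13, 25} {2, 3, 4, 5, 6, 7, 8, 9, 10, 11, 12} {2} {2} s s';
      \<And>i. i < n \<Longrightarrow> kin s' i = (let a = wa s aItem (lo + i) in
        (if a = wv s vPiv then 2 else slope_key (rv s 0, rv s 1) (pt a), a));
      t' \<le> t + 70 * n + 20\<rbrakk> \<Longrightarrow> P s' t'"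
  shows "wp fill_keys P s t"
proof -
  define g where "g i = (let a = wa s aItem (lo + i) in
        (if a = wv s vPiv then 2 else slope_key (rv s 0, rv s 1) (pt a), a))" for i
  define J where "J k s' \<longleftrightarrow> mods {11, 12, 13, 25} {2, 3, 4, 5, 6, 7, 8, 9, 10, 11, 12} {2} {2} s s' \<and>
    wv s' vI = k \<and> k \<le> n \<and> rv s' 8 = 0 \<and> rv s' 9 = 2 \<and> (\<forall>i<k. kin s' i = g i)" for k s'
  have "wp (While vI vLen key_body) P
      (s\<lparr>rv := (rv s)(8 := 0, 9 := 2), wv := (wv s)(vConst := 2, vI := 0)\<rparr>) (t + 2 + 2 + 2 + 2 + 2)"
  proof (rule wp_for[where J = J and m = n and C = 60])
    show "J 0 (s\<lparr>rv := (rv s)(8 := 0, 9 := 2), wv := (wv s)(vConst := 2, vI := 0)\<rparr>)"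
      by (simp add: J_def mods_def)
    show "(wv s' vI < wv s' vLen) = (k < n)" if "J k s'" for k s'
      using that v by (simp add: J_def mods_def)
    fix k s' t' assume k: "k < n" and J: "J k s'"
    let ?a = "wa s aItem (lo + k)"
    have m: "mods {11, 12, 13, 25} {2, 3, 4, 5, 6, 7, 8, 9, 10, 11, 12} {2} {2} s s'"
      and m': "wv s' vI = k" "rv s' 8 = 0" "rv s' 9 = 2" "\<forall>i<k. kin s' i = g i"
      using J by (auto simp: J_def)
    show "wp key_body (\<lambda>s'' a''. J (Suc k) s'' \<and> a'' \<le> t' + 60) s' t'"
    proof (rule key_body_wp[where a = ?a and c = "(rv s 0, rv s 1)"])
      show "wv s' vLo + wv s' vI < Q" "wv s' vI < Q" using m m' v k MQ by (simp_all add: mods_def)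
      show "wa s' aItem (wv s' vLo + wv s' vI) = ?a" "(rv s 0, rv s 1) = (rv s' 0, rv s' 1)"
        using m m' v by (simp_all add: mods_def)
      show "?a < N" using it k by simp
      show "rv s' 8 = 0" "rv s' 9 = 2" by fact+
      show "env s'" using e m by (simp add: env_def mods_def)
      fix s2 :: st and t2
      assume 2: "mods {11, 12, 13} {2, 3, 4, 5, 6, 7, 10, 11, 12} {2} {2} s' s2" "wv s2 vI = Suc (wv s' vI)"
        "\<And>i. kin s2 i = (if i = wv s' vI then (if ?a = wv s' vPiv then 2
          else slope_key (rv s 0, rv s 1) (pt ?a), ?a) else kin s' i)" "t2 \<le> t' + 60"
      have "mods {11, 12, 13, 25} {2, 3, 4, 5, 6, 7, 8, 9, 10, 11, 12} {2} {2} s s2"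
        using m 2(1) by (simp add: mods_def)
      moreover have "rv s2 8 = 0" "rv s2 9 = 2" using 2(1) m' by (simp_all add: mods_def)
      moreover have "wv s' vPiv = wv s vPiv" using m by (simp add: mods_def)
      then have "\<forall>i<Suc k. kin s2 i = g i" unfolding 2(3) using m' by (simp add: g_def Let_def less_Suc_eq)
      ultimately show "J (Suc k) s2 \<and> t2 \<le> t' + 60" using 2(2,4) k m' by (simp add: J_def)
    qed
  next
    fix s' t' assume "J n s'" "t' \<le> t + 2 + 2 + 2 + 2 + 2 + n * (60 + 2) + 2"
    then show "P s' t'" by (intro P) (auto simp: J_def g_def)
  qed
  then show ?thesis unfolding fill_keys_def by (simp add: wp_Seq wp_At)
qed

lemma init_sides_wp:
  assumes e: "env s" and v: "wv s vLen = n" "n \<le> M" and zs: "length zs = n" "set zs \<subseteq> {..<N}"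
    "\<And>i. i < n \<Longrightarrow> wa s aKey i = zs ! i" and c: "fst c = rv s 0"
    and P: "\<And>s' t'. \<lbrakk>mods {11, 12, 13, 18, 19, 22, 28} {2} {3} {} s s'; wv s' vZero = 0;
      \<And>i. i < n \<Longrightarrow> wa s' aU i = (if inU c zs 0 i then 1 else 0); int (wv s' vH) = int M + usum c zs 0;
      t' \<le> t + 30 * n + 20\<rbrakk> \<Longrightarrow> P s' t'"
  shows "wp init_sides P s t"
proof -
  define g where "g k = (\<Sum>i<k. if inU c zs 0 i then wt C (zs ! i) else 0)" for k
  define J where "J k s' \<longleftrightarrow> mods {11, 12, 13, 18, 19, 22, 28} {2} {3} {} s s' \<and> wv s' vZero = 0 \<and>
    wv s' vI = k \<and> k \<le> n \<and> (\<forall>i<k. wa s' aU i = (if inU c zs 0 i then 1 else 0)) \<and>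
    int (wv s' vH) = int M + g k" for k s'
  have gb: "\<bar>g k\<bar> \<le> int k" for k
    by (induction k) (auto simp: g_def wt_def)
  have MM: "M < 64 * Q" using MQ by linarith
  have "wp (While vI vLen init_sides_body) P
      (s\<lparr>wv := (wv s)(vZero := 0, vH := M, vI := 0)\<rparr>) (t + 2 + 2 + 2)"
  proof (rule wp_for[where J = J and m = n and C = 24])
    show "J 0 (s\<lparr>wv := (wv s)(vZero := 0, vH := M, vI := 0)\<rparr>)"
      by (simp add: J_def mods_def g_def)
    show "(wv s' vI < wv s' vLen) = (k < n)" if "J k s'" for k s'
      using that v by (simp add: J_def mods_def)
    fix k s' t' assume k: "k < n" and J: "J k s'"
    let ?a = "zs ! k"
    have m: "mods {11, 12, 13, 18, 19, 22, 28} {2} {3} {} s s'"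
      and m': "wv s' vI = k" "wv s' vZero = 0" "int (wv s' vH) = int M + g k"
        "\<forall>i<k. wa s' aU i = (if inU c zs 0 i then 1 else 0)"
      using J by (auto simp: J_def)
    have a: "?a < N" using zs k nth_mem by blast
    \<comment> \<open>So far the shifted sum has moved by at most \<open>k < M\<close>, so it can
      still be decreased.\<close>
    have h: "0 < wv s' vH" "wv s' vH < 2 * M" using m'(3) gb[of k] k v(2) by linarith+
    have b: "k < Q" "?a < Q" "?a + ?a < Q" "?a + ?a < 64 * Q" "Suc k < 64 * Q" "wv s' vH < 64 * Q" "Suc (wv s' vH) < 64 * Q"
      using k v MQ a QN h by linarith+
    have x: "ra s aXY (?a + ?a) = fst (pt ?a)" "wa s aCol ?a = (if C ?a then 1 else 0)" "wa s aKey k = ?a"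
      using e a zs(3) k by (simp_all add: env_def flip: mult_2)
    have gS: "g (Suc k) = g k + (if fst c \<le> fst (pt ?a) then wt C ?a else 0)"
      by (simp add: g_def inU_def)
    show "wp init_sides_body (\<lambda>s'' a''. J (Suc k) s'' \<and> a'' \<le> t' + 24) s' t'"
      unfolding init_sides_body_def
      by (cases "C ?a"; cases "fst (pt ?a) < rv s 0"; insert m m' b x k h c gS;
          auto simp: wp_simps J_def mods_def less_Suc_eq inU_def wt_def of_nat_diff)
  next
    fix s' t' assume "J n s'" "t' \<le> t + 2 + 2 + 2 + n * (24 + 2) + 2"
    then show "P s' t'" by (intro P) (auto simp: J_def usum_def g_def zs)
  qed
  then show ?thesis unfolding init_sides_def using e MM by (simp add: wp_Seq wp_At env_def)
qed

lemma usum_bound: "\<bar>usum c zs k\<bar> \<le> int (length zs)"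
proof -
  have "\<bar>usum c zs k\<bar> \<le> (\<Sum>i<length zs. \<bar>if inU c zs k i then wt C (zs ! i) else 0\<bar>)"
    unfolding usum_def by (rule sum_abs)
  also have "\<dots> \<le> (\<Sum>i<length zs. 1)" by (intro sum_mono) (auto simp: wt_def)
  finally show ?thesis by simp
qed

lemma flip_sides_wp:
  assumes e: "env s" and v: "wv s vZero = 0" "n \<le> M"
    and zs: "length zs = n" "set zs \<subseteq> {..<N}" "\<And>i. i < n \<Longrightarrow> wa s aKey i = zs ! i"
    and U: "\<And>i. i < n \<Longrightarrow> wa s aU i = (if inU c zs 0 i then 1 else 0)"
    and h: "int (wv s vH) = int M + usum c zs 0"
    and K: "0 < K" "K \<le> n" "usum c zs K = 0" "\<And>k. 0 < k \<Longrightarrow> k < K \<Longrightarrow> usum c zs k \<noteq> 0"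
    and P: "\<And>s' t'. \<lbrakk>mods {12, 18, 19, 20, 21, 22, 25} {} {3} {} s s';
      \<And>i. i < n \<Longrightarrow> wa s' aU i = (if inU c zs K i then 1 else 0); t' \<le> t + 40 * n + 20\<rbrakk> \<Longrightarrow> P s' t'"
  shows "wp flip_sides P s t"
proof -
  define J where "J k s' \<longleftrightarrow> mods {12, 18, 19, 20, 21, 22, 25} {} {3} {} s s' \<and>
    wv s' vK = k \<and> k \<le> K \<and> (\<forall>i<n. wa s' aU i = (if inU c zs k i then 1 else 0)) \<and>
    int (wv s' vH) = int M + usum c zs k \<and> wv s' vGo = (if k < K then 1 else 0)" for k s'
  have "wp (While vZero vGo flip_sides_body) P
      (s\<lparr>wv := (wv s)(vK := 0, vGo := 1)\<rparr>) (t + 2 + 2)"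
  proof (rule wp_for[where J = J and m = K and C = 32])
    show "J 0 (s\<lparr>wv := (wv s)(vK := 0, vGo := 1)\<rparr>)"
      using U h K by (simp add: J_def mods_def)
    show "(wv s' vZero < wv s' vGo) = (k < K)" if "J k s'" for k s'
      using that v by (simp add: J_def mods_def)
    fix k s' t' assume k: "k < K" and J: "J k s'"
    let ?a = "zs ! k"
    have kn: "k < n" using k K by simp
    have m: "mods {12, 18, 19, 20, 21, 22, 25} {} {3} {} s s'"
      and m': "wv s' vK = k" "int (wv s' vH) = int M + usum c zs k" "wv s' vGo = 1"
        and mU: "\<forall>i<n. wa s' aU i = (if inU c zs k i then 1 else 0)"
      using J k by (auto simp: J_def)
    have a: "?a < N" using zs kn nth_mem by blast
    define u where "u = (fst c \<le> fst (pt ?a))"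
    have uk: "inU c zs k k = u" "inU c zs (Suc k) k = (\<not> u)" by (auto simp: u_def inU_def)
    have other: "inU c zs (Suc k) i = inU c zs k i" if "i \<noteq> k" for i using that by (auto simp: inU_def)
    have uS: "usum c zs (Suc k) = usum c zs k + (if u then - wt C ?a else wt C ?a)"
      using usum_Suc[of k zs c] kn zs by (simp add: u_def)
    have fin: "usum c zs (Suc k) = 0 \<longleftrightarrow> Suc k = K"
      using K(3) K(4)[of "Suc k"] k by (cases "Suc k = K") auto
    have hb: "usum c zs (Suc k) \<ge> - int M" "usum c zs k \<le> int M"
      using usum_bound[of c zs "Suc k"] usum_bound[of c zs k] zs v by linarith+
    have h2: "wv s' vH \<le> 2 * M" using hb m' by linarith
    have b: "k < Q" "?a < Q" "Suc k < 64 * Q" "wv s' vH < 64 * Q" "Suc (wv s' vH) < 64 * Q" "0 < Q"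
      using kn v MQ a QN h2 by linarith+
    have x: "wa s aCol ?a = (if C ?a then 1 else 0)" "wa s aKey k = ?a"
      using e a zs(3) kn by (simp_all add: env_def)
    have vM: "wv s vM = M" using e by (simp add: env_def)
    \<comment> \<open>The next sum is at least \<open>- M\<close> as well, so a decrease starts from
      a positive word.\<close>
    define h' where "h' = (if C ?a = u then wv s' vH - 1 else Suc (wv s' vH))"
    have h': "int h' = int M + usum c zs (Suc k)" and hpos: "C ?a = u \<Longrightarrow> 0 < wv s' vH"
      using hb uS m'(2) by (auto simp: h'_def wt_def of_nat_diff split: if_splits)
    have hM: "h' < M \<or> M < h' \<longleftrightarrow> Suc k \<noteq> K" using fin h' by linarith
    define s2 where "s2 = s'\<lparr>wv := (wv s')(vItem := ?a, vCol := if C ?a then 1 else 0, vH := h', vConst := 1,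
        vU := if u then 0 else 1, vK := Suc k, vGo := if Suc k < K then 1 else 0),
        wa := (wa s')(aU := (wa s' aU)(k := if u then 0 else 1))\<rparr>"
    have J2: "J (Suc k) s2"
      using m mU k h' uk other unfolding J_def s2_def by (auto simp: mods_def)
    have mv: "wv s' vZero = 0" "wa s' aKey = wa s aKey" "wa s' aCol = wa s aCol" "wv s' vM = M"
      using m v vM by (simp_all add: mods_def)
    have "wp flip_sides_body (\<lambda>s'' a''. wv s'' = wv s2 \<and> rv s'' = rv s2 \<and> wa s'' = wa s2 \<and> ra s'' = ra s2 \<and> a'' \<le> t' + 32) s' t'"
      unfolding flip_sides_body_def
      by (cases "C ?a"; cases u; insert m' b x hpos mv uk hM mU kn k;
          auto simp: wp_simps s2_def h'_def fun_eq_iff)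
    then show "wp flip_sides_body (\<lambda>s'' a''. J (Suc k) s'' \<and> a'' \<le> t' + 32) s' t'"
      by (rule wp_mono) (use J2 in \<open>simp add: J_def mods_def\<close>)
  next
    fix s' t' assume "J K s'" "t' \<le> t + 2 + 2 + K * (32 + 2) + 2"
    then show "P s' t'" using K(2) by (intro P) (auto simp: J_def)
  qed
  then show ?thesis unfolding flip_sides_def by (simp add: wp_Seq wp_At)
qed

lemma partition_items_wp:
  assumes v: "wv s vLo = lo" "wv s vHi = lo + n" "wv s vLen = n" "lo + n \<le> M" "wv s vZero = 0"
    and zs: "length zs = n" "\<And>i. i < n \<Longrightarrow> wa s aKey i = zs ! i"
    and U: "\<And>i. i < n \<Longrightarrow> wa s aU i = (if b i then 1 else 0)"
    and P: "\<And>s' t'. \<lbrakk>mods {11, 12, 22, 23, 24} {} {1} {} s s';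
      wv s' vFront = lo + length (filter b [0..<n]);
      map (wa s' aItem) [lo..<lo + length (filter b [0..<n])] = map ((!) zs) (filter b [0..<n]);
      map (wa s' aItem) [lo + length (filter b [0..<n])..<lo + n] = rev (map ((!) zs) (filter (\<lambda>i. \<not> b i) [0..<n]));
      \<And>j. j < lo \<or> lo + n \<le> j \<Longrightarrow> wa s' aItem j = wa s aItem j; t' \<le> t + 30 * n + 20\<rbrakk> \<Longrightarrow> P s' t'"
  shows "wp partition_items P s t"
proof -
  define X where "X k = map ((!) zs) (filter b [0..<k])" for k
  define Y where "Y k = map ((!) zs) (filter (\<lambda>i. \<not> b i) [0..<k])" for k
  have XY: "length (X k) + length (Y k) = k" for k
    using sum_length_filter_compl[of b "[0..<k]"] by (simp add: X_def Y_def)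
  have XS: "X (Suc k) = (if b k then X k @ [zs ! k] else X k)"
    and YS: "Y (Suc k) = (if b k then Y k else Y k @ [zs ! k])" for k
    by (simp_all add: X_def Y_def)
  define J where "J k s' \<longleftrightarrow> mods {11, 12, 22, 23, 24} {} {1} {} s s' \<and>
    wv s' vI = k \<and> k \<le> n \<and> wv s' vFront = lo + length (X k) \<and> wv s' vBack = lo + n - length (Y k) \<and>
    map (wa s' aItem) [lo..<lo + length (X k)] = X k \<and>
    map (wa s' aItem) [lo + n - length (Y k)..<lo + n] = rev (Y k) \<and>
    (\<forall>j. j < lo \<or> lo + n \<le> j \<longrightarrow> wa s' aItem j = wa s aItem j)" for k s'
  have Q: "lo < 64 * Q" "lo + n < 64 * Q" using v MQ by linarith+
  have "wp (While vI vLen partition_items_body) P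
      (s\<lparr>wv := (wv s)(vFront := lo, vBack := lo + n, vI := 0)\<rparr>) (t + 2 + 2 + 2)"
  proof (rule wp_for[where J = J and m = n and C = 20])
    show "J 0 (s\<lparr>wv := (wv s)(vFront := lo, vBack := lo + n, vI := 0)\<rparr>)"
      by (simp add: J_def mods_def X_def Y_def)
    show "(wv s' vI < wv s' vLen) = (k < n)" if "J k s'" for k s'
      using that v by (simp add: J_def mods_def)
    fix k s' t' assume k: "k < n" and J: "J k s'"
    define f where "f = lo + length (X k)"
    define g where "g = lo + n - length (Y k)"
    have m: "mods {11, 12, 22, 23, 24} {} {1} {} s s'"
      and m': "wv s' vI = k" "wv s' vFront = f" "wv s' vBack = g"
      and it: "map (wa s' aItem) [lo..<f] = X k" "map (wa s' aItem) [g..<lo + n] = rev (Y k)"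
        "\<forall>j. j < lo \<or> lo + n \<le> j \<longrightarrow> wa s' aItem j = wa s aItem j"
      using J by (auto simp: J_def f_def g_def)
    have fg: "f < g" "lo \<le> f" "g \<le> lo + n" "0 < g" using XY[of k] k by (auto simp: f_def g_def)
    have b: "k < Q" "f < Q" "g < Q" "g - 1 < Q" "Suc k < 64 * Q" "Suc f < 64 * Q" "g < 64 * Q"
      using k v MQ fg by linarith+
    have mv: "wv s' vZero = 0" "wa s' aKey = wa s aKey" "wa s' aU = wa s aU"
      using m v by (simp_all add: mods_def)
    show "wp partition_items_body (\<lambda>s'' a''. J (Suc k) s'' \<and> a'' \<le> t' + 20) s' t'"
    proof (cases "b k")
      case True
      have 1: "map ((wa s' aItem)(f := zs ! k)) [lo..<Suc f] = X k @ [zs ! k]"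
        using it(1) fg by (simp add: map_fun_upd flip: it(1))
      have 2: "map ((wa s' aItem)(f := zs ! k)) [g..<lo + n] = rev (Y k)"
        using it(2) fg by (simp add: map_fun_upd)
      show ?thesis
        unfolding partition_items_body_def
        using True m m' it(3) fg b mv U[OF k] zs(2)[OF k] 1 2 k v(4)
        by (auto simp: wp_simps J_def mods_def XS YS f_def g_def)
    next
      case False
      have "map ((wa s' aItem)(g - Suc 0 := zs ! k)) [lo..<f] = map (wa s' aItem) [lo..<f]"
        using fg by (intro map_cong refl) auto
      then have 1: "map ((wa s' aItem)(g - Suc 0 := zs ! k)) [lo..<f] = X k"
        using it(1) by (rule trans)
      have "[g - Suc 0..<lo + n] = (g - Suc 0) # [g..<lo + n]"
        using fg by (simp add: upt_conv_Cons)
      then have 2: "map ((wa s' aItem)(g - Suc 0 := zs ! k)) [g - Suc 0..<lo + n] = zs ! k # rev (Y k)"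
        using it(2) fg by (simp add: map_fun_upd)
      have g': "lo + n - Suc (length (Y k)) = g - Suc 0" by (simp add: g_def)
      show ?thesis
        unfolding partition_items_body_def
        using False m m' it(3) fg b mv U[OF k] zs(2)[OF k] 1 2 k v(4)
        by (auto simp: wp_simps J_def mods_def XS YS f_def g' simp flip: g_def)
    qed
  next
    fix s' t' assume J: "J n s'" and "t' \<le> t + 2 + 2 + 2 + n * (20 + 2) + 2"
    \<comment> \<open>Every item has gone to one of the two ends, so front and back have
      met.\<close>
    have "lo + n - length (Y n) = lo + length (X n)" using XY[of n] by linarith
    then show "P s' t'" using J \<open>t' \<le> _\<close> unfolding J_def X_def Y_def by (intro P) auto
  qed
  then show ?thesis unfolding partition_items_def using v Q by (simp add: wp_Seq wp_At)
qed

end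

section \<open>Choice of the pivot\<close>

text \<open>For large blocks \<open>vPiv\<close> is set to \<open>N\<close>, which is the number of
  no item, so that no key is replaced by 2 later.\<close>

definition choose_center :: com where
  "choose_center = At (Cst vConst 49) ;;
     IfW vLen vConst
       (find_leftmost ;; At (Add vT vPiv vPiv) ;; At (RLd 0 aXY vT) ;; At (AddI vT vT 1) ;; At (RLd 1 aXY vT))
       (At (Mov vPiv vN) ;; fill_x ;; At (Mov vSize vLen) ;; sort_prog ;;
        At (Half vHalf vLen) ;; At (Ld vItem aKey vHalf) ;; At (Add vT vItem vItem) ;; At (RLd 0 aXY vT) ;;
        fill_heights ;; At (Mov vSize vHalf) ;; sort_prog ;; At (Half vT vHalf) ;; At (RLd 1 aKey vT))"

text \<open>The sort permutes pairs of a key and an item. As the key is a function of the item, the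
  sorted pairs are still determined by their items.\<close>

lemma mset_map_pair_graph:
  assumes "mset (map f [0..<n]) = mset (map (\<lambda>a. (g a, a)) xs)"
  shows "mset (map (\<lambda>i. snd (f i)) [0..<n]) = mset xs"
    and "map f [0..<n] = map (\<lambda>a. (g a, a)) (map (\<lambda>i. snd (f i)) [0..<n])"
proof -
  have "image_mset snd (mset (map f [0..<n])) = image_mset snd (mset (map (\<lambda>a. (g a, a)) xs))"
    using assms by simp
  then show "mset (map (\<lambda>i. snd (f i)) [0..<n]) = mset xs"
    by (simp add: image_mset.compositionality comp_def)
  have "f i = (g (snd (f i)), snd (f i))" if "i < n" for i
  proof -
    have "f i \<in> set (map f [0..<n])" using that by simp
    also have "set (map f [0..<n]) = set (map (\<lambda>a. (g a, a)) xs)"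
      using assms by (metis set_mset_mset)
    finally show ?thesis by auto
  qed
  then show "map f [0..<n] = map (\<lambda>a. (g a, a)) (map (\<lambda>i. snd (f i)) [0..<n])"
    by simp
qed

lemma sorted_fst_of_kle:
  "sorted_wrt kle ps \<Longrightarrow> sorted (map fst ps)"
  by (auto simp: sorted_map kle_def elim!: sorted_wrt_mono_rel[rotated])

lemma nth_bounded:
  fixes zs :: "nat list"
  shows "set zs \<subseteq> {..<n} \<Longrightarrow> i < length zs \<Longrightarrow> zs ! i < n"
  by (meson lessThan_iff nth_mem subsetD)

context k13
begin

definition block :: "st \<Rightarrow> nat \<Rightarrow> nat \<Rightarrow> nat list" where
  "block s lo hi = map (wa s aItem) [lo..<hi]"

text \<open>All weights are odd, so a sum of weights has the parity of the number of
  summands.\<close>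

lemma even_length_wsum: "wsum xs = 0 \<Longrightarrow> even (length xs)"
proof -
  have "even (wsum xs + int (length xs))" for xs
    by (induction xs) (auto simp: wt_def)
  from this[of xs] show "wsum xs = 0 \<Longrightarrow> even (length xs)" by simp
qed

definition good_center :: "nat list \<Rightarrow> point \<Rightarrow> nat \<Rightarrow> bool" where
  "good_center xs c p \<longleftrightarrow>
     (if length xs < 49 then p \<in> set xs \<and> c = pt p \<and> (\<forall>a\<in>set xs. fst c \<le> fst (pt a))
      else p = N \<and> (\<forall>\<tau>. \<bar>\<tau>\<bar> \<le> 1 \<longrightarrow>
        length xs \<le> 4 * length (filter (\<lambda>a. side (key_dir \<tau>) c (pt a) \<ge> 0) xs) \<and>
        length xs \<le> 4 * length (filter (\<lambda>a. side (key_dir \<tau>) c (pt a) \<le> 0) xs)))"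

lemma choose_center_wp:
  assumes e: "env s" and v: "wv s vLo = lo" "wv s vHi = lo + n" "wv s vLen = n" "lo + n \<le> M" "0 < n" "n \<le> 2 ^ L"
    and xs: "xs = block s lo (lo + n)" "set xs \<subseteq> {..<N}" "wsum xs = 0"
    and P: "\<And>s' t'. \<lbrakk>mods {11..} UNIV {2, 3} {2, 3} s s'; good_center xs (rv s' 0, rv s' 1) (wv s' vPiv);
      t' \<le> t + 600 * (n + 1) * (L + 1)\<rbrakk> \<Longrightarrow> P s' t'"
  shows "wp choose_center P s t"
proof -
  have len: "length xs = n" by (simp add: xs block_def)
  have xsi: "xs ! i = wa s aItem (lo + i)" if "i < n" for i using that by (simp add: xs block_def)
  have it: "wa s aItem (lo + i) < N" if "i < n" for i
    using nth_bounded[OF xs(2), of i] that len xsi by simp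
  have nQ: "n < Q" "n < 64 * Q" using v MQ by linarith+
  have time0: "600 * (n + 1) \<le> 600 * (n + 1) * (L + 1)" by simp
  show ?thesis
  proof (cases "n < 49")
    case True
    have "wp find_leftmost (wp (At (Add vT vPiv vPiv) ;; At (RLd 0 aXY vT) ;; At (AddI vT vT 1) ;; At (RLd 1 aXY vT)) P)
        (s\<lparr>wv := (wv s)(vConst := 49)\<rparr>) (t + 2 + 2)"
    proof (rule find_leftmost_wp[where lo = lo and n = n])
      show "env (s\<lparr>wv := (wv s)(vConst := 49)\<rparr>)" using e by (simp add: env_def)
      fix s' t' p
      assume 1: "mods {11, 12, 13, 14} {0, 2} {} {} (s\<lparr>wv := (wv s)(vConst := 49)\<rparr>) s'"
        "wv s' vPiv = p" "\<exists>j<n. p = wa (s\<lparr>wv := (wv s)(vConst := 49)\<rparr>) aItem (lo + j)"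
        "\<And>i. i < n \<Longrightarrow> fst (pt p) \<le> fst (pt (wa (s\<lparr>wv := (wv s)(vConst := 49)\<rparr>) aItem (lo + i)))"
        "t' \<le> t + 2 + 2 + 20 * n + 10"
      obtain j where j: "j < n" "p = xs ! j" using 1(3) xsi by auto
      have p: "p \<in> set xs" "p < N" using j len nth_bounded[OF xs(2)] by simp_all
      have b: "p + p < Q" "p + p < 64 * Q" "Suc (p + p) < Q" "Suc (p + p) < 64 * Q"
        using p QN by linarith+
      have x: "ra s aXY (p + p) = fst (pt p)" "ra s aXY (Suc (p + p)) = snd (pt p)"
        using e p by (simp_all add: env_def flip: mult_2)
      have r: "ra s' aXY = ra s aXY" using 1(1) by (simp add: mods_def)
      have le: "\<forall>a\<in>set xs. fst (pt p) \<le> fst (pt a)"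
        using 1(4) xsi len by (auto simp: in_set_conv_nth)
      show "wp (At (Add vT vPiv vPiv) ;; At (RLd 0 aXY vT) ;; At (AddI vT vT 1) ;; At (RLd 1 aXY vT)) P s' t'"
        by (simp add: wp_simps 1(2) b x r, rule P)
          (use 1(1,2,5) p le True time0 len in \<open>auto simp: good_center_def mods_def\<close>)
    qed (use v it in \<open>auto\<close>)
    then show ?thesis using True v unfolding choose_center_def by (simp add: wp_Seq wp_At wp_IfW)
  next
    case False
    define H where "H = n div 2"
    \<comment> \<open>Balance makes the block even, so the items left and right of the vertical line
      can be paired off completely.\<close>
    have nH: "n = 2 * H" using even_length_wsum[OF xs(3)] len by (simp add: H_def)
    have H0: "0 < H" "H \<le> n" "H < n" "H \<le> 2 ^ L" using False nH v(6) by auto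
    define s1 :: st where "s1 = s\<lparr>wv := (wv s)(vConst := 49, vPiv := N)\<rparr>"
    let ?rest4 = "At (Half vT vHalf) ;; At (RLd 1 aKey vT)"
    let ?rest3 = "fill_heights ;; At (Mov vSize vHalf) ;; sort_prog ;; ?rest4"
    let ?rest2 = "At (Half vHalf vLen) ;; At (Ld vItem aKey vHalf) ;; At (Add vT vItem vItem) ;; At (RLd 0 aXY vT) ;; ?rest3"
    let ?rest1 = "At (Mov vSize vLen) ;; sort_prog ;; ?rest2"
    have main: "wp fill_x (wp ?rest1 P) s1 (t + 2 + 2 + 2)"
    proof (rule fill_x_wp[where lo = lo and n = n])
      show "env s1" using e by (simp add: env_def s1_def)
      show "wv s1 vLo = lo" "wv s1 vLen = n" "lo + n \<le> M" using v by (simp_all add: s1_def)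
      show "wa s1 aItem (lo + i) < N" if "i < n" for i using it that by (simp add: s1_def)
      fix s2 :: st and t2
      assume 2: "mods {11, 12, 13} {2} {2} {2} s1 s2"
        "\<And>i. i < n \<Longrightarrow> kin s2 i = (fst (pt (wa s1 aItem (lo + i))), wa s1 aItem (lo + i))"
        "t2 \<le> t + 2 + 2 + 2 + 20 * n + 10"
      define s2' :: st where "s2' = s2\<lparr>wv := (wv s2)(vSize := n)\<rparr>"
      have "wp sort_prog (wp ?rest2 P) s2' (t2 + 2)"
      proof (rule sort_prog_wp[where n = n and L = L])
        show "n < Q" "wv s2' vSize = n" "n \<le> 2 ^ L" using nQ v by (auto simp: s2'_def)
        fix s3 :: st and t3
        assume 3: "sort_frame s2' s3" "sorted_wrt kle (map (kin s3) [0..<n])"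
          "mset (map (kin s3) [0..<n]) = mset (map (kin s2') [0..<n])"
          "t3 \<le> t2 + 2 + 220 * (n + 1) * (L + 1)"
        define zs where "zs = map (wa s3 aKey) [0..<n]"
        have "map (kin s2') [0..<n] = map (\<lambda>a. (fst (pt a), a)) xs"
          using 2(2) xsi len by (intro nth_equalityI) (auto simp: s2'_def s1_def)
        then have "mset (map (kin s3) [0..<n]) = mset (map (\<lambda>a. (fst (pt a), a)) xs)" using 3(3) by simp
        from mset_map_pair_graph[OF this]
        have zs: "mset zs = mset xs" "map (kin s3) [0..<n] = map (\<lambda>a. (fst (pt a), a)) zs"
          unfolding zs_def by (simp_all del: mset_map mset_upt)
        have zsN: "set zs \<subseteq> {..<N}" using zs(1) xs(2) by (metis set_mset_mset)
        have lz: "length zs = n" by (simp add: zs_def)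
        have srt: "sorted (map (\<lambda>a. fst (pt a)) zs)"
          using sorted_fst_of_kle[OF 3(2)] unfolding zs(2) by (simp add: comp_def)
        \<comment> \<open>The vertical line passes through the first item of the right half.\<close>
        define a where "a = zs ! H"
        have a: "a < N" using nth_bounded[OF zsN, of H] lz H0 by (simp add: a_def)
        define x where "x = fst (pt a)"
        have aQ: "a + a < Q" "a + a < 64 * Q" "H < Q" "H < 64 * Q" using a QN H0 nQ by linarith+
        have e3: "env s3" using e 2(1) 3(1)
          by (simp add: env_def s1_def s2'_def mods_def sort_frame_def)
        have xa: "ra s3 aXY (a + a) = x" using e3 a by (simp add: env_def x_def flip: mult_2)
        have fr3: "wv s3 r = (if r = 14 then N else wv s r)" if "r \<le> 10 \<or> r = 14" for r
          using that 2(1) 3(1) by (auto simp: mods_def sort_frame_def s1_def s2'_def)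
        have len3: "wv s3 10 = n" using fr3[of 10] v by simp
        have a3: "wa s3 2 H = a" using H0 by (simp add: a_def zs_def)
        define s3' :: st where "s3' = s3\<lparr>wv := (wv s3)(vHalf := H, vItem := a, vT := a + a), rv := (rv s3)(0 := x)\<rparr>"
        have "wp fill_heights (wp (At (Mov vSize vHalf) ;; sort_prog ;; ?rest4) P) s3' (t3 + 2 + 2 + 2 + 2)"
        proof (rule fill_heights_wp[where H = H])
          show "env s3'" using e3 by (simp add: env_def s3'_def)
          show "wv s3' vHalf = H" "2 * H \<le> M" using nH v by (auto simp: s3'_def)
          show "wa s3' aKey i < N" if "i < 2 * H" for i
            using nth_bounded[OF zsN, of i] that nH lz by (simp add: s3'_def zs_def)
          fix s4 :: st and t4
          assume 4: "mods {11, 12, 13} {2, 3, 4, 5, 6} {} {2} s3' s4"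
            "\<And>i. i < H \<Longrightarrow> ra s4 aKey i = crossing_height (rv s3' 0) (pt (wa s3' aKey i)) (pt (wa s3' aKey (H + i)))"
            "t4 \<le> t3 + 2 + 2 + 2 + 2 + 40 * H + 10"
          define s4' :: st where "s4' = s4\<lparr>wv := (wv s4)(vSize := H)\<rparr>"
          have "wp sort_prog (wp ?rest4 P) s4' (t4 + 2)"
          proof (rule sort_prog_wp[where n = H and L = L])
            show "H < Q" "wv s4' vSize = H" "H \<le> 2 ^ L" using aQ H0 by (auto simp: s4'_def)
            fix s5 :: st and t5
            assume 5: "sort_frame s4' s5" "sorted_wrt kle (map (kin s5) [0..<H])"
              "mset (map (kin s5) [0..<H]) = mset (map (kin s4') [0..<H])"
              "t5 \<le> t4 + 2 + 220 * (H + 1) * (L + 1)"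
            define ks where "ks = map (ra s5 aKey) [0..<H]"
            have srt5: "sorted ks"
              using sorted_fst_of_kle[OF 5(2)] by (simp add: ks_def comp_def)
            have "image_mset fst (mset (map (kin s5) [0..<H])) = image_mset fst (mset (map (kin s4') [0..<H]))"
              using 5(3) by simp
            then have "mset ks = mset (map (ra s4 aKey) [0..<H])"
              by (simp add: image_mset.compositionality comp_def s4'_def ks_def)
            also have "map (ra s4 aKey) [0..<H] =
                map2 (\<lambda>l r. crossing_height x (pt l) (pt r)) (take H zs) (drop H zs)"
              \<comment> \<open>The pairing joins position \<open>i\<close> of the left half to
                position \<open>i\<close> of the right half in the order of abscissas.\<close>
              using 4(2) lz nH by (intro nth_equalityI) (auto simp: s3'_def zs_def)
            finally have ks5: "mset ks = mset (map2 (\<lambda>l r. crossing_height x (pt l) (pt r)) (take H zs) (drop H zs))" .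
            have left: "fst (pt l) \<le> x" if lr: "l \<in> set (take H zs)" for l
            proof -
              obtain i where "i < H" "l = zs ! i" using lr lz H0 by (auto simp: in_set_conv_nth)
              then show ?thesis using sorted_nth_mono[OF srt, of i H] lz H0 by (simp add: x_def a_def)
            qed
            have right: "x \<le> fst (pt r)" if lr: "r \<in> set (drop H zs)" for r
            proof -
              obtain i where "i < n - H" "r = zs ! (H + i)" using lr lz H0 by (auto simp: in_set_conv_nth)
              then show ?thesis using sorted_nth_mono[OF srt, of H "H + i"] lz H0 by (simp add: x_def a_def)
            qed
            define c where "c = (x, ks ! (H div 2))"
            have flt: "length (filter R xs) = length (filter R (take H zs @ drop H zs))" for R
              using zs(1) by (metis append_take_drop_id mset_filter size_mset)
            have lt: "length (take H zs) = H" "length (drop H zs) = H" using lz nH by simp_all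
            note dp = deep_point[OF lt H0(1) left right srt5 ks5, folded c_def flt]
            have "length xs \<le> 4 * length (filter (\<lambda>a. side (key_dir \<tau>) c (pt a) \<ge> 0) xs) \<and>
                length xs \<le> 4 * length (filter (\<lambda>a. side (key_dir \<tau>) c (pt a) \<le> 0) xs)"
              if "\<bar>\<tau>\<bar> \<le> 1" for \<tau>
              using dp[OF _ _ that] len nH by linarith
            then have "good_center xs c N" unfolding good_center_def using False len by simp
            moreover have "mods {11..} UNIV {2, 3} {2, 3} s s5"
              using 2(1) 3(1) 4(1) 5(1)
              by (simp add: mods_def sort_frame_def s1_def s2'_def s3'_def s4'_def)
            moreover have "rv s5 0 = x" "wv s5 14 = N" "wv s5 15 = H"
              using 4(1) 5(1) fr3[of 14] by (simp_all add: mods_def sort_frame_def s3'_def s4'_def)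
            moreover have "H div 2 < Q" "H div 2 < H" using aQ H0 by (auto intro: le_less_trans)
            moreover have "t5 + 4 \<le> t + 600 * (n + 1) * (L + 1)"
            proof -
              have "t5 + 4 \<le> t + 2+2+2+20 * n + 10 + 2 + 220 * (n + 1) * (L + 1) + 2+2+2+2 + 40 * H + 10 + 2 +
                  220 * (H + 1) * (L + 1) + 4"
                using 2(3) 3(4) 4(3) 5(4) by linarith
              also have "\<dots> \<le> t + 600 * (n + 1) * (L + 1)"
                using nH False by (simp add: algebra_simps)
              finally show ?thesis .
            qed
            ultimately show "wp ?rest4 P s5 t5"
              by (simp add: wp_Seq wp_At, intro P) (auto simp: mods_def c_def ks_def)
          qed
          moreover have "wv s4 15 = H" using 4(1) by (simp add: mods_def s3'_def)
          ultimately show "wp (At (Mov vSize vHalf) ;; sort_prog ;; ?rest4) P s4 t4"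
            using aQ by (simp add: wp_Seq wp_At s4'_def)
        qed
        then show "wp ?rest2 P s3 t3"
          using aQ a3 xa len3 nH by (simp add: wp_Seq wp_At s3'_def)
      qed
      moreover have "wv s2 10 = n" using 2(1) v by (simp add: mods_def s1_def)
      ultimately show "wp ?rest1 P s2 t2"
        using nQ by (simp add: wp_Seq wp_At s2'_def)
    qed
    have "N < 64 * Q" "wv s vN = N" using QN e by (auto simp: env_def)
    with main show ?thesis using False v unfolding choose_center_def
      by (simp add: wp_Seq wp_At wp_IfW s1_def fun_upd_twist)
  qed
qed

end

section \<open>Choice of the two sides\<close>

text \<open>With a leftmost pivot all side bits start at 1, so clearing the first and the last one
  cuts off that pair. Two strict comparisons of colour bits test whether the colours differ.\<close>

definition choose_sides :: com where
  "choose_sides = init_sides ;; At (Cst vConst 49) ;;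
     IfW vLen vConst
       (At (Ld vItem aKey vZero) ;; At (Ld vU aCol vItem) ;; At (SubI vT vLen 1) ;;
        At (Ld vItem aKey vT) ;; At (Ld vCol aCol vItem) ;;
        IfW vU vCol (At (St aU vZero vZero) ;; At (St aU vT vZero))
          (IfW vCol vU (At (St aU vZero vZero) ;; At (St aU vT vZero)) flip_sides))
       flip_sides"

definition split_prog :: com where
  "split_prog = choose_center ;; fill_keys ;; At (Mov vSize vLen) ;; sort_prog ;; choose_sides ;;
     partition_items ;; At (St aNext vLo vFront) ;; At (St aNext vFront vHi)"

lemma mods_trans:
  assumes "mods W R A G s s'" "mods W' R' A' G' s' s''"
    and "W \<union> W' \<subseteq> W''" "R \<union> R' \<subseteq> R''" "A \<union> A' \<subseteq> A''" "G \<union> G' \<subseteq> G''"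
  shows "mods W'' R'' A'' G'' s s''"
  unfolding mods_def
proof (intro conjI allI impI)
  show "wv s'' r = wv s r" if "r \<notin> W''" for r
    using assms(1,2,3) that unfolding mods_def by (metis Un_iff subsetD)
  show "rv s'' r = rv s r" if "r \<notin> R''" for r
    using assms(1,2,4) that unfolding mods_def by (metis Un_iff subsetD)
  show "wa s'' r = wa s r" if "r \<notin> A''" for r
    using assms(1,2,5) that unfolding mods_def by (metis Un_iff subsetD)
  show "ra s'' r = ra s r" if "r \<notin> G''" for r
    using assms(1,2,6) that unfolding mods_def by (metis Un_iff subsetD)
qed

context k13
begin

definition picked :: "nat list \<Rightarrow> (nat \<Rightarrow> bool) \<Rightarrow> nat list" where
  "picked zs b = map ((!) zs) (filter b [0..<length zs])"

lemma set_picked: "set (picked zs b) = {zs ! i | i. i < length zs \<and> b i}"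
  by (auto simp: picked_def)

lemma length_picked: "length (picked zs b) = card {i. i < length zs \<and> b i}"
proof -
  have "card (set (filter b [0..<length zs])) = length (filter b [0..<length zs])"
    by (intro distinct_card) simp
  moreover have "set (filter b [0..<length zs]) = {i. i < length zs \<and> b i}" by auto
  ultimately show ?thesis by (simp add: picked_def)
qed

lemma wsum_picked: "wsum (picked zs b) = (\<Sum>i<length zs. if b i then wt C (zs ! i) else 0)"
proof -
  have "wsum (map ((!) zs) (filter b [0..<n])) = (\<Sum>i<n. if b i then wt C (zs ! i) else 0)" for n
    by (induction n) auto
  then show ?thesis by (simp add: picked_def)
qed

lemma mset_picked: "mset (picked zs b) + mset (picked zs (\<lambda>i. \<not> b i)) = mset zs"
proof -
  have "mset (filter b [0..<length zs]) + mset (filter (\<lambda>i. \<not> b i) [0..<length zs]) = mset [0..<length zs]"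
    by (metis mset_filter multiset_partition)
  then have "image_mset ((!) zs) (mset (filter b [0..<length zs]) + mset (filter (\<lambda>i. \<not> b i) [0..<length zs])) =
      image_mset ((!) zs) (mset [0..<length zs])" by simp
  then show ?thesis unfolding picked_def mset_map
    by (metis image_mset_union map_nth mset_map)
qed

lemma wsum_picked_compl: "wsum (picked zs b) + wsum (picked zs (\<lambda>i. \<not> b i)) = wsum zs"
  using mset_picked[of zs b] wsum_mset[of "picked zs b @ picked zs (\<lambda>i. \<not> b i)" zs] by simp

definition good_sides :: "nat list \<Rightarrow> (nat \<Rightarrow> bool) \<Rightarrow> bool" where
  "good_sides zs b \<longleftrightarrow> wsum (picked zs b) = 0 \<and> wsum (picked zs (\<lambda>i. \<not> b i)) = 0 \<and>
     picked zs b \<noteq> [] \<and> picked zs (\<lambda>i. \<not> b i) \<noteq> [] \<and>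
     sep (set (picked zs b)) (set (picked zs (\<lambda>i. \<not> b i))) \<and>
     (49 \<le> length zs \<longrightarrow> length zs \<le> 8 * length (picked zs b) \<and>
        length zs \<le> 8 * length (picked zs (\<lambda>i. \<not> b i)))"

definition items_ok :: "nat list \<Rightarrow> bool" where
  "items_ok xs \<longleftrightarrow> set xs \<subseteq> {..<N} \<and> wsum xs = 0 \<and> (\<forall>a. count (mset xs) a \<le> 3) \<and>
     (\<forall>a. \<not> C a \<longrightarrow> count (mset xs) a \<le> 1)"

lemma items_ok_mset: "mset xs = mset ys \<Longrightarrow> items_ok xs = items_ok ys"
  unfolding items_ok_def using wsum_mset by (metis set_mset_mset)

lemma good_center_mset: "mset xs = mset ys \<Longrightarrow> good_center xs c p = good_center ys c p"
proof -
  assume m: "mset xs = mset ys"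
  have "length (filter R xs) = length (filter R ys)" for R using m by (metis mset_filter size_mset)
  moreover have "length xs = length ys" using m by (metis size_mset)
  moreover have "set xs = set ys" using m by (metis set_mset_mset)
  ultimately show ?thesis by (simp add: good_center_def)
qed

lemma good_sides_inU:
  assumes kd: "keyed c ky zs" and ok: "items_ok zs" and K: "0 < K" "K \<le> length zs" "usum c zs K = 0"
    and sz: "if length zs < 49 then K < length zs \<and> (\<forall>a\<in>set zs. fst c \<le> fst (pt a))
      else (\<forall>\<tau>. \<bar>\<tau>\<bar> \<le> 1 \<longrightarrow>
        length zs \<le> 4 * length (filter (\<lambda>a. side (key_dir \<tau>) c (pt a) \<ge> 0) zs) \<and>
        length zs \<le> 4 * length (filter (\<lambda>a. side (key_dir \<tau>) c (pt a) \<le> 0) zs))"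
  shows "good_sides zs (inU c zs K)"
proof -
  have w: "wsum (picked zs (inU c zs K)) = 0" using K(3) by (simp add: wsum_picked usum_def)
  have w': "wsum (picked zs (\<lambda>i. \<not> inU c zs K i)) = 0"
    using wsum_picked_compl[of zs "inU c zs K"] w ok by (simp add: items_ok_def)
  have sp: "sep (set (picked zs (inU c zs K))) (set (picked zs (\<lambda>i. \<not> inU c zs K i)))"
    unfolding set_picked using sep_inU[OF kd K(1,2)] .
  have big: "length zs \<le> 8 * length (picked zs (inU c zs K)) \<and>
      length zs \<le> 8 * length (picked zs (\<lambda>i. \<not> inU c zs K i))" if "49 \<le> length zs"
  proof -
    define H where "H = length zs div 2"
    have H: "length zs = 2 * H"
      using even_length_wsum[of zs] ok by (simp add: H_def items_ok_def)
    have "H \<le> 2 * length (filter (\<lambda>a. side (key_dir \<tau>) c (pt a) \<ge> 0) zs)"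
      "H \<le> 2 * length (filter (\<lambda>a. side (key_dir \<tau>) c (pt a) \<le> 0) zs)" if "\<bar>\<tau>\<bar> \<le> 1" for \<tau>
    proof -
      have "length zs \<le> 4 * length (filter (\<lambda>a. side (key_dir \<tau>) c (pt a) \<ge> 0) zs) \<and>
        length zs \<le> 4 * length (filter (\<lambda>a. side (key_dir \<tau>) c (pt a) \<le> 0) zs)"
        using sz \<open>49 \<le> length zs\<close> that by simp
      then show "H \<le> 2 * length (filter (\<lambda>a. side (key_dir \<tau>) c (pt a) \<ge> 0) zs)"
        "H \<le> 2 * length (filter (\<lambda>a. side (key_dir \<tau>) c (pt a) \<le> 0) zs)" using H by linarith+
    qed
    from inU_sizes[OF kd K(1,2) _ this] ok
    have "H \<le> 2 * length (picked zs (inU c zs K)) + 12 \<and>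
        H \<le> 2 * length (picked zs (\<lambda>i. \<not> inU c zs K i)) + 12"
      unfolding length_picked items_ok_def by blast
    \<comment> \<open>If \<open>H \<le> 2 * x + 12\<close>, then
      \<open>8 * x \<ge> 4 * H - 48\<close>, which is at least \<open>2 * H\<close> as soon as
      \<open>H \<ge> 24\<close>.\<close>
    then show ?thesis using H that by linarith
  qed
  have "picked zs (inU c zs K) \<noteq> [] \<and> picked zs (\<lambda>i. \<not> inU c zs K i) \<noteq> []"
  proof (cases "length zs < 49")
    case True
    then have K': "K < length zs" and l: "\<forall>a\<in>set zs. fst c \<le> fst (pt a)" using sz by auto
    \<comment> \<open>Nothing lies left of the pivot, so position \<open>K\<close>, not yet passed,
      is above the line, and position 0, already passed, is below.\<close>
    have "inU c zs K K" using K' l by (simp add: inU_def)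
    moreover have "zs ! 0 \<in> set zs" using K' by (intro nth_mem) linarith
    then have "\<not> inU c zs K 0" using K l by (simp add: inU_def not_less)
    ultimately have "zs ! K \<in> set (picked zs (inU c zs K))" "zs ! 0 \<in> set (picked zs (\<lambda>i. \<not> inU c zs K i))"
      using K K' unfolding set_picked by auto
    then show ?thesis by auto
  next
    case False
    then show ?thesis using big by auto
  qed
  then show ?thesis using w w' sp big by (simp add: good_sides_def)
qed

lemma good_sides_first_last:
  assumes kd: "keyed c ky zs" and ok: "items_ok zs" and n: "4 \<le> length zs" "length zs < 49"
    and c: "pt (last zs) = c" "\<And>a. a \<in> set zs \<Longrightarrow> fst c \<le> fst (pt a)" and col: "C (hd zs) \<noteq> C (last zs)"
  shows "good_sides zs (\<lambda>i. 0 < i \<and> i < length zs - 1)"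
proof -
  let ?b = "\<lambda>i. 0 < i \<and> i < length zs - 1"
  have ne: "zs \<noteq> []" using n by auto
  define m where "m = length zs - 2"
  have m: "length zs = Suc (Suc m)" "0 < m" using n by (auto simp: m_def)
  have up: "[0..<length zs] = 0 # [1..<Suc m] @ [Suc m]"
    unfolding m(1) by (simp add: upt_conv_Cons)
  have "filter ?b [1..<Suc m] = [1..<Suc m]" unfolding filter_id_conv by (auto simp: m)
  then have f1: "filter ?b [0..<length zs] = [1..<Suc m]" unfolding up by (simp add: m(1))
  have "filter (\<lambda>i. \<not> ?b i) [1..<Suc m] = []" unfolding filter_empty_conv by (auto simp: m)
  then have f2: "filter (\<lambda>i. \<not> ?b i) [0..<length zs] = [0, Suc m]" unfolding up by (simp add: m(1))
  have X: "picked zs ?b = butlast (tl zs)"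
    unfolding picked_def f1 using m(1) by (intro nth_equalityI) (auto simp: nth_butlast nth_tl simp del: upt_Suc)
  have Y: "picked zs (\<lambda>i. \<not> ?b i) = [hd zs, last zs]"
    unfolding picked_def f2 using ne m(1) by (simp add: hd_conv_nth last_conv_nth)
  have w2: "wsum (picked zs (\<lambda>i. \<not> ?b i)) = 0" using col unfolding Y by (auto simp: wt_def)
  have w1: "wsum (picked zs ?b) = 0"
    using wsum_picked_compl[of zs ?b] w2 ok by (simp add: items_ok_def)
  have "count (mset zs) (hd zs) = 1 \<or> count (mset zs) (last zs) = 1"
  proof -
    have "count (mset zs) (hd zs) > 0" "count (mset zs) (last zs) > 0" using ne by simp_all
    moreover have "\<not> C (hd zs) \<or> \<not> C (last zs)" using col by auto
    ultimately show ?thesis using ok unfolding items_ok_def by (metis Suc_leI One_nat_def le_antisym)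
  qed
  moreover have "hd zs \<noteq> last zs" using col by metis
  ultimately have "sep (set (butlast (tl zs))) {hd zs, last zs}"
    using sep_first_last[OF kd _ c(1) _ c(2)] n by simp
  moreover have "butlast (tl zs) \<noteq> []" using m by (metis X f1 picked_def length_map length_upt list.size(3) diff_Suc_1 less_not_refl)
  ultimately show ?thesis using w1 w2 n unfolding good_sides_def X Y by simp
qed

lemma choose_sides_wp:
  assumes e: "env s" and v: "wv s vLen = n" "4 \<le> n" "n \<le> M"
    and zs: "length zs = n" "\<And>i. i < n \<Longrightarrow> wa s aKey i = zs ! i" "items_ok zs"
    and c: "c = (rv s 0, rv s 1)" "good_center zs c p"
    and ky: "ky = (\<lambda>a. if a = p then 2 else slope_key c (pt a))" "sorted_wrt kle (map (\<lambda>a. (ky a, a)) zs)"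
    and P: "\<And>s' t' b. \<lbrakk>mods {11..<40} {2} {3} {} s s'; wv s' vZero = 0;
      \<And>i. i < n \<Longrightarrow> wa s' aU i = (if b i then 1 else 0); good_sides zs b;
      t' \<le> t + 80 * n + 100\<rbrakk> \<Longrightarrow> P s' t'"
  shows "wp choose_sides P s t"
proof -
  have zsN: "set zs \<subseteq> {..<N}" and w0: "wsum zs = 0" using zs(3) by (auto simp: items_ok_def)
  have ne: "zs \<noteq> []" using zs v by auto
  have kd: "keyed c ky zs"
    unfolding keyed_def
  proof (intro conjI ballI impI)
    fix a assume a: "a \<in> set zs"
    \<comment> \<open>The key 2 belongs only to the item \<open>p\<close>, which sits at
      \<open>c\<close>; if \<open>p = N\<close>, no item has it.\<close>
    show "ky a = slope_key c (pt a)" if "pt a \<noteq> c"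
      using that c(2) a zsN by (auto simp: ky good_center_def split: if_splits)
    show "- 1 \<le> ky a" using slope_key_bounds[of c "pt a"] by (simp add: ky)
  qed (use ky zsN in auto)
  \<comment> \<open>A copy of the pivot is in the block and has key 2, so the last key is at least
    2, more than any slope key.\<close>
  have last_p: "last zs = p" if "n < 49"
  proof -
    have "p \<in> set zs" using c(2) that zs by (simp add: good_center_def)
    then obtain j where "j < n" "zs ! j = p" using zs by (auto simp: in_set_conv_nth)
    then have "2 \<le> ky (last zs)"
      using keyed_nth(1)[OF kd, of j "n - 1"] zs ne by (simp add: ky last_conv_nth)
    then show ?thesis using slope_key_bounds[of c "pt (last zs)"] by (auto simp: ky split: if_splits)
  qed
  define K where "K = (LEAST k. 0 < k \<and> usum c zs k = 0)"
  obtain k0 where k0: "0 < k0" "k0 \<le> n" "usum c zs k0 = 0"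
    using usum_zero_exists[OF w0 ne, of c] zs by auto
  have K: "0 < K" "usum c zs K = 0" unfolding K_def using LeastI[of "\<lambda>k. 0 < k \<and> usum c zs k = 0" k0] k0 by auto
  have K_le: "K \<le> k" if "0 < k" "usum c zs k = 0" for k unfolding K_def using that by (intro Least_le) auto
  have Kn: "K \<le> n" using K_le k0 by (meson order_trans)
  have K_min: "usum c zs k \<noteq> 0" if "0 < k" "k < K" for k using K_le[of k] that by auto
  have flip: "wp flip_sides P s' t'"
    if s': "mods {11..<40} {2} {3} {} s s'" "wv s' vZero = 0"
      "\<And>i. i < n \<Longrightarrow> wa s' aU i = (if inU c zs 0 i then 1 else 0)" "int (wv s' vH) = int M + usum c zs 0"
      "t' \<le> t + 30 * n + 70" and g: "good_sides zs (inU c zs K)" for s' t'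
  proof (rule flip_sides_wp[where n = n and zs = zs and c = c and K = K])
    show "env s'" using e s'(1) by (simp add: env_def mods_def)
    show "wa s' aKey i = zs ! i" if "i < n" for i using s'(1) zs that by (simp add: mods_def)
    fix s2 :: st and t2
    assume 2: "mods {12, 18, 19, 20, 21, 22, 25} {} {3} {} s' s2"
      "\<And>i. i < n \<Longrightarrow> wa s2 aU i = (if inU c zs K i then 1 else 0)" "t2 \<le> t' + 40 * n + 20"
    show "P s2 t2"
    proof (rule P)
      show "mods {11..<40} {2} {3} {} s s2" by (rule mods_trans[OF s'(1) 2(1)]) auto
      show "wv s2 vZero = 0" using s'(2) 2(1) by (simp add: mods_def)
      show "wa s2 aU i = (if inU c zs K i then 1 else 0)" if "i < n" for i using 2(2) that .
      show "good_sides zs (inU c zs K)" by fact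
      show "t2 \<le> t + 80 * n + 100" using 2(3) s'(5) by linarith
    qed
  qed (use s' v zs zsN K Kn K_min in auto)
  show ?thesis
    unfolding choose_sides_def
  proof (subst wp_Seq, rule init_sides_wp[where n = n and zs = zs and c = c])
    show "env s" by fact
    show "wv s vLen = n" "n \<le> M" "length zs = n" "set zs \<subseteq> {..<N}" using v zs zsN by auto
    show "wa s aKey i = zs ! i" if "i < n" for i using zs that by simp
    show "fst c = rv s 0" using c by simp
    fix s1 :: st and t1
    assume 1: "mods {11, 12, 13, 18, 19, 22, 28} {2} {3} {} s s1" "wv s1 vZero = 0"
      "\<And>i. i < n \<Longrightarrow> wa s1 aU i = (if inU c zs 0 i then 1 else 0)" "int (wv s1 vH) = int M + usum c zs 0"
      "t1 \<le> t + 30 * n + 20"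
    have m1: "wv s1 10 = n" "wa s1 2 = wa s 2" "wa s1 5 = wa s 5" using 1(1) v by (simp_all add: mods_def)
    show "wp (At (Cst vConst 49) ;;
     IfW vLen vConst
       (At (Ld vItem aKey vZero) ;; At (Ld vU aCol vItem) ;; At (SubI vT vLen 1) ;;
        At (Ld vItem aKey vT) ;; At (Ld vCol aCol vItem) ;;
        IfW vU vCol (At (St aU vZero vZero) ;; At (St aU vT vZero))
          (IfW vCol vU (At (St aU vZero vZero) ;; At (St aU vT vZero)) flip_sides))
       flip_sides) P s1 t1"
    proof (cases "n < 49")
      case False
      have "good_sides zs (inU c zs K)"
        using good_sides_inU[OF kd zs(3) K(1) _ K(2)] Kn zs c(2) False by (simp add: good_center_def)
      then have "wp flip_sides P (s1\<lparr>wv := (wv s1)(vConst := 49)\<rparr>) (t1 + 2 + 2)"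
        using 1 by (intro flip) (auto simp: mods_def)
      then show ?thesis using False m1 by (simp add: wp_simps)
    next
      case True
      have cp: "pt (last zs) = c" and left: "\<And>a. a \<in> set zs \<Longrightarrow> fst c \<le> fst (pt a)"
        using c(2) True zs last_p by (auto simp: good_center_def)
      have ends: "zs ! 0 = hd zs" "zs ! (n - Suc 0) = last zs" using ne zs by (simp_all add: hd_conv_nth last_conv_nth)
      have hN: "hd zs < N" "last zs < N" using zsN ne hd_in_set last_in_set by auto
      have b: "0 < Q" "n - Suc 0 < Q" "hd zs < Q" "last zs < Q" "n < 64 * Q" using hN QN v MQ by linarith+
      have col: "wa s 5 (hd zs) = (if C (hd zs) then 1 else 0)" "wa s 5 (last zs) = (if C (last zs) then 1 else 0)"
        "wa s 2 0 = hd zs" "wa s 2 (n - Suc 0) = last zs"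
        using e hN zs(2)[of 0] zs(2)[of "n - Suc 0"] v ends by (auto simp: env_def)
      define s2 :: st where "s2 = s1\<lparr>wv := (wv s1)(vConst := 49, vU := if C (hd zs) then 1 else 0,
        vT := n - Suc 0, vItem := last zs, vCol := if C (last zs) then 1 else 0)\<rparr>"
      show ?thesis
      proof (cases "C (hd zs) = C (last zs)")
        case eq: True
        obtain k where "0 < k" "k < n" "usum c zs k = 0"
          using usum_zero_exists_interior[OF w0 _ eq left] zs v by auto
        then have "K < n" using K_le[of k] by simp
        then have g: "good_sides zs (inU c zs K)"
          using good_sides_inU[OF kd zs(3) K(1) _ K(2)] Kn zs True left by simp
        have "wp flip_sides P s' t'" if "wv s' = wv s2" "wa s' = wa s1" "rv s' = rv s1" "ra s' = ra s1"
            "t' \<le> t1 + 30" for s' t'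
          using 1 that g by (intro flip) (auto simp: mods_def s2_def)
        then show ?thesis using True eq m1 1(2) b col v
          by (auto simp: wp_simps s2_def fun_upd_twist)
      next
        case ne': False
        define b where "b = (\<lambda>i. 0 < i \<and> i < n - 1)"
        have g: "good_sides zs b"
          unfolding b_def using good_sides_first_last[OF kd zs(3) _ _ cp left] zs v True ne' by simp
        have iU: "inU c zs 0 i" if "i < n" for i using left that zs by (simp add: inU_def)
        have "P s' t'" if "wv s' = wv s2" "rv s' = rv s1" "ra s' = ra s1" "wa s' = (wa s1)(aU := (wa s1 aU)(0 := 0, n - Suc 0 := 0))"
            "t' \<le> t1 + 30" for s' t'
        proof (rule P[of s' b])
          show "mods {11..<40} {2} {3} {} s s'" "wv s' vZero = 0"
            using that 1(1,2) by (auto simp: mods_def s2_def)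
          show "wa s' aU i = (if b i then 1 else 0)" if "i < n" for i
            using \<open>wa s' = _\<close> 1(3)[OF that] iU[OF that] that by (auto simp: b_def)
          show "t' \<le> t + 80 * n + 100" using that(5) 1(5) by linarith
        qed (rule g)
        then show ?thesis using True ne' m1 1(2) \<open>0 < Q\<close> \<open>n - Suc 0 < Q\<close> \<open>hd zs < Q\<close> \<open>last zs < Q\<close> \<open>n < 64 * Q\<close> col v
          by (auto simp: wp_simps s2_def fun_upd_twist)
      qed
    qed
  qed
qed

lemma block_append: "lo \<le> mid \<Longrightarrow> mid \<le> hi \<Longrightarrow> block s lo hi = block s lo mid @ block s mid hi"
  unfolding block_def by (metis le_add_diff_inverse map_append upt_add_eq_append)

lemma split_prog_wp:
  assumes e: "env s" and v: "wv s vLo = lo" "wv s vHi = lo + n" "wv s vLen = n" "lo + n \<le> M" "4 \<le> n" "n \<le> 2 ^ L"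
    and xs: "xs = block s lo (lo + n)" "items_ok xs"
    and P: "\<And>s' t' mid. \<lbrakk>mods {11..} UNIV {1, 2, 3, 4} {2, 3} s s'; lo < mid; mid < lo + n;
      wa s' aNext = (wa s aNext)(lo := mid, mid := lo + n);
      \<And>j. j < lo \<or> lo + n \<le> j \<Longrightarrow> wa s' aItem j = wa s aItem j;
      mset (block s' lo (lo + n)) = mset xs;
      wsum (block s' lo mid) = 0; wsum (block s' mid (lo + n)) = 0;
      sep (set (block s' lo mid)) (set (block s' mid (lo + n)));
      49 \<le> n \<Longrightarrow> n \<le> 8 * (mid - lo) \<and> n \<le> 8 * (lo + n - mid);
      t' \<le> t + 1200 * (n + 1) * (L + 1)\<rbrakk> \<Longrightarrow> P s' t'"
  shows "wp split_prog P s t"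
proof -
  have len: "length xs = n" by (simp add: xs block_def)
  have xsN: "set xs \<subseteq> {..<N}" "wsum xs = 0" using xs(2) by (auto simp: items_ok_def)
  have xsi: "xs ! i = wa s aItem (lo + i)" if "i < n" for i using that by (simp add: xs block_def)
  have nQ: "n < Q" "n < 64 * Q" using v MQ by linarith+
  show ?thesis
    unfolding split_prog_def
  proof (subst wp_Seq, rule choose_center_wp[where lo = lo and n = n and L = L and xs = xs])
    show "env s" "xs = block s lo (lo + n)" "set xs \<subseteq> {..<N}" "wsum xs = 0" by fact+
    show "wv s vLo = lo" "wv s vHi = lo + n" "wv s vLen = n" "lo + n \<le> M" "0 < n" "n \<le> 2 ^ L" using v by auto
    fix s1 :: st and t1
    assume 1: "mods {11..} UNIV {2, 3} {2, 3} s s1" "good_center xs (rv s1 0, rv s1 1) (wv s1 vPiv)"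
      "t1 \<le> t + 600 * (n + 1) * (L + 1)"
    define c where "c = (rv s1 0, rv s1 1)"
    define ky where "ky = (\<lambda>a. if a = wv s1 vPiv then 2 else slope_key c (pt a))"
    have v1: "wv s1 vLo = lo" "wv s1 vHi = lo + n" "wv s1 vLen = n" "wa s1 aItem = wa s aItem"
      using 1(1) v by (simp_all add: mods_def)
    show "wp (fill_keys ;; At (Mov vSize vLen) ;; sort_prog ;; choose_sides ;; partition_items ;;
        At (St aNext vLo vFront) ;; At (St aNext vFront vHi)) P s1 t1"
    proof (subst wp_Seq, rule fill_keys_wp[where lo = lo and n = n])
      show "env s1" using e 1(1) by (simp add: env_def mods_def)
      show "wv s1 vLo = lo" "wv s1 vLen = n" "lo + n \<le> M" using v1 v by auto
      show "wa s1 aItem (lo + i) < N" if "i < n" for i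
        using nth_bounded[OF xsN(1), of i] that len xsi v1 by simp
      fix s2 :: st and t2
      assume 2: "mods {11, 12, 13, 25} {2, 3, 4, 5, 6, 7, 8, 9, 10, 11, 12} {2} {2} s1 s2"
        "\<And>i. i < n \<Longrightarrow> kin s2 i = (let a = wa s1 aItem (lo + i) in
          (if a = wv s1 vPiv then 2 else slope_key (rv s1 0, rv s1 1) (pt a), a))"
        "t2 \<le> t1 + 70 * n + 20"
      define s2' :: st where "s2' = s2\<lparr>wv := (wv s2)(vSize := n)\<rparr>"
      have "wp sort_prog (wp (choose_sides ;; partition_items ;;
        At (St aNext vLo vFront) ;; At (St aNext vFront vHi)) P) s2' (t2 + 2)"
      proof (rule sort_prog_wp[where n = n and L = L])
        show "n < Q" "wv s2' vSize = n" "n \<le> 2 ^ L" using nQ v by (auto simp: s2'_def)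
        fix s3 :: st and t3
        assume 3: "sort_frame s2' s3" "sorted_wrt kle (map (kin s3) [0..<n])"
          "mset (map (kin s3) [0..<n]) = mset (map (kin s2') [0..<n])"
          "t3 \<le> t2 + 2 + 220 * (n + 1) * (L + 1)"
        define zs where "zs = map (wa s3 aKey) [0..<n]"
        have "map (kin s2') [0..<n] = map (\<lambda>a. (ky a, a)) xs"
          using 2(2) xsi len v1 by (intro nth_equalityI) (auto simp: s2'_def ky_def c_def Let_def)
        then have "mset (map (kin s3) [0..<n]) = mset (map (\<lambda>a. (ky a, a)) xs)" using 3(3) by simp
        from mset_map_pair_graph[OF this]
        have zs: "mset zs = mset xs" "map (kin s3) [0..<n] = map (\<lambda>a. (ky a, a)) zs"
          unfolding zs_def by (simp_all del: mset_map mset_upt)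
        have lz: "length zs = n" by (simp add: zs_def)
        have s12: "mods {11..} UNIV {2, 3} {2, 3} s s2" by (rule mods_trans[OF 1(1) 2(1)]) auto
        have "mods {40..} UNIV {2, 3} {2, 3} s2 s3"
          using 3(1) by (simp add: mods_def sort_frame_def s2'_def)
        from mods_trans[OF s12 this]
        have s23: "mods {11..} UNIV {2, 3} {2, 3} s s3" by auto
        have r3: "rv s3 0 = rv s1 0" "rv s3 1 = rv s1 1"
          using 2(1) 3(1) by (simp_all add: mods_def sort_frame_def s2'_def)
        have v3: "wv s3 vLo = lo" "wv s3 vHi = lo + n" "wv s3 vLen = n" using s23 v by (simp_all add: mods_def)
        show "wp (choose_sides ;; partition_items ;; At (St aNext vLo vFront) ;; At (St aNext vFront vHi)) P s3 t3"
        proof (subst wp_Seq, rule choose_sides_wp[where n = n and zs = zs and c = c and p = "wv s1 vPiv" and ky = ky])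
          show "env s3" using e s23 by (simp add: env_def mods_def)
          show "wv s3 vLen = n" "4 \<le> n" "n \<le> M" "length zs = n" using v3 v lz by auto
          show "wa s3 aKey i = zs ! i" if "i < n" for i using that by (simp add: zs_def)
          show "items_ok zs" using items_ok_mset[OF zs(1)] xs by simp
          show "c = (rv s3 0, rv s3 1)" using r3 by (simp add: c_def)
          show "good_center zs c (wv s1 vPiv)" using good_center_mset[OF zs(1)] 1(2) by (simp add: c_def)
          show "ky = (\<lambda>a. if a = wv s1 vPiv then 2 else slope_key c (pt a))" by (rule ky_def)
          show "sorted_wrt kle (map (\<lambda>a. (ky a, a)) zs)" using 3(2) zs(2) by simp
          fix s4 :: st and t4 b
          assume 4: "mods {11..<40} {2} {3} {} s3 s4" "wv s4 vZero = 0"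
            "\<And>i. i < n \<Longrightarrow> wa s4 aU i = (if b i then 1 else 0)" "good_sides zs b" "t4 \<le> t3 + 80 * n + 100"
          have v4: "wv s4 vLo = lo" "wv s4 vHi = lo + n" "wv s4 vLen = n" "wa s4 aKey = wa s3 aKey"
            using 4(1) v3 by (simp_all add: mods_def)
          have s4: "mods {11..} UNIV {2, 3} {2, 3} s s4" by (rule mods_trans[OF s23 4(1)]) auto
          show "wp (partition_items ;; At (St aNext vLo vFront) ;; At (St aNext vFront vHi)) P s4 t4"
          proof (subst wp_Seq, rule partition_items_wp[where lo = lo and n = n and zs = zs and b = b])
            show "wa s4 aKey i = zs ! i" if "i < n" for i using that v4 by (simp add: zs_def)
            fix s5 :: st and t5
            assume 5: "mods {11, 12, 22, 23, 24} {} {1} {} s4 s5"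
              "wv s5 vFront = lo + length (filter b [0..<n])"
              "map (wa s5 aItem) [lo..<lo + length (filter b [0..<n])] = map ((!) zs) (filter b [0..<n])"
              "map (wa s5 aItem) [lo + length (filter b [0..<n])..<lo + n] =
                rev (map ((!) zs) (filter (\<lambda>i. \<not> b i) [0..<n]))"
              "\<And>j. j < lo \<or> lo + n \<le> j \<Longrightarrow> wa s5 aItem j = wa s4 aItem j" "t5 \<le> t4 + 30 * n + 20"
            define mid where "mid = lo + length (filter b [0..<n])"
            have X: "block s5 lo mid = picked zs b" and Y: "block s5 mid (lo + n) = rev (picked zs (\<lambda>i. \<not> b i))"
              using 5(3,4) by (simp_all add: block_def mid_def picked_def lz)
            have lX: "length (picked zs b) = mid - lo" by (simp add: mid_def picked_def lz)
            have lY: "length (picked zs (\<lambda>i. \<not> b i)) = lo + n - mid"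
              using arg_cong[OF mset_picked[of zs b], of size] lX lz by (simp add: mid_def)
            have mid: "lo < mid" "mid < lo + n"
              using 4(4) lX lY unfolding good_sides_def by (metis length_greater_0_conv zero_less_diff)+
            have v5: "wv s5 vLo = lo" "wv s5 vHi = lo + n" "wa s5 aNext = wa s aNext"
              using 5(1) v4 s4 by (simp_all add: mods_def)
            have blk: "block s5 lo (lo + n) = picked zs b @ rev (picked zs (\<lambda>i. \<not> b i))"
              using block_append[of lo mid "lo + n" s5] mid X Y by simp
            have s5: "mods {11..} UNIV {1, 2, 3} {2, 3} s s5" by (rule mods_trans[OF s4 5(1)]) auto
            define s6 :: st where "s6 = s5\<lparr>wa := (wa s5)(aNext := (wa s aNext)(lo := mid, mid := lo + n))\<rparr>"
            have b6: "block s6 = block s5" by (simp add: fun_eq_iff block_def s6_def)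
            have "P s6 (t5 + 4)"
            proof (rule P)
              show "mods {11..} UNIV {1, 2, 3, 4} {2, 3} s s6" using s5 by (simp add: mods_def s6_def)
              show "lo < mid" "mid < lo + n" by fact+
              show "wa s6 aNext = (wa s aNext)(lo := mid, mid := lo + n)" by (simp add: s6_def)
              show "wa s6 aItem j = wa s aItem j" if "j < lo \<or> lo + n \<le> j" for j
                using 5(5)[OF that] s4 by (simp add: s6_def mods_def)
              show "mset (block s6 lo (lo + n)) = mset xs"
                unfolding b6 blk using mset_picked[of zs b] zs(1) by simp
              have "wsum (rev ys) = wsum ys" for ys by (rule wsum_mset) simp
              then show "wsum (block s6 lo mid) = 0" "wsum (block s6 mid (lo + n)) = 0"
                unfolding b6 X Y using 4(4) by (simp_all add: good_sides_def)
              show "sep (set (block s6 lo mid)) (set (block s6 mid (lo + n)))"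
                unfolding b6 X Y using 4(4) by (simp add: good_sides_def)
              show "n \<le> 8 * (mid - lo) \<and> n \<le> 8 * (lo + n - mid)" if "49 \<le> n"
                using 4(4) that lz unfolding good_sides_def lX lY by simp
              have "t5 + 4 \<le> t + 600 * (n + 1) * (L + 1) + 70 * n + 20 + 2 + 220 * (n + 1) * (L + 1) +
                  80 * n + 100 + 30 * n + 20 + 4"
                using 1(3) 2(3) 3(4) 4(5) 5(6) by linarith
              also have "\<dots> \<le> t + 1200 * (n + 1) * (L + 1)" using v(5) by (simp add: algebra_simps)
              finally show "t5 + 4 \<le> t + 1200 * (n + 1) * (L + 1)" .
            qed
            moreover have "lo < Q" "mid < Q" using mid v MQ by linarith+
            ultimately show "wp (At (St aNext vLo vFront) ;; At (St aNext vFront vHi)) P s5 t5"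
              using v5 5(2) by (simp add: wp_Seq wp_At s6_def add.commute flip: mid_def)
          qed (use v4 4 lz v in auto)
        qed
      qed
      moreover have "wv s2 10 = n" using 2(1) v1 by (simp add: mods_def)
      ultimately show "wp (At (Mov vSize vLen) ;; sort_prog ;; choose_sides ;; partition_items ;;
        At (St aNext vLo vFront) ;; At (St aNext vFront vHi)) P s2 t2"
        using nQ by (simp add: wp_Seq wp_At s2'_def)
    qed
  qed
qed

end

section \<open>The recursion\<close>

text \<open>The matching is read off the final order of the items. All blocks have even length, so
  the final blocks of length two start at even positions.\<close>

fun pairs :: "'a list \<Rightarrow> ('a \<times> 'a) list" where
  "pairs (a # b # xs) = (a, b) # pairs xs"
| "pairs _ = []"

lemma pairs_append: "even (length xs) \<Longrightarrow> pairs (xs @ ys) = pairs xs @ pairs ys"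
  by (induction xs rule: pairs.induct) auto

lemma length_pairs: "length (pairs xs) = length xs div 2"
  by (induction xs rule: pairs.induct) auto

lemma nth_pairs: "k < length xs div 2 \<Longrightarrow> pairs xs ! k = (xs ! (2 * k), xs ! Suc (2 * k))"
proof (induction xs arbitrary: k rule: pairs.induct)
  case (1 a b xs)
  then show ?case by (cases k) auto
qed auto

lemma set_pairs: "(a, b) \<in> set (pairs xs) \<Longrightarrow> a \<in> set xs \<and> b \<in> set xs"
  by (induction xs rule: pairs.induct) auto

lemma noncr_sym: "noncr p q u v \<longleftrightarrow> noncr u v p q"
  by (auto simp: noncr_def)

lemma noncr_swap: "noncr p q u v \<longleftrightarrow> noncr q p u v" "noncr p q u v \<longleftrightarrow> noncr p q v u"
  by (auto simp: noncr_def closed_segment_commute insert_commute)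

text \<open>\<open>aNext\<close> maps the start of each pending block to its end. After a cut
  \<open>vLo\<close> stays, so the left part comes next; a block of two is finished, and
  \<open>vLo\<close> moves on to the next block, whose end was recorded when it was cut off. This
  replaces a stack.\<close>

definition main_body :: com where
  "main_body = At (Ld vHi aNext vLo) ;; At (Sub vLen vHi vLo) ;; At (Cst vConst 3) ;;
     IfW vLen vConst (At (Mov vLo vHi)) split_prog"

context k13
begin

definition noncr_pair :: "nat \<times> nat \<Rightarrow> nat \<times> nat \<Rightarrow> bool" where
  "noncr_pair = (\<lambda>(a, b) (c, d). noncr (pt a) (pt b) (pt c) (pt d))"

definition matched :: "nat list \<Rightarrow> bool" where
  "matched xs \<longleftrightarrow> (\<forall>(a, b)\<in>set (pairs xs). C a \<noteq> C b) \<and> sorted_wrt noncr_pair (pairs xs)"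

text \<open>The even length of \<open>xs\<close> keeps the pairs of \<open>ys\<close> aligned, and
  \<open>sep\<close> covers the pairs from different parts.\<close>

lemma matched_append:
  assumes "even (length xs)" "matched xs" "matched ys" "sep (set xs) (set ys)"
  shows "matched (xs @ ys)"
  using assms set_pairs unfolding matched_def pairs_append[OF assms(1)] sorted_wrt_append sep_def noncr_pair_def
  by (fastforce simp: case_prod_unfold)

section \<open>The recurrence for the running time\<close>

text \<open>\<open>76800 = 48 * 1600\<close>: a cut lowers \<open>n * ln n\<close> by at least
  \<open>n / 48\<close> and takes at most \<open>1600 * (L + 1) * n\<close> steps.\<close>

definition cost :: "nat \<Rightarrow> nat \<Rightarrow> real" where
  "cost L n = 76800 * real (L + 1) * (real n * ln (real n))"

text \<open>The potential drops by \<open>2 * a * b / n\<close> at least. If both parts have at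
  least \<open>n / 8\<close> items, then \<open>a * b\<close> is at least \<open>7 / 64\<close> of
  \<open>n * n\<close>. In a small block \<open>a * b \<ge> n - 1 \<ge> n / 2\<close>, and
  \<open>n \<le> 48\<close> makes this sufficient.\<close>

lemma cost_split:
  assumes "n = a + b" "4 \<le> n" "0 < a" "0 < b" "49 \<le> n \<Longrightarrow> n \<le> 8 * a \<and> n \<le> 8 * b"
  shows "cost L a + cost L b + real (14 + 1200 * (n + 1) * (L + 1)) \<le> cost L n"
proof -
  have pos: "real a > 0" "real b > 0" "real n > 0" using assms by auto
  have "real n / 48 \<le> 2 * real a * real b / real n"
  proof (cases "49 \<le> n")
    case True
    then have "real n \<le> 8 * real a" "real n \<le> 8 * real b" using assms(5) by linarith+
    then have "(8 * real a - real n) * (8 * real b - real n) \<ge> 0" by simp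
    then have "64 * (real a * real b) \<ge> 8 * real n * (real a + real b) - real n * real n"
      by (simp add: algebra_simps)
    then have "64 * (real a * real b) \<ge> 7 * (real n * real n)"
      using assms(1) by (simp add: algebra_simps)
    moreover have "0 \<le> real a * real b" by simp
    ultimately have "real n * real n \<le> 96 * (real a * real b)" by linarith
    then show ?thesis using pos by (simp add: field_simps)
  next
    case False
    then have n: "real n \<le> 48" by simp
    have "(real a - 1) * (real b - 1) \<ge> 0" using assms by (intro mult_nonneg_nonneg) auto
    then have "real a * real b \<ge> real n - 1" using assms(1) by (simp add: algebra_simps)
    then have ab: "2 * (real a * real b) \<ge> real n" using assms(2) by linarith
    have "real n * real n \<le> 48 * real n" using n pos by (intro mult_right_mono) auto
    then have "real n * real n \<le> 96 * (real a * real b)" using ab by linarith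
    then show ?thesis using pos by (simp add: field_simps)
  qed
  moreover have "real a * ln (real a) + real b * ln (real b) + 2 * real a * real b / real n \<le> real n * ln (real n)"
    using entropy_split[OF pos(1,2)] assms(1) by simp
  ultimately have "real n / 48 \<le> real n * ln (real n) - real a * ln (real a) - real b * ln (real b)" by linarith
  then have "76800 * real (L + 1) * (real n / 48) \<le> 76800 * real (L + 1) *
      (real n * ln (real n) - real a * ln (real a) - real b * ln (real b))"
    by (intro mult_left_mono) auto
  then have 1: "1600 * real (L + 1) * real n \<le> cost L n - cost L a - cost L b"
    unfolding cost_def by (simp add: algebra_simps)
  have "14 + 1200 * (n + 1) * (L + 1) \<le> 1600 * (L + 1) * n"
  proof -
    have "14 + 1200 * (n + 1) * (L + 1) \<le> (14 + 1200 * (n + 1)) * (L + 1)" by (simp add: algebra_simps)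
    also have "\<dots> \<le> (1600 * n) * (L + 1)" using assms(2) by (intro mult_right_mono) auto
    finally show ?thesis by (simp add: mult_ac)
  qed
  then have "real (14 + 1200 * (n + 1) * (L + 1)) \<le> real (1600 * (L + 1) * n)"
    by (rule of_nat_mono)
  with 1 show ?thesis by simp
qed

lemma items_ok_sub:
  assumes "items_ok xs" "mset ys \<subseteq># mset xs" "wsum ys = 0"
  shows "items_ok ys"
  using assms unfolding items_ok_def
  by (metis (no_types, lifting) order_trans mset_subset_eq_count set_mset_mset set_mset_mono)

text \<open>The last assumption describes the rest of the loop once the block is finished. In this
  continuation form the induction on the block length can be used for the left part with the right
  part as its continuation, although there is only one loop.\<close>

lemma main_loop_wp:
  assumes "env s" "wv s vLo = lo" "wa s aNext lo = lo + n" "lo + n \<le> M" "2 \<le> n" "M \<le> 2 ^ L"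
    and "items_ok (block s lo (lo + n))"
    and "\<And>s' t'. \<lbrakk>mods ({6, 7} \<union> {10..}) UNIV {1, 2, 3, 4} {2, 3} s s'; wv s' vLo = lo + n;
      \<And>j. j < lo \<or> lo + n \<le> j \<Longrightarrow> wa s' aItem j = wa s aItem j \<and> wa s' aNext j = wa s aNext j;
      mset (block s' lo (lo + n)) = mset (block s lo (lo + n)); matched (block s' lo (lo + n));
      real t' \<le> real t + cost L n\<rbrakk> \<Longrightarrow> wp (While vLo vM main_body) P s' t'"
  shows "wp (While vLo vM main_body) P s t"
  using assms
proof (induction n arbitrary: s t lo P rule: less_induct)
  case (less n)
  note e = less.prems(1) and v = less.prems(2-6) and ok = less.prems(7) and P = less.prems(8)
  have ev: "even n" using even_length_wsum[of "block s lo (lo + n)"] ok by (simp add: items_ok_def block_def)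
  have b: "lo < Q" "lo + n < 64 * Q" using v MQ by linarith+
  have vM: "wv s vM = M" using e by (simp add: env_def)
  define s0 :: st where "s0 = s\<lparr>wv := (wv s)(vHi := lo + n, vLen := n, vConst := 3)\<rparr>"
  have body: "wp main_body R s u" if "wp (if n < 3 then At (Mov vLo vHi) else split_prog) R s0 (u + 2 + 2 + 2 + 2)" for R u
    unfolding main_body_def using that v b
    by (cases "n < 3") (simp_all add: wp_Seq wp_At[of "Ld _ _ _"] wp_At[of "Sub _ _ _"] wp_At[of "Cst _ _"] wp_IfW s0_def)
  have enter: "wp (While vLo vM main_body) P s t"
    if "wp (if n < 3 then At (Mov vLo vHi) else split_prog) (wp (While vLo vM main_body) P) s0 (t + 2 + 2 + 2 + 2 + 2)"
    by (rule wp_While_enter) (use v vM that in \<open>auto intro: body\<close>)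
  show ?case
  proof (cases "n < 3")
    case True
    then have n: "n = 2" using v ev by auto
    have blk: "block s lo (lo + n) = [wa s aItem lo, wa s aItem (Suc lo)]"
      using n by (simp add: block_def upt_rec)
    \<comment> \<open>Two items of total weight zero have different colours and form an
      edge.\<close>
    have mt: "matched (block s lo (lo + n))"
      using ok unfolding blk by (auto simp: matched_def items_ok_def wt_def split: if_splits)
    \<comment> \<open>Two loop-control tests and four atoms, at two units each.\<close>
    have c2: "real 12 \<le> cost L n"
    proof -
      have "ln (2::real) \<ge> 1 / 2" using ln_le_minus_one[of "1 / 2 :: real"] by (simp add: ln_div)
      then have "76800 * 1 * (2 * (1/2)) \<le> cost L n" unfolding cost_def n
        by (intro mult_mono) auto
      then show ?thesis by simp
    qed
    define s1 :: st where "s1 = s0\<lparr>wv := (wv s0)(vLo := lo + n)\<rparr>"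
    have "wp (While vLo vM main_body) P s1 (t + 2 + 2 + 2 + 2 + 2 + 2)"
    proof (rule P)
      show "mods ({6, 7} \<union> {10..}) UNIV {1, 2, 3, 4} {2, 3} s s1" by (auto simp: mods_def s1_def s0_def)
      have "block s1 lo (lo + n) = block s lo (lo + n)" by (simp add: block_def s1_def s0_def)
      then show "mset (block s1 lo (lo + n)) = mset (block s lo (lo + n))" "matched (block s1 lo (lo + n))"
        using mt by simp_all
    qed (use c2 in \<open>simp_all add: s1_def s0_def\<close>)
    then show ?thesis using True b by (intro enter) (simp add: wp_At s1_def s0_def)
  next
    case False
    then have n4: "4 \<le> n" using ev by (cases "n = 3") auto
    have nL: "n \<le> 2 ^ L" using v by linarith
    have "wp split_prog (wp (While vLo vM main_body) P) s0 (t + 2 + 2 + 2 + 2 + 2)"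
    proof (rule split_prog_wp[where lo = lo and n = n and L = L and xs = "block s lo (lo + n)"])
      show "env s0" using e by (simp add: env_def s0_def)
      show "block s lo (lo + n) = block s0 lo (lo + n)" by (simp add: block_def s0_def)
      fix s1 :: st and t1 mid
      assume 1: "mods {11..} UNIV {1, 2, 3, 4} {2, 3} s0 s1" "lo < mid" "mid < lo + n"
        "wa s1 aNext = (wa s0 aNext)(lo := mid, mid := lo + n)"
        "\<And>j. j < lo \<or> lo + n \<le> j \<Longrightarrow> wa s1 aItem j = wa s0 aItem j"
        "mset (block s1 lo (lo + n)) = mset (block s lo (lo + n))"
        "wsum (block s1 lo mid) = 0" "wsum (block s1 mid (lo + n)) = 0"
        "sep (set (block s1 lo mid)) (set (block s1 mid (lo + n)))"
        "49 \<le> n \<Longrightarrow> n \<le> 8 * (mid - lo) \<and> n \<le> 8 * (lo + n - mid)"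
        "t1 \<le> t + 2 + 2 + 2 + 2 + 2 + 1200 * (n + 1) * (L + 1)"
      define a where "a = mid - lo"
      define b where "b = lo + n - mid"
      have ab: "mid = lo + a" "lo + n = mid + b" "n = a + b" "0 < a" "0 < b" "a < n" "b < n"
        using 1(2,3) by (auto simp: a_def b_def)
      have even_ab: "even a" "even b"
        using even_length_wsum[OF 1(7)] even_length_wsum[OF 1(8)] by (simp_all add: block_def a_def b_def)
      then have two: "2 \<le> a" "2 \<le> b" using ab(4,5) by (auto elim!: evenE)
      have sub: "mset (block s1 lo mid) + mset (block s1 mid (lo + n)) = mset (block s lo (lo + n))"
        using 1(6) block_append[of lo mid "lo + n" s1] 1(2,3) by simp
      then have ok1: "items_ok (block s1 lo mid)" "items_ok (block s1 mid (lo + n))"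
        using items_ok_sub[OF ok] 1(7,8) by (metis mset_subset_eq_add_left, metis mset_subset_eq_add_right)
      have e1: "env s1" using e 1(1) by (simp add: env_def mods_def s0_def)
      show "wp (While vLo vM main_body) P s1 t1"
      proof (rule less.IH[of a s1 lo])
        show "a < n" "env s1" "2 \<le> a" "M \<le> 2 ^ L" using ab e1 two v by auto
        show "wv s1 vLo = lo" using 1(1) v by (simp add: mods_def s0_def)
        show "wa s1 aNext lo = lo + a" using 1(2,4) ab by simp
        show "lo + a \<le> M" using v ab by linarith
        show "items_ok (block s1 lo (lo + a))" using ok1 ab by simp
        fix s2 :: st and t2
        assume 2: "mods ({6, 7} \<union> {10..}) UNIV {1, 2, 3, 4} {2, 3} s1 s2" "wv s2 vLo = lo + a"
          "\<And>j. j < lo \<or> lo + a \<le> j \<Longrightarrow> wa s2 aItem j = wa s1 aItem j \<and> wa s2 aNext j = wa s1 aNext j"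
          "mset (block s2 lo (lo + a)) = mset (block s1 lo (lo + a))" "matched (block s2 lo (lo + a))"
          "real t2 \<le> real t1 + cost L a"
        have blk2: "block s2 mid (mid + b) = block s1 mid (mid + b)"
          unfolding block_def using 2(3) ab by (intro map_cong) auto
        have e2: "env s2" using e1 2(1) by (simp add: env_def mods_def)
        show "wp (While vLo vM main_body) P s2 t2"
        proof (rule less.IH[of b s2 mid])
          show "b < n" "env s2" "2 \<le> b" "M \<le> 2 ^ L" "wv s2 vLo = mid" using ab e2 two v 2(2) by auto
          \<comment> \<open>The cut recorded this end, and processing the left part changed only
            cells from \<open>lo\<close> up to \<open>mid\<close>.\<close>
          show "wa s2 aNext mid = mid + b" using 2(3)[of mid] 1(4) ab by simp
          show "mid + b \<le> M" using v ab by linarith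
          show "items_ok (block s2 mid (mid + b))" unfolding blk2 using ok1(2) ab(2) by simp
          fix s3 :: st and t3
          assume 3: "mods ({6, 7} \<union> {10..}) UNIV {1, 2, 3, 4} {2, 3} s2 s3" "wv s3 vLo = mid + b"
            "\<And>j. j < mid \<or> mid + b \<le> j \<Longrightarrow> wa s3 aItem j = wa s2 aItem j \<and> wa s3 aNext j = wa s2 aNext j"
            "mset (block s3 mid (mid + b)) = mset (block s2 mid (mid + b))" "matched (block s3 mid (mid + b))"
            "real t3 \<le> real t2 + cost L b"
          have blk3: "block s3 lo mid = block s2 lo mid"
            unfolding block_def using 3(3) by (intro map_cong) auto
          have app: "block s3 lo (lo + n) = block s2 lo mid @ block s3 mid (mid + b)"
            using block_append[of lo mid "lo + n" s3] 1(2,3) blk3 ab(2) by simp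
          have ms1: "mset (block s2 lo mid) = mset (block s1 lo mid)" using 2(4) ab by simp
          have ms2: "mset (block s3 mid (mid + b)) = mset (block s1 mid (mid + b))" using 3(4) blk2 by simp
          show "wp (While vLo vM main_body) P s3 t3"
          proof (rule P)
            have m0: "mods ({6, 7} \<union> {10..}) UNIV {1, 2, 3, 4} {2, 3} s s0" by (auto simp: mods_def s0_def)
            have m1: "mods ({6, 7} \<union> {10..}) UNIV {1, 2, 3, 4} {2, 3} s s1"
              by (rule mods_trans[OF m0 1(1)]) auto
            have m2: "mods ({6, 7} \<union> {10..}) UNIV {1, 2, 3, 4} {2, 3} s s2"
              by (rule mods_trans[OF m1 2(1)]) auto
            show "mods ({6, 7} \<union> {10..}) UNIV {1, 2, 3, 4} {2, 3} s s3"
              by (rule mods_trans[OF m2 3(1)]) auto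
            show "wv s3 vLo = lo + n" using 3(2) ab(2) by simp
            show "wa s3 aItem j = wa s aItem j \<and> wa s3 aNext j = wa s aNext j" if "j < lo \<or> lo + n \<le> j" for j
              using 3(3)[of j] 2(3)[of j] 1(5)[OF that] 1(4) that ab by (auto simp: s0_def)
            show "mset (block s3 lo (lo + n)) = mset (block s lo (lo + n))"
              unfolding app using ms1 ms2 sub ab(2) by simp
            show "matched (block s3 lo (lo + n))"
              unfolding app
            proof (rule matched_append)
              show "even (length (block s2 lo mid))" using even_ab by (simp add: block_def a_def)
              show "matched (block s2 lo mid)" "matched (block s3 mid (mid + b))" using 2(5) 3(5) ab(1) by simp_all
              have "set (block s2 lo mid) = set (block s1 lo mid)"
                "set (block s3 mid (mid + b)) = set (block s1 mid (lo + n))"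
                using ms1 ms2 ab(2) by (metis set_mset_mset)+
              then show "sep (set (block s2 lo mid)) (set (block s3 mid (mid + b)))" using 1(9) by simp
            qed
            have "cost L a + cost L b + real (14 + 1200 * (n + 1) * (L + 1)) \<le> cost L n"
              using 1(10) by (intro cost_split ab n4) (simp add: a_def b_def)
            moreover have "real t1 \<le> real (t + 2 + 2 + 2 + 2 + 2 + 1200 * (n + 1) * (L + 1))"
              using 1(11) by (rule of_nat_mono)
            ultimately show "real t3 \<le> real t + cost L n" using 2(6) 3(6) by simp
          qed
        qed
      qed
    qed (use v ok n4 nL in \<open>simp_all add: s0_def\<close>)
    then show ?thesis using False by (intro enter) simp
  qed
qed

end

section \<open>Input, output and running time\<close>

abbreviation (input) "vRed \<equiv> 0 :: nat"
abbreviation (input) "vBlue \<equiv> 1 :: nat"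
abbreviation (input) "vC0 \<equiv> 4 :: nat"
abbreviation (input) "vCenters \<equiv> 5 :: nat"
abbreviation (input) "vL0 \<equiv> 8 :: nat"

definition setup_centers_body :: com where
  "setup_centers_body = At (Add vT vC0 vI) ;; At (St aCol vT vConst) ;;
     At (St aItem vItem vT) ;; At (AddI vItem vItem 1) ;;
     At (St aItem vItem vT) ;; At (AddI vItem vItem 1) ;;
     At (St aItem vItem vT) ;; At (AddI vItem vItem 1) ;; At (AddI vI vI 1)"

definition setup_leaves_body :: com where
  "setup_leaves_body = At (St aItem vItem vT) ;; At (AddI vT vT 1) ;; At (AddI vItem vItem 1)"

definition setup_prog :: com where
  "setup_prog = At (Add vN vRed vBlue) ;;
     IfW vRed vBlue (At (Cst vC0 0) ;; At (Mov vCenters vRed) ;; At (Mov vL0 vRed))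
       (At (Mov vC0 vRed) ;; At (Mov vCenters vBlue) ;; At (Cst vL0 0)) ;;
     At (Cst vI 0) ;; At (Cst vItem 0) ;; At (Cst vConst 1) ;; While vI vCenters setup_centers_body ;;
     At (Add vM vItem vItem) ;; At (Mov vT vL0) ;; While vItem vM setup_leaves_body ;;
     At (Cst vLo 0) ;; At (St aNext vLo vM)"

text \<open>\<open>aCnt\<close> counts the leaves already written for each star, so the edges may
  come in any order. The centre is written again with every edge.\<close>

definition output_body :: com where
  "output_body = At (Ld 12 aItem vI) ;; At (AddI vI vI 1) ;; At (Ld 13 aItem vI) ;; At (AddI vI vI 1) ;;
     At (Ld 18 aCol 12) ;;
     IfW vZero 18 (At (Mov 14 12) ;; At (Mov 15 13)) (At (Mov 14 13) ;; At (Mov 15 12)) ;;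
     At (Sub 16 14 vC0) ;; At (Ld 17 aCnt 16) ;; At (Add 19 16 16) ;; At (Add 19 19 19) ;;
     At (St aOut 19 14) ;; At (AddI 20 17 1) ;; At (St aCnt 16 20) ;; At (Add 19 19 20) ;; At (St aOut 19 15)"

definition output_prog :: com where
  "output_prog = At (Cst vZero 0) ;; At (Cst vI 0) ;; While vI vM output_body"

text \<open>The less frequent colour supplies the \<open>m\<close> centres, numbered from
  \<open>c0\<close>; the leaves are numbered from \<open>l0\<close>. The empty instance falls under
  the second alternative of \<open>rb\<close>.\<close>

locale k13_instance = k13 wbits Q pt N C M
  for wbits Q pt N C M +
  fixes m c0 l0 r b :: nat
  assumes N4: "N = 4 * m"
    and rb: "r < b \<and> r = m \<and> b = 3 * m \<and> c0 = 0 \<and> l0 = m \<or> \<not> r < b \<and> r = 3 * m \<and> b = m \<and> c0 = 3 * m \<and> l0 = 0"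
    and C_iff: "\<And>a. C a \<longleftrightarrow> c0 \<le> a \<and> a < c0 + m"
begin

lemma M6: "M = 6 * m" using MN N4 by simp

definition items :: "nat list" where
  "items = concat (map (\<lambda>j. [c0 + j, c0 + j, c0 + j]) [0..<m]) @ [l0..<l0 + 3 * m]"

lemma count_items: "count (mset items) a = (if a < N then if C a then 3 else 1 else 0)"
proof -
  have 1: "count (mset (concat (map (\<lambda>j. [c0 + j, c0 + j, c0 + j]) [0..<k]))) a =
      (if c0 \<le> a \<and> a < c0 + k then 3 else 0)" for k
    by (induction k) auto
  have 2: "count (mset [l0..<l0 + k]) a = (if l0 \<le> a \<and> a < l0 + k then 1 else 0)" for k
    by (induction k) (auto simp del: mset_upt)
  show ?thesis unfolding items_def mset_append count_union 1 2 C_iff using rb N4 by auto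
qed

lemma wsum_items: "wsum items = 0"
proof -
  have 1: "wsum (concat (map (\<lambda>j. [c0 + j, c0 + j, c0 + j]) [0..<k])) = 3 * int k" if "k \<le> m" for k
    using that by (induction k) (auto simp: wt_def C_iff)
  have 2: "wsum [l0..<l0 + k] = - int k" if "k \<le> 3 * m" for k
    using that rb by (induction k) (auto simp: wt_def C_iff)
  show ?thesis unfolding items_def using 1[of m] 2[of "3 * m"] by simp
qed

lemma items_ok_items: "items_ok items"
proof -
  have "a < N" if "a \<in> set items" for a
  proof -
    have "0 < count (mset items) a" using that by simp
    then show ?thesis unfolding count_items by (auto split: if_splits)
  qed
  then show ?thesis unfolding items_ok_def using wsum_items by (auto simp: count_items)
qed

lemma setup_prog_wp:
  assumes v: "wv s vRed = r" "wv s vBlue = b" and wa0: "\<And>a i. wa s a i = 0"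
    and xy: "\<And>a. a < N \<Longrightarrow> ra s aXY (2 * a) = fst (pt a) \<and> ra s aXY (Suc (2 * a)) = snd (pt a)"
    and P: "\<And>s' t'. \<lbrakk>env s'; wv s' vC0 = c0; wv s' vLo = 0; wa s' aNext 0 = M; block s' 0 M = items;
      \<And>i. wa s' aCnt i = 0; t' \<le> t + 200 * m + 100\<rbrakk> \<Longrightarrow> P s' t'"
  shows "wp setup_prog P s t"
proof -
  have rbN: "r + b = N" using rb N4 by auto
  have Q: "N < 64 * Q" "r < 64 * Q" "b < 64 * Q" "M < 64 * Q" "M < Q" using QN rbN MQ by linarith+
  define s1 :: st where "s1 = s\<lparr>wv := (wv s)(vN := N, vC0 := c0, vCenters := m, vL0 := l0, vI := 0, vItem := 0, vConst := 1)\<rparr>"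
  define c3 where "c3 k = concat (map (\<lambda>j. [c0 + j, c0 + j, c0 + j]) [0..<k])" for k
  define J where "J k s' \<longleftrightarrow> mods {11, 12, 13} {} {1, 5} {} s1 s' \<and> wv s' vI = k \<and> k \<le> m \<and>
    wv s' vItem = 3 * k \<and> block s' 0 (3 * k) = c3 k \<and>
    (\<forall>a. wa s' aCol a = (if c0 \<le> a \<and> a < c0 + k then 1 else 0))" for k s'
  define J' where "J' k s' \<longleftrightarrow> mods {3, 11, 12, 13} {} {1, 5} {} s1 s' \<and> wv s' vM = M \<and>
    wv s' vItem = 3 * m + k \<and> wv s' vT = l0 + k \<and> k \<le> 3 * m \<and> block s' 0 (3 * m + k) = c3 m @ [l0..<l0 + k] \<and>
    (\<forall>a. wa s' aCol a = (if c0 \<le> a \<and> a < c0 + m then 1 else 0))" for k s'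
  let ?rest2 = "At (Cst vLo 0) ;; At (St aNext vLo vM)"
  let ?rest = "At (Add vM vItem vItem) ;; At (Mov vT vL0) ;; While vItem vM setup_leaves_body ;; ?rest2"
  have loop2: "wp (While vItem vM setup_leaves_body) (wp ?rest2 P) s' t'"
    if J0: "J' 0 s'" and t': "t' \<le> t + 30 * m + 40" for s' t'
  proof (rule wp_for[where J = J' and m = "3 * m" and C = 6])
    show "J' 0 s'" by fact
    show "(wv s2 vItem < wv s2 vM) = (k < 3 * m)" if "J' k s2" for k s2
      using that M6 by (auto simp: J'_def)
    fix k s2 t2 assume k: "k < 3 * m" and J: "J' k s2"
    have b: "3 * m + k < Q" "Suc (3 * m + k) < 64 * Q" "Suc (l0 + k) < 64 * Q" using k M6 Q rb by linarith+
    have "map ((wa s2 aItem)(3 * m + k := l0 + k)) [0..<3 * m + k] = map (wa s2 aItem) [0..<3 * m + k]"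
      by (intro map_cong) auto
    then show "wp setup_leaves_body (\<lambda>s'' a''. J' (Suc k) s'' \<and> a'' \<le> t2 + 6) s2 t2"
      unfolding setup_leaves_body_def using J k b
      by (auto simp: wp_simps J'_def mods_def block_def)
  next
    fix s2 t2 assume J: "J' (3 * m) s2" and t2: "t2 \<le> t' + 3 * m * (6 + 2) + 2"
    have s2: "mods {3, 11, 12, 13} {} {1, 5} {} s1 s2" "wv s2 vM = M"
      "block s2 0 M = items" "\<forall>a. wa s2 aCol a = (if c0 \<le> a \<and> a < c0 + m then 1 else 0)"
      using J M6 by (auto simp: J'_def items_def c3_def)
    show "wp ?rest2 P s2 t2"
    proof (simp add: wp_simps Q_pos, rule P)
      show "env (s2\<lparr>wv := (wv s2)(6 := 0), wa := (wa s2)(4 := (wa s2 4)(0 := wv s2 3))\<rparr>)"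
        using s2 xy by (simp add: env_def mods_def s1_def C_iff)
    qed (use s2 wa0 t' t2 in \<open>simp_all add: mods_def s1_def block_def\<close>)
  qed
  have loop1: "wp (While vI vCenters setup_centers_body) (wp ?rest P) s1 (t + 2 + 2 + 2 + 2 + 2 + 2 + 2 + 2)"
  proof (rule wp_for[where J = J and m = m and C = 18])
    show "J 0 s1" using wa0 by (simp add: J_def mods_def s1_def block_def c3_def)
    show "(wv s2 vI < wv s2 vCenters) = (k < m)" if "J k s2" for k s2
      using that by (auto simp: J_def mods_def s1_def)
    fix k s2 t2 assume k: "k < m" and J: "J k s2"
    have b: "3 * k < Q" "Suc (3 * k) < Q" "Suc (Suc (3 * k)) < Q" "Suc (3 * k) < 64 * Q" "Suc (Suc (3 * k)) < 64 * Q"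
      "Suc (Suc (Suc (3 * k))) < 64 * Q" "c0 + k < Q" "c0 + k < 64 * Q" "Suc k < 64 * Q"
      using k M6 Q rb QN N4 by linarith+
    define f where "f = (wa s2 aItem)(3 * k := c0 + k, Suc (3 * k) := c0 + k, Suc (Suc (3 * k)) := c0 + k)"
    have "map f [0..<3 * k] = map (wa s2 aItem) [0..<3 * k]" by (intro map_cong) (auto simp: f_def)
    moreover have "[0..<3 * Suc k] = [0..<3 * k] @ [3 * k, Suc (3 * k), Suc (Suc (3 * k))]"
      by (simp add: numeral_3_eq_3)
    ultimately have "map f [0..<3 * Suc k] = c3 (Suc k)"
      using J by (simp add: J_def block_def c3_def f_def)
    then show "wp setup_centers_body (\<lambda>s'' a''. J (Suc k) s'' \<and> a'' \<le> t2 + 18) s2 t2"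
      unfolding setup_centers_body_def using J k b
      by (auto simp: wp_simps J_def mods_def block_def f_def s1_def)
  next
    fix s2 t2 assume J: "J m s2" and t2: "t2 \<le> t + 2 + 2 + 2 + 2 + 2 + 2 + 2 + 2 + m * (18 + 2) + 2"
    define s3 :: st where "s3 = s2\<lparr>wv := (wv s2)(vM := M, vT := l0)\<rparr>"
    have "J' 0 s3" using J M6 by (auto simp: J'_def J_def s3_def mods_def block_def)
    then have "wp (While vItem vM setup_leaves_body) (wp ?rest2 P) s3 (t2 + 2 + 2)"
      using t2 by (intro loop2) auto
    moreover have "wv s2 vItem = 3 * m" "wv s2 vL0 = l0" "l0 < 64 * Q" "3 * m + 3 * m = M" "M < 64 * Q"
      using J M6 Q rb by (auto simp: J_def mods_def s1_def)
    ultimately show "wp ?rest P s2 t2" by (simp add: wp_Seq wp_At s3_def)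
  qed
  show ?thesis
    using rb
  proof
    assume *: "r < b \<and> r = m \<and> b = 3 * m \<and> c0 = 0 \<and> l0 = m"
    then show ?thesis using loop1 v rbN Q
      by (simp add: setup_prog_def wp_Seq wp_At wp_IfW s1_def)
  next
    assume *: "\<not> r < b \<and> r = 3 * m \<and> b = m \<and> c0 = 3 * m \<and> l0 = 0"
    then show ?thesis using loop1 v rbN Q
      by (simp add: setup_prog_def wp_Seq wp_At wp_IfW s1_def)
  qed
qed

section \<open>From the matching to the stars\<close>

definition edges :: "nat list \<Rightarrow> (nat \<times> nat) list" where
  "edges ys = map (\<lambda>(a, b). if C a then (a, b) else (b, a)) (pairs ys)"

definition leaves_of :: "(nat \<times> nat) list \<Rightarrow> nat \<Rightarrow> nat list" where
  "leaves_of qs c = map snd (filter (\<lambda>q. fst q = c) qs)"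

lemma mset_edges:
  assumes "even (length ys)"
  shows "mset (map fst (edges ys)) + mset (map snd (edges ys)) = mset ys"
  using assms unfolding edges_def by (induction ys rule: pairs.induct) auto

lemma edges_colors:
  assumes "matched ys" "(c, l) \<in> set (edges ys)"
  shows "C c" "\<not> C l"
  using assms by (auto simp: matched_def edges_def split: if_splits)

text \<open>The ends of all edges together are the items, and the colours tell first ends from
  second ends. A centre thus occurs three times as a first end, a leaf once as a second end.\<close>

lemma edges_counts:
  assumes mt: "matched ys" and ms: "mset ys = mset items"
  shows "length (leaves_of (edges ys) c) = (if C c then 3 else 0)"
    and "count (mset (map snd (edges ys))) l = (if l < N \<and> \<not> C l then 1 else 0)"
proof -
  have "even (length ys)" using ms items_ok_items even_length_wsum[of items]
    by (metis items_ok_def size_mset)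
  from mset_edges[OF this] have ct: "count (mset (map fst (edges ys))) a + count (mset (map snd (edges ys))) a =
      (if a < N then if C a then 3 else 1 else 0)" for a
    using ms count_items[of a] by (metis count_union)
  have f0: "count (mset (map fst (edges ys))) a = 0" if "\<not> C a" for a
    using edges_colors[OF mt] that by (auto simp: count_eq_zero_iff)
  have s0: "count (mset (map snd (edges ys))) a = 0" if "C a" for a
    using edges_colors[OF mt] that by (auto simp: count_eq_zero_iff)
  have CN: "a < N" if "C a" for a using that rb N4 by (auto simp: C_iff)
  have "length (leaves_of qs c) = count (mset (map fst qs)) c" for qs :: "(nat \<times> nat) list"
    unfolding leaves_of_def by (induction qs) auto
  then show "length (leaves_of (edges ys) c) = (if C c then 3 else 0)"
    using ct[of c] f0[of c] s0[of c] CN[of c] by auto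
  show "count (mset (map snd (edges ys))) l = (if l < N \<and> \<not> C l then 1 else 0)"
    using ct[of l] f0[of l] s0[of l] by auto
qed

lemma output_prog_wp:
  assumes e: "env s" and v: "wv s vC0 = c0" and cnt0: "\<And>i. wa s aCnt i = 0"
    and ys: "ys = block s 0 M" "matched ys" "mset ys = mset items"
    and P: "\<And>s' t'. \<lbrakk>\<And>i. i < m \<Longrightarrow> wa s' aOut (4 * i) = c0 + i;
      \<And>i j. i < m \<Longrightarrow> j < 3 \<Longrightarrow> wa s' aOut (4 * i + Suc j) = leaves_of (edges ys) (c0 + i) ! j;
      t' \<le> t + 200 * m + 100\<rbrakk> \<Longrightarrow> P s' t'"
  shows "wp output_prog P s t"
proof -
  have ly: "length ys = M" by (simp add: ys block_def)
  define qs where "qs = edges ys"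
  have lq: "length qs = 3 * m" using ly M6 by (simp add: qs_def edges_def length_pairs)
  have lv: "length (leaves_of qs c) = (if C c then 3 else 0)" for c
    unfolding qs_def using edges_counts(1)[OF ys(2,3)] .
  have ysN: "ys ! i < N" if "i < M" for i
  proof -
    have "set ys \<subseteq> {..<N}" using items_ok_mset[OF ys(3)] items_ok_items by (simp add: items_ok_def)
    then show ?thesis using nth_bounded[of ys N i] that ly by simp
  qed
  have ysi: "wa s aItem i = ys ! i" if "i < M" for i using that by (simp add: ys block_def)
  define J where "J k s' \<longleftrightarrow> mods ({11..20} \<union> {28}) {} {0, 6} {} s s' \<and> wv s' vI = 2 * k \<and> wv s' vZero = 0 \<and> k \<le> 3 * m \<and>
    (\<forall>i<m. wa s' aCnt i = length (leaves_of (take k qs) (c0 + i)) \<and>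
      (leaves_of (take k qs) (c0 + i) \<noteq> [] \<longrightarrow> wa s' aOut (4 * i) = c0 + i) \<and>
      (\<forall>j < length (leaves_of (take k qs) (c0 + i)).
        wa s' aOut (4 * i + Suc j) = leaves_of (take k qs) (c0 + i) ! j))" for k s'
  have "wp (While vI vM output_body) P (s\<lparr>wv := (wv s)(vZero := 0, vI := 0)\<rparr>) (t + 2 + 2)"
  proof (rule wp_for[where J = J and m = "3 * m" and C = 40])
    show "J 0 (s\<lparr>wv := (wv s)(vZero := 0, vI := 0)\<rparr>)"
      using cnt0 by (simp add: J_def mods_def leaves_of_def)
    show "(wv s' vI < wv s' vM) = (k < 3 * m)" if "J k s'" for k s'
    proof -
      have "wv s' vI = 2 * k" "wv s' vM = M" using that e by (simp_all add: J_def mods_def env_def)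
      then show ?thesis using M6 by linarith
    qed
    fix k s' t' assume k: "k < 3 * m" and J: "J k s'"
    have k2: "2 * k < M" "Suc (2 * k) < M" using k M6 by linarith+
    define a where "a = ys ! (2 * k)"
    define a' where "a' = ys ! Suc (2 * k)"
    have aN: "a < N" "a' < N" using ysN k2 by (auto simp: a_def a'_def)
    have pk: "pairs ys ! k = (a, a')" using nth_pairs[of k ys] k ly M6 by (simp add: a_def a'_def)
    define c where "c = fst (qs ! k)"
    define l where "l = snd (qs ! k)"
    have qk: "(c, l) = (if C a then (a, a') else (a', a))"
      unfolding c_def l_def qs_def edges_def using pk k ly M6 by (simp add: length_pairs)
    have cl: "C c" "c < N" "l < N"
    proof -
      have "(c, l) \<in> set qs" using k lq nth_mem[of k qs] by (simp add: c_def l_def)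
      then show "C c" using edges_colors[OF ys(2)] by (simp add: qs_def)
      show "c < N" "l < N" using qk aN by (auto split: if_splits)
    qed
    define i where "i = c - c0"
    have i: "c = c0 + i" "i < m" "c - c0 = i" "c0 \<le> c" using cl(1) by (auto simp: C_iff i_def)
    define n where "n = length (leaves_of (take k qs) c)"
    have tk: "take (Suc k) qs = take k qs @ [(c, l)]" using k lq by (simp add: take_Suc_conv_app_nth c_def l_def)
    have lvS: "leaves_of (take (Suc k) qs) x = (if x = c then leaves_of (take k qs) c @ [l] else leaves_of (take k qs) x)" for x
      unfolding tk by (simp add: leaves_of_def)
    \<comment> \<open>The current edge is itself one of the three edges at \<open>c\<close>, so
      fewer than three precede it.\<close>
    have n3: "n < 3"
    proof -
      have "qs = take (Suc k) qs @ drop (Suc k) qs" by simp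
      then have "leaves_of qs c = leaves_of (take (Suc k) qs) c @ leaves_of (drop (Suc k) qs) c"
        unfolding leaves_of_def by (metis filter_append map_append)
      then have "length (leaves_of (take (Suc k) qs) c) \<le> 3" using lv[of c] cl by simp
      then show ?thesis by (simp add: lvS n_def)
    qed
    have m': "mods ({11..20} \<union> {28}) {} {0, 6} {} s s'" "wv s' vI = 2 * k" "wv s' vZero = 0"
      using J by (auto simp: J_def)
    have mv: "wa s' aItem (2 * k) = a" "wa s' aItem (Suc (2 * k)) = a'" "wa s' aCol a = (if C a then 1 else 0)"
      "wv s' vC0 = c0" "wa s' aCnt i = n"
      using m' ysi k2 e aN v J i by (auto simp: mods_def a_def a'_def env_def J_def n_def)
    have b: "2 * k < Q" "Suc (2 * k) < Q" "Suc (2 * k) < 64 * Q" "Suc (Suc (2 * k)) < 64 * Q"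
      "a < Q" "a < 64 * Q" "a' < 64 * Q" "c < 64 * Q" "l < 64 * Q" "i < Q" "i + i < 64 * Q"
      "i + i + (i + i) < 64 * Q" "i + i + (i + i) < Q" "Suc n < 64 * Q"
      "i + i + (i + i) + Suc n < 64 * Q" "i + i + (i + i) + Suc n < Q"
      using k2 MQ aN QN cl i n3 N4 by linarith+
    define s2 :: st where "s2 = s'\<lparr>wv := (wv s')(12 := a, 13 := a', vI := Suc (Suc (2 * k)), 18 := if C a then 1 else 0,
       14 := c, 15 := l, 16 := i, 17 := n, 20 := Suc n, 19 := 4 * i + Suc n),
       wa := (wa s')(aCnt := (wa s' aCnt)(i := Suc n), aOut := (wa s' aOut)(4 * i := c, 4 * i + Suc n := l))\<rparr>"
    have "J (Suc k) s2"
      unfolding J_def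
    proof (intro conjI allI impI)
      show "mods ({11..20} \<union> {28}) {} {0, 6} {} s s2"
        using m'(1) by (auto simp: mods_def s2_def)
      show "wv s2 vI = 2 * Suc k" "wv s2 vZero = 0" "Suc k \<le> 3 * m" using k m'(3) by (simp_all add: s2_def)
      fix i' assume i': "i' < m"
      show "wa s2 aCnt i' = length (leaves_of (take (Suc k) qs) (c0 + i'))"
        using J i' i by (auto simp: J_def s2_def lvS n_def)
      show "wa s2 aOut (4 * i') = c0 + i'" if "leaves_of (take (Suc k) qs) (c0 + i') \<noteq> []"
      proof (cases "i' = i")
        case False
        \<comment> \<open>\<open>Suc n\<close> is 1, 2 or 3, so the leaf is not written to a cell
          reserved for a centre.\<close>
        then have "4 * i' \<noteq> 4 * i + Suc n" using n3 by presburger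
        then show ?thesis using J i' that False i by (auto simp: J_def s2_def lvS split: if_splits)
      qed (use i in \<open>simp add: s2_def\<close>)
      show "wa s2 aOut (4 * i' + Suc j) = leaves_of (take (Suc k) qs) (c0 + i') ! j"
        if j: "j < length (leaves_of (take (Suc k) qs) (c0 + i'))" for j
      proof (cases "i' = i")
        case False
        have "length (leaves_of (take k qs) (c0 + i')) \<le> 3"
        proof -
          have "qs = take k qs @ drop k qs" by simp
          then have "leaves_of qs (c0 + i') = leaves_of (take k qs) (c0 + i') @ leaves_of (drop k qs) (c0 + i')"
            unfolding leaves_of_def by (metis filter_append map_append)
          then show ?thesis using lv[of "c0 + i'"] by (simp split: if_splits)
        qed
        moreover have "length (leaves_of (take k qs) (c0 + i')) > j" using j False i by (simp add: lvS)
        ultimately have j3: "j < 3" by simp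
        then have "4 * i' + Suc j \<noteq> 4 * i + Suc n" "4 * i' + Suc j \<noteq> 4 * i" using n3 False by presburger+
        then show ?thesis using J i' j False i by (auto simp: J_def s2_def lvS)
      next
        case True
        have old: "wa s' aOut (4 * i + Suc j) = leaves_of (take k qs) c ! j" if "j < n"
          using J i that by (simp add: J_def n_def)
        show ?thesis using True i j old by (auto simp: s2_def lvS n_def nth_append less_Suc_eq)
      qed
    qed
    moreover have "wp output_body (\<lambda>s'' t''. s'' = s2 \<and> t'' \<le> t' + 40) s' t'"
    proof -
      have four: "i + i + (i + i) = 4 * i" "i + i + (i + i) + x = 4 * i + x" for x by simp_all
      show ?thesis
      proof (cases "C a")
        case True
        then have ac: "a = c" "a' = l" using qk by simp_all
        show ?thesis unfolding output_body_def s2_def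
          using m'(2,3) mv b i(3,4) True unfolding ac four by (simp add: wp_simps four)
      next
        case False
        then have ac: "a = l" "a' = c" using qk by simp_all
        show ?thesis unfolding output_body_def s2_def
          using m'(2,3) mv b i(3,4) False unfolding ac four by (simp add: wp_simps four)
      qed
    qed
    ultimately show "wp output_body (\<lambda>s'' a''. J (Suc k) s'' \<and> a'' \<le> t' + 40) s' t'"
      by (elim wp_mono) simp
  next
    fix s' t' assume J: "J (3 * m) s'" and t': "t' \<le> t + 2 + 2 + 3 * m * (40 + 2) + 2"
    have tq: "take (3 * m) qs = qs" using lq by simp
    have l3: "length (leaves_of qs (c0 + i)) = 3" if "i < m" for i using lv[of "c0 + i"] that by (simp add: C_iff)
    show "P s' t'"
    proof (rule P)
      show "wa s' aOut (4 * i) = c0 + i" if "i < m" for i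
      proof -
        have "leaves_of qs (c0 + i) \<noteq> []" using l3[OF that] by auto
        then show ?thesis using J that unfolding J_def tq by blast
      qed
      show "wa s' aOut (4 * i + Suc j) = leaves_of (edges ys) (c0 + i) ! j" if "i < m" "j < 3" for i j
        using J that l3[OF that(1)] unfolding J_def tq qs_def[symmetric] by simp
      show "t' \<le> t + 200 * m + 100" using t' by simp
    qed
  qed
  then show ?thesis unfolding output_prog_def by (simp add: wp_Seq wp_At)
qed

end

context k13_instance
begin

text \<open>\<open>matched\<close> relates each pair only to later ones and ignores orientation;
  \<open>noncr\<close> is symmetric and does not depend on the order of the ends of a
  segment.\<close>

lemma edges_noncr:
  assumes mt: "matched ys" and xy: "x \<in> set (edges ys)" "y \<in> set (edges ys)" "x \<noteq> y"
  shows "noncr_pair x y"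
proof -
  let ?f = "\<lambda>(a, b). if C a then (a, b) else (b, a)"
  obtain x0 y0 where 0: "x0 \<in> set (pairs ys)" "x = ?f x0" "y0 \<in> set (pairs ys)" "y = ?f y0"
    using xy by (auto simp: edges_def)
  then have "x0 \<noteq> y0" using xy(3) by auto
  obtain i j where ij: "i < length (pairs ys)" "pairs ys ! i = x0" "j < length (pairs ys)" "pairs ys ! j = y0"
    using 0 by (auto simp: in_set_conv_nth)
  have srt: "sorted_wrt noncr_pair (pairs ys)" using mt by (simp add: matched_def)
  have "noncr_pair x0 y0 \<or> noncr_pair y0 x0"
    using sorted_wrt_nth_less[OF srt, of i j] sorted_wrt_nth_less[OF srt, of j i] ij \<open>x0 \<noteq> y0\<close>
    by (cases i j rule: linorder_cases) auto
  then have "noncr_pair x0 y0" using noncr_sym by (auto simp: noncr_pair_def case_prod_unfold)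
  then show ?thesis unfolding 0 using noncr_swap by (auto simp: noncr_pair_def case_prod_unfold)
qed

text \<open>Here the copies collapse. Each leaf ends exactly one edge, so the three leaves of a star
  are distinct and different stars are disjoint; edges at copies of one centre may meet in that
  centre, which \<open>noncr\<close> permits.\<close>

lemma covering_of_output:
  assumes mt: "matched ys" "mset ys = mset items"
    and w: "\<And>i. i < m \<Longrightarrow> w (4 * i) = c0 + i"
      "\<And>i j. i < m \<Longrightarrow> j < 3 \<Longrightarrow> w (4 * i + Suc j) = leaves_of (edges ys) (c0 + i) ! j"
  shows "\<And>a. a < N \<Longrightarrow> w a < N"
    and "K13_covering (pt ` {..<r}) (pt ` {r..<N})
      ((\<lambda>i. (pt (w (4 * i)), (\<lambda>j. pt (w (4 * i + j))) ` {1, 2, 3})) ` {..<m})"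
proof -
  define qs where "qs = edges ys"
  define lv where "lv i = set (leaves_of qs (c0 + i))" for i
  have lv_iff: "l \<in> lv i \<longleftrightarrow> (c0 + i, l) \<in> set qs" for l i
    by (force simp: lv_def leaves_of_def)
  have l3: "length (leaves_of qs (c0 + i)) = 3" if "i < m" for i
    using edges_counts(1)[OF mt, of "c0 + i"] that by (simp add: qs_def C_iff)
  have dist: "distinct (map snd qs)"
    unfolding distinct_count_atmost_1
  proof
    fix l
    have "count (mset (map snd qs)) l = (if l < N \<and> \<not> C l then 1 else 0)"
      unfolding qs_def by (rule edges_counts(2)[OF mt])
    moreover have "l \<in> set (map snd qs) \<longleftrightarrow> count (mset (map snd qs)) l > 0" by (simp add: count_greater_zero_iff)
    ultimately show "count (mset (map snd qs)) l = (if l \<in> set (map snd qs) then 1 else 0)" by auto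
  qed
  have snd_qs: "set (map snd qs) = {l. l < N \<and> \<not> C l}"
  proof (rule set_eqI)
    fix l
    have "count (mset (map snd qs)) l = (if l < N \<and> \<not> C l then 1 else 0)"
      unfolding qs_def by (rule edges_counts(2)[OF mt])
    moreover have "l \<in> set (map snd qs) \<longleftrightarrow> count (mset (map snd qs)) l > 0" by (simp add: count_greater_zero_iff)
    ultimately show "l \<in> set (map snd qs) \<longleftrightarrow> l \<in> {l. l < N \<and> \<not> C l}" by auto
  qed
  have uniq: "c = c'" if "(c, l) \<in> set qs" "(c', l) \<in> set qs" for c c' l
    using inj_onD[of snd "set qs" "(c, l)" "(c', l)"] that dist by (auto simp: distinct_map)
  have card3: "card (lv i) = 3" if "i < m" for i
  proof -
    have "distinct (leaves_of qs (c0 + i))"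
      unfolding leaves_of_def using dist by (simp add: distinct_map_filter)
    then show ?thesis using l3[OF that] by (simp add: lv_def distinct_card)
  qed
  have lvN: "l < N" "\<not> C l" if "l \<in> lv i" for l i
  proof -
    have "l \<in> set (map snd qs)" using that unfolding lv_iff by force
    then show "l < N" "\<not> C l" unfolding snd_qs by auto
  qed
  have cN: "c0 + i < N" "C (c0 + i)" if "i < m" for i using that rb N4 by (auto simp: C_iff)
  have lv_eq: "(\<lambda>j. w (4 * i + j)) ` {1, 2, 3} = lv i" if "i < m" for i
  proof -
    have "(\<lambda>j. w (4 * i + j)) ` {1, 2, 3} = (\<lambda>j. w (4 * i + Suc j)) ` {0, 1, 2}"
      by (simp add: numeral_2_eq_2 numeral_3_eq_3)
    also have "{0, 1, 2} = {..<3::nat}" by auto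
    also have "(\<lambda>j. w (4 * i + Suc j)) ` {..<3} = (\<lambda>j. leaves_of qs (c0 + i) ! j) ` {..<3}"
      unfolding qs_def by (rule image_cong[OF refl], rule w(2)[OF that]) simp
    also have "(\<lambda>j. leaves_of qs (c0 + i) ! j) ` {..<3} = lv i"
      using l3[OF that] by (auto simp: lv_def set_conv_nth)
    finally show ?thesis .
  qed
  show "w a < N" if "a < N" for a
  proof -
    define i where "i = a div 4"
    have i: "i < m" "a = 4 * i + a mod 4" using that N4 by (auto simp: i_def)
    have "a mod 4 < 4" by simp
    then have "a mod 4 = 0 \<or> a mod 4 = 1 \<or> a mod 4 = 2 \<or> a mod 4 = 3" by arith
    then consider "a mod 4 = 0" | "a mod 4 \<in> {1, 2, 3}" by fastforce
    then show ?thesis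
    proof cases
      case 1
      then show ?thesis using i w(1)[OF i(1)] cN by auto
    next
      case 2
      then have "w (4 * i + a mod 4) \<in> lv i" using lv_eq[OF i(1)] by blast
      then show ?thesis using lvN i(2) by metis
    qed
  qed
  define star where "star i = (pt (c0 + i), pt ` lv i)" for i
  have stars: "(\<lambda>i. (pt (w (4 * i)), (\<lambda>j. pt (w (4 * i + j))) ` {1, 2, 3})) ` {..<m} = star ` {..<m}"
  proof (rule image_cong)
    fix i assume "i \<in> {..<m}"
    then have i: "i < m" by simp
    have "(\<lambda>j. pt (w (4 * i + j))) ` {1, 2, 3} = pt ` (\<lambda>j. w (4 * i + j)) ` {1, 2, 3}" by blast
    then show "(pt (w (4 * i)), (\<lambda>j. pt (w (4 * i + j))) ` {1, 2, 3}) = star i"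
      unfolding star_def using w(1)[OF i] lv_eq[OF i] by (simp only:)
  qed simp
  have rC: "{a. a < N \<and> C a} = {..<r} \<and> {a. a < N \<and> \<not> C a} = {r..<N} \<or>
      {a. a < N \<and> C a} = {r..<N} \<and> {a. a < N \<and> \<not> C a} = {..<r}"
    using rb N4 by (auto simp: C_iff)
  have edge: "\<exists>c l. p = pt c \<and> q = pt l \<and> (c, l) \<in> set qs \<and> c < N \<and> l < N"
    if pq: "(p, q) \<in> star_edges (star ` {..<m})" for p q
  proof -
    obtain i l where "i < m" "p = pt (c0 + i)" "q = pt l" "l \<in> lv i"
      using pq by (auto simp: star_edges_def star_def)
    then show ?thesis using lvN cN unfolding lv_iff by blast
  qed
  have "K13_covering (pt ` {..<r}) (pt ` {r..<N}) (star ` {..<m})"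
    unfolding K13_covering_def
  proof (intro conjI ballI)
    fix s assume "s \<in> star ` {..<m}"
    then obtain i where i: "i < m" "s = star i" by auto
    have "card (pt ` lv i) = 3"
      using card3[OF i(1)] lvN pt_inj by (subst card_image) (auto simp: inj_on_def)
    moreover have "c0 + i \<in> {a. a < N \<and> C a}" "lv i \<subseteq> {a. a < N \<and> \<not> C a}" using cN[OF i(1)] lvN by auto
    ultimately show "K13_star (pt ` {..<r}) (pt ` {r..<N}) s"
      unfolding i(2) K13_star_def star_def using rC by auto
  next
    show "disjoint_family_on (\<lambda>(c, L). insert c L) (star ` {..<m})"
      unfolding disjoint_family_on_def
    proof (intro ballI impI)
      fix s s' assume "s \<in> star ` {..<m}" "s' \<in> star ` {..<m}" "s \<noteq> s'"
      then obtain i j where ij: "i < m" "s = star i" "j < m" "s' = star j" "i \<noteq> j" by auto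
      have "lv i \<inter> lv j = {}" using ij(5) uniq unfolding lv_iff disjoint_iff by fastforce
      moreover have "c0 + i \<notin> lv j" "c0 + j \<notin> lv i" "c0 + i \<noteq> c0 + j"
        using lvN(2) cN(2) ij by auto
      ultimately have "insert (c0 + i) (lv i) \<inter> insert (c0 + j) (lv j) = {}" by auto
      moreover have "insert (c0 + i) (lv i) \<subseteq> {..<N}" "insert (c0 + j) (lv j) \<subseteq> {..<N}"
        using ij cN lvN by auto
      ultimately have "pt ` insert (c0 + i) (lv i) \<inter> pt ` insert (c0 + j) (lv j) = {}"
        using pt_inj by (metis image_empty inj_on_image_Int)
      then show "(\<lambda>(c, L). insert c L) s \<inter> (\<lambda>(c, L). insert c L) s' = {}"
        unfolding ij star_def by simp
    qed
  next
    have "(\<Union>i<m. insert (c0 + i) (lv i)) = {..<N}"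
    proof (intro equalityI subsetI)
      fix a assume "a \<in> (\<Union>i<m. insert (c0 + i) (lv i))"
      then show "a \<in> {..<N}" using cN lvN by auto
    next
      fix a assume a: "a \<in> {..<N}"
      show "a \<in> (\<Union>i<m. insert (c0 + i) (lv i))"
      proof (cases "C a")
        case True
        then show ?thesis by (auto simp: C_iff intro!: bexI[of _ "a - c0"])
      next
        case False
        then have "a \<in> set (map snd qs)" using a unfolding snd_qs by simp
        then obtain c where c: "(c, a) \<in> set qs" by auto
        then have "C c" using edges_colors(1)[OF mt(1)] by (auto simp: qs_def)
        then have "c = c0 + (c - c0)" "c - c0 < m" by (auto simp: C_iff)
        then have "a \<in> lv (c - c0)" "c - c0 < m" using c unfolding lv_iff by auto
        then show ?thesis by blast
      qed
    qed
    then have "(\<Union>i<m. pt ` insert (c0 + i) (lv i)) = pt ` {..<N}" by (metis image_UN)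
    moreover have "pt ` {..<r} \<union> pt ` {r..<N} = pt ` {..<N}"
    proof -
      have "{..<r} \<union> {r..<N} = {..<N}" using rb N4 by auto
      then show ?thesis by (metis image_Un)
    qed
    ultimately show "(\<Union>(c, L)\<in>star ` {..<m}. insert c L) = pt ` {..<r} \<union> pt ` {r..<N}"
      by (simp add: star_def)
  next
    show "non_crossing (star_edges (star ` {..<m}))"
      unfolding non_crossing_def case_prod_unfold
    proof (intro ballI impI)
      fix x y
      assume xy: "x \<in> star_edges (star ` {..<m})" "y \<in> star_edges (star ` {..<m})"
        and ne: "(fst x, snd x) \<noteq> (fst y, snd y)"
      obtain c l where cl: "fst x = pt c" "snd x = pt l" "(c, l) \<in> set qs"
        using edge[of "fst x" "snd x"] xy(1) by auto
      obtain c' l' where cl': "fst y = pt c'" "snd y = pt l'" "(c', l') \<in> set qs"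
        using edge[of "fst y" "snd y"] xy(2) by auto
      have "(c, l) \<noteq> (c', l')" using ne cl cl' by auto
      then have "noncr_pair (c, l) (c', l')" using edges_noncr[OF mt(1)] cl(3) cl'(3) by (simp add: qs_def)
      then show "closed_segment (fst x) (snd x) \<inter> closed_segment (fst y) (snd y) \<subseteq>
          {fst x, snd x} \<inter> {fst y, snd y}"
        unfolding cl(1,2) cl'(1,2) by (simp only: noncr_pair_def noncr_def split_conv)
    qed
  qed
  then show "K13_covering (pt ` {..<r}) (pt ` {r..<N})
      ((\<lambda>i. (pt (w (4 * i)), (\<lambda>j. pt (w (4 * i + j))) ` {1, 2, 3})) ` {..<m})"
    unfolding stars .
qed

lemma algorithm_wp:
  assumes v: "wv s vRed = r" "wv s vBlue = b" and wa0: "\<And>a i. wa s a i = 0"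
    and xy: "\<And>a. a < N \<Longrightarrow> ra s aXY (2 * a) = fst (pt a) \<and> ra s aXY (Suc (2 * a)) = snd (pt a)"
    and L: "M \<le> 2 ^ L"
  shows "wp (setup_prog ;; While vLo vM main_body ;; output_prog)
    (\<lambda>s' t'. (\<forall>a<N. wa s' aOut a < N) \<and> K13_covering (pt ` {..<r}) (pt ` {r..<N})
      ((\<lambda>i. (pt (wa s' aOut (4 * i)), (\<lambda>j. pt (wa s' aOut (4 * i + j))) ` {1, 2, 3})) ` {..<m}) \<and>
      real t' \<le> 400 * real m + 202 + cost L M) s 0"
    (is "wp _ ?P _ _")
proof (subst wp_Seq, rule setup_prog_wp[OF v wa0 xy])
  fix s1 :: st and t1
  assume 1: "env s1" "wv s1 vC0 = c0" "wv s1 vLo = 0" "wa s1 aNext 0 = M" "block s1 0 M = items"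
    "\<And>i. wa s1 aCnt i = 0" "t1 \<le> 0 + 200 * m + 100"
  have fin: "wp (While vLo vM main_body) (wp output_prog ?P) s2 t2"
    if 2: "env s2" "wv s2 vLo = M" "wv s2 vC0 = c0" "\<And>i. wa s2 aCnt i = 0"
      "matched (block s2 0 M)" "mset (block s2 0 M) = mset items"
      "real t2 \<le> 200 * real m + 100 + cost L M" for s2 t2
  proof (rule wp_While_exit)
    show "\<not> wv s2 vLo < wv s2 vM" using 2(1,2) by (simp add: env_def)
    show "wp output_prog ?P s2 (t2 + 2)"
    proof (rule output_prog_wp[OF 2(1,3,4) refl 2(5,6)])
      fix s3 :: st and t3
      assume 3: "\<And>i. i < m \<Longrightarrow> wa s3 aOut (4 * i) = c0 + i"
        "\<And>i j. i < m \<Longrightarrow> j < 3 \<Longrightarrow> wa s3 aOut (4 * i + Suc j) = leaves_of (edges (block s2 0 M)) (c0 + i) ! j"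
        "t3 \<le> t2 + 2 + 200 * m + 100"
      note cov = covering_of_output[OF 2(5,6), of "wa s3 aOut", OF 3(1,2)]
      have "real t3 \<le> real (t2 + 2 + 200 * m + 100)" using 3(3) by (rule of_nat_mono)
      then have "real t3 \<le> 400 * real m + 202 + cost L M" using 2(7) by simp
      then show "?P s3 t3" using cov by blast
    qed
  qed
  show "wp (While vLo vM main_body ;; output_prog) ?P s1 t1"
  proof (subst wp_Seq, cases "m = 0")
    \<comment> \<open>For the empty instance the loop ends at once, while
      \<open>main_loop_wp\<close> speaks of blocks with at least two items.\<close>
    case True
    then have M0: "M = 0" using M6 by simp
    have i0: "items = []" unfolding items_def using True by simp
    show "wp (While vLo vM main_body) (wp output_prog ?P) s1 t1"
      using 1 M0 i0 True by (intro fin) (auto simp: matched_def cost_def)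
  next
    case False
    have ok: "items_ok (block s1 0 (0 + M))" using 1(5) items_ok_items by simp
    show "wp (While vLo vM main_body) (wp output_prog ?P) s1 t1"
    proof (rule main_loop_wp[where lo = 0 and n = M and L = L])
      show "wa s1 aNext 0 = 0 + M" "2 \<le> M" "0 + M \<le> M" using 1 M6 False by auto
      fix s2 :: st and t2
      assume 2: "mods ({6, 7} \<union> {10..}) UNIV {1, 2, 3, 4} {2, 3} s1 s2" "wv s2 vLo = 0 + M"
        "mset (block s2 0 (0 + M)) = mset (block s1 0 (0 + M))" "matched (block s2 0 (0 + M))"
        "real t2 \<le> real t1 + cost L M"
      have "real t1 \<le> real (0 + 200 * m + 100)" using 1(7) by (rule of_nat_mono)
      then show "wp (While vLo vM main_body) (wp output_prog ?P) s2 t2"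
        using 1 2 by (intro fin) (simp_all add: env_def mods_def)
    qed (use 1 L ok in auto)
  qed
qed

end

section \<open>The complete program and its time bound\<close>

text \<open>Saves the two input sizes in the registers of variables 0 and 1 and then sets register
  \<open>a\<close> to \<open>a * Q\<close> for the arrays, where \<open>Q = 2 * (r + b) + 2\<close>
  is formed in register 1. Register 9 is never written and keeps the value zero.\<close>

definition prologue :: "instr list" where
  "prologue = [WArith WAdd 10 0 9, WArith WAdd 11 1 9, WArith WAdd 1 10 11, WArith WAdd 1 1 1,
     WConst 8 2, WArith WAdd 1 1 8, WConst 0 0, WArith WAdd 2 1 1, WArith WAdd 3 2 1,
     WArith WAdd 4 3 1, WArith WAdd 5 4 1, WArith WAdd 6 5 1]"

definition program :: "instr list" where
  "program = prologue @ compile 12 (setup_prog ;; While vLo vM main_body ;; output_prog)"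

definition log_bound :: "nat \<Rightarrow> nat" where
  "log_bound N = nat \<lceil>log 2 (real (N + 2))\<rceil>"

text \<open>\<open>214\<close> is \<open>202\<close> plus the 12 steps of the prologue, and
  \<open>2 * N\<close> bounds the number of items. The summand 2 keeps the logarithm nonnegative for
  \<open>N = 0\<close>.\<close>

definition time_bound :: "nat \<Rightarrow> nat" where
  "time_bound N = nat \<lfloor>400 * real N + 214 +
     76800 * real (log_bound N + 2) * (2 * real N * ln (2 * real N + 2))\<rfloor>"

lemma le_two_power_log_bound: "N + 2 \<le> 2 ^ log_bound N"
proof -
  have "log 2 (real (N + 2)) \<le> real (log_bound N)" unfolding log_bound_def by linarith
  then have "real (N + 2) \<le> 2 powr real (log_bound N)" by (simp add: log_le_iff)
  also have "\<dots> = real (2 ^ log_bound N)" by (simp add: powr_realpow)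
  finally show ?thesis by (simp only: of_nat_le_iff)
qed

lemma time_bound_bigo: "(\<lambda>N. real (time_bound N)) \<in> O(\<lambda>N. real N powr (4 / 3) * ln (real N) ^ 3)"
proof -
  let ?g = "\<lambda>N::nat. 400 * real N + 214 +
    76800 * (log 2 (real N + 2) + 3) * (2 * real N * ln (2 * real N + 2))"
  have "(\<lambda>N. real (time_bound N)) \<in> O(?g)"
  proof (intro landau_o.big_mono always_eventually allI)
    fix N :: nat
    have ln: "ln (2 * real N + 2) \<ge> 0" by simp
    have lb: "real (log_bound N) \<le> log 2 (real N + 2) + 1"
    proof -
      have "log 2 (real (N + 2)) \<ge> 0" by (simp add: zero_le_log_cancel_iff)
      then show ?thesis unfolding log_bound_def by (simp add: add.commute) linarith
    qed
    have "0 \<le> 400 * real N + 214 + 76800 * real (log_bound N + 2) * (2 * real N * ln (2 * real N + 2))"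
      using ln by simp
    then have "real (time_bound N) \<le> 400 * real N + 214 +
        76800 * real (log_bound N + 2) * (2 * real N * ln (2 * real N + 2))"
      unfolding time_bound_def by linarith
    also have "\<dots> \<le> ?g N"
      using ln lb by (intro add_left_mono mult_right_mono mult_left_mono) auto
    finally show "norm (real (time_bound N)) \<le> norm (?g N)" by simp
  qed
  also have "?g \<in> O(\<lambda>N. real N powr (4 / 3) * ln (real N) ^ 3)"
    by real_asymp
  finally show ?thesis .
qed

lemma program_correct:
  assumes d: "distinct rs" "distinct bs" and inst: "K13_instance (set rs) (set bs)"
    and N: "N = length rs + length bs"
  shows "\<exists>t\<le>time_bound N. halted program ((step (word_size 8 N) program ^^ t) (init_config rs bs)) \<and>
    valid_output rs bs ((step (word_size 8 N) program ^^ t) (init_config rs bs))"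
proof -
  define Q where "Q = 2 * N + 2"
  define pt where "pt a = (rs @ bs) ! a" for a
  define r where "r = length rs"
  define b where "b = length bs"
  define m where "m = min r b"
  define c0 where "c0 = (if r < b then 0 else r)"
  define l0 where "l0 = (if r < b then r else 0)"
  define C where "C a \<longleftrightarrow> c0 \<le> a \<and> a < c0 + m" for a
  define M where "M = 6 * m"
  have disj: "set rs \<inter> set bs = {}" and gp: "general_position (set rs \<union> set bs)"
    and card: "card (set rs) = 3 * card (set bs) \<or> card (set bs) = 3 * card (set rs)"
    using inst by (auto simp: K13_instance_def)
  have rb3: "r = 3 * b \<or> b = 3 * r"
    using card d by (simp add: distinct_card r_def b_def)
  have dist: "distinct (rs @ bs)" using d disj by simp
  have N4: "N = 4 * m" using rb3 N by (auto simp: r_def[symmetric] b_def[symmetric] m_def)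
  have lenrb: "length (rs @ bs) = N" using N by simp
  \<comment> \<open>The word size constant 8 comes from here: \<open>64 * Q\<close> is at most
    \<open>2 ^ 7 * (N + 2)\<close>, hence at most \<open>(N + 2) ^ 8\<close>.\<close>
  have pow: "64 * Q \<le> 2 ^ word_size 8 N"
  proof -
    have "64 * Q \<le> 128 * (N + 2)" by (simp add: Q_def)
    also have "\<dots> = 2 ^ 7 * (N + 2)" by simp
    also have "\<dots> \<le> (N + 2) ^ 7 * (N + 2)" by (intro mult_right_mono power_mono) auto
    also have "\<dots> = (N + 2) ^ 8" by (simp flip: power_Suc2)
    also have "\<dots> \<le> (2 ^ log_bound N) ^ 8" using le_two_power_log_bound by (intro power_mono) auto
    also have "\<dots> = 2 ^ word_size 8 N"
      by (simp add: word_size_def log_bound_def mult.commute flip: power_mult)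
    finally show ?thesis .
  qed
  interpret k13_instance "word_size 8 N" Q pt N C M m c0 l0 r b
  proof
    show "0 < Q" by (simp add: Q_def)
    show "64 * Q \<le> 2 ^ word_size 8 N" by (rule pow)
    show "(64::nat) \<le> 2 ^ word_size 8 N" using pow by (simp add: Q_def)
    show "inj_on pt {..<N}" unfolding pt_def using dist lenrb by (intro inj_on_nth) auto
    fix a b c assume abc: "a < N" "b < N" "c < N" "a \<noteq> b" "b \<noteq> c" "a \<noteq> c"
    have "pt a \<noteq> pt b" "pt b \<noteq> pt c" "pt a \<noteq> pt c"
      unfolding pt_def using dist abc lenrb by (simp_all add: nth_eq_iff_index_eq)
    then have "card {pt a, pt b, pt c} = 3" by simp
    moreover have "pt x \<in> set rs \<union> set bs" if "x < N" for x
      using nth_mem[of x "rs @ bs"] that lenrb by (simp add: pt_def)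
    then have "{pt a, pt b, pt c} \<subseteq> set rs \<union> set bs" using abc by auto
    ultimately show "\<not> collinear {pt a, pt b, pt c}" using gp unfolding general_position_def by blast
  qed (use N4 rb3 in \<open>auto simp: Q_def M_def m_def c0_def l0_def C_def\<close>)
  define s0 :: st where "s0 = \<lparr>wv = (\<lambda>_. 0)(0 := r, 1 := b), rv = (\<lambda>_. 0), wa = (\<lambda>_ _. 0),
    ra = (\<lambda>_ _. 0)(0 := rmem (init_config rs bs))\<rparr>"
  \<comment> \<open>One bit more than for \<open>N\<close>, because the items outnumber the points
    by a factor below 2.\<close>
  define L where "L = log_bound N + 1"
  have M_le: "M \<le> 2 ^ L"
  proof -
    have "M \<le> 2 * (N + 2)" using N4 by (simp add: M_def)
    also have "\<dots> \<le> 2 * 2 ^ log_bound N" using le_two_power_log_bound by (intro mult_left_mono) auto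
    finally show ?thesis by (simp add: L_def)
  qed
  define code where "code = (setup_prog ;; While vLo vM main_body ;; output_prog)"
  have "wp code (\<lambda>s' t'. (\<forall>a<N. wa s' aOut a < N) \<and> K13_covering (pt ` {..<r}) (pt ` {r..<N})
      ((\<lambda>i. (pt (wa s' aOut (4 * i)), (\<lambda>j. pt (wa s' aOut (4 * i + j))) ` {1, 2, 3})) ` {..<m}) \<and>
      real t' \<le> 400 * real m + 202 + cost L M) s0 0"
    unfolding code_def
  proof (rule algorithm_wp)
    show "ra s0 aXY (2 * a) = fst (pt a) \<and> ra s0 aXY (Suc (2 * a)) = snd (pt a)" if "a < N" for a
    proof -
      have "Suc (2 * a) < 2 * (length rs + length bs)" "2 * a < 2 * (length rs + length bs)"
        using that unfolding N by auto
      then show ?thesis by (simp add: s0_def init_config_def pt_def)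
    qed
  qed (use M_le in \<open>simp_all add: s0_def\<close>)
  then obtain t s' where big: "big code s0 t s'" and out: "\<forall>a<N. wa s' aOut a < N"
    and cov: "K13_covering (pt ` {..<r}) (pt ` {r..<N})
      ((\<lambda>i. (pt (wa s' aOut (4 * i)), (\<lambda>j. pt (wa s' aOut (4 * i + j))) ` {1, 2, 3})) ` {..<m})"
    and t: "real t \<le> 400 * real m + 202 + cost L M"
    unfolding wp_def by auto
  define \<sigma>0 where "\<sigma>0 = init_config rs bs"
  define \<sigma>1 where "\<sigma>1 = fold (exec_instr (word_size 8 N)) prologue \<sigma>0"
  have prog: "program = [] @ prologue @ compile 12 code" by (simp add: program_def code_def)
  have len12: "length prologue = 12" by (simp add: prologue_def)
  have st1: "(step (word_size 8 N) program ^^ 12) \<sigma>0 = \<sigma>1"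
    unfolding \<sigma>1_def len12[symmetric]
    by (rule steps_straight_line[OF prog]) (auto simp: \<sigma>0_def init_config_def prologue_def)
  have sim1: "sim s0 \<sigma>1 \<and> pc \<sigma>1 = 12"
  proof -
    define W where "W = word_size 8 N"
    have rbN: "r + b = N" using N by (simp add: r_def b_def)
    have small: "x mod 2 ^ W = x" if "x \<le> 12 * (r + b) + 12" for x
      unfolding W_def using that rbN by (intro word_small) (simp add: Q_def)
    have Q': "Q = 2 * (r + b) + 2" using rbN by (simp add: Q_def)
    have regs: "wreg \<sigma>1 = (\<lambda>_. 0)(10 := r, 11 := b, 8 := 2, 1 := Q, 0 := 0, 2 := 2 * Q, 3 := 3 * Q, 4 := 4 * Q, 5 := 5 * Q, 6 := 6 * Q)"
      "pc \<sigma>1 = 12" "rreg \<sigma>1 = (\<lambda>_. 0)" "wmem \<sigma>1 = (\<lambda>_. 0)" "rmem \<sigma>1 = rmem \<sigma>0"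
      unfolding \<sigma>1_def \<sigma>0_def prologue_def init_config_def W_def[symmetric] Q'
      by (simp_all add: small fun_eq_iff flip: r_def b_def)
    have "wreg \<sigma>1 (x + 10) = wv s0 x" for x
      unfolding regs s0_def by auto
    moreover have "wreg \<sigma>1 a = a * Q" if "a \<le> 6" for a
    proof -
      have "a = 0 \<or> a = 1 \<or> a = 2 \<or> a = 3 \<or> a = 4 \<or> a = 5 \<or> a = 6" using that by arith
      then show ?thesis unfolding regs by (elim disjE) simp_all
    qed
    \<comment> \<open>The input occupies \<open>2 * N < Q\<close> cells, so the other real arrays
      begin beyond it and are zero.\<close>
    moreover have "rmem \<sigma>0 (a * Q + i) = ra s0 a i" if "i < Q" for a i
    proof (cases "a = 0")
      case True
      then show ?thesis by (simp add: s0_def \<sigma>0_def)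
    next
      case False
      then have "1 * Q \<le> a * Q" by (intro mult_right_mono) auto
      moreover have "2 * (length rs + length bs) < Q" using N by (simp add: Q_def)
      ultimately have "\<not> a * Q + i < 2 * (length rs + length bs)" by linarith
      then show ?thesis using False by (simp add: s0_def \<sigma>0_def init_config_def)
    qed
    ultimately show ?thesis unfolding sim_def by (simp add: regs s0_def)
  qed
  have "reaches program t \<sigma>1 s' (length prologue + len code)"
    by (rule compile_sim[OF big, where post = "[]"]) (use sim1 prog len12 in auto)
  then obtain u where u: "u \<le> t" "sim s' ((step (word_size 8 N) program ^^ u) \<sigma>1)"
    "pc ((step (word_size 8 N) program ^^ u) \<sigma>1) = length prologue + len code"
    unfolding reaches_def by auto
  define \<sigma>2 where "\<sigma>2 = (step (word_size 8 N) program ^^ u) \<sigma>1"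
  have run: "(step (word_size 8 N) program ^^ (u + 12)) (init_config rs bs) = \<sigma>2"
    unfolding \<sigma>2_def st1[symmetric] by (simp only: funpow_add comp_apply \<sigma>0_def)
  have "halted program \<sigma>2" using u(3) len12 by (simp add: halted_def \<sigma>2_def prog)
  moreover have "valid_output rs bs \<sigma>2"
  proof -
    have mem: "wmem \<sigma>2 a = wa s' aOut a" if "a < N" for a
    proof -
      have "\<forall>i<Q. wmem \<sigma>2 (0 * Q + i) = wa s' 0 i" using u(2) unfolding sim_def \<sigma>2_def by blast
      then show ?thesis using that by (simp add: Q_def)
    qed
    have "output_stars (rs @ bs) \<sigma>2 =
        (\<lambda>i. (pt (wa s' aOut (4 * i)), (\<lambda>j. pt (wa s' aOut (4 * i + j))) ` {1, 2, 3})) ` {..<m}"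
      unfolding output_stars_def lenrb
    proof (rule image_cong)
      show "{..<N div 4} = {..<m}" using N4 by simp
      fix i assume "i \<in> {..<m}"
      then have "4 * i < N" "4 * i + 1 < N" "4 * i + 2 < N" "4 * i + 3 < N" using N4 by auto
      then show "((rs @ bs) ! wmem \<sigma>2 (4 * i), (\<lambda>j. (rs @ bs) ! wmem \<sigma>2 (4 * i + j)) ` {1, 2, 3}) =
          (pt (wa s' aOut (4 * i)), (\<lambda>j. pt (wa s' aOut (4 * i + j))) ` {1, 2, 3})"
        by (simp add: mem pt_def)
    qed
    moreover have "pt ` {..<r} = set rs"
    proof -
      have "pt ` {..<r} = (!) rs ` {..<r}" by (intro image_cong) (auto simp: pt_def nth_append r_def)
      then show ?thesis by (auto simp: r_def set_conv_nth)
    qed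
    moreover have "pt ` {r..<N} = set bs"
    proof -
      have "{r..<N} = (\<lambda>i. r + i) ` {..<b}"
        using image_add_atLeastLessThan[of r 0 b] N
        by (simp add: r_def b_def lessThan_atLeast0 add.commute)
      then have "pt ` {r..<N} = (\<lambda>i. pt (r + i)) ` {..<b}" by (simp add: image_image)
      also have "\<dots> = (!) bs ` {..<b}" by (intro image_cong) (auto simp: pt_def nth_append r_def)
      finally show ?thesis by (auto simp: b_def set_conv_nth)
    qed
    ultimately show ?thesis using cov out mem lenrb by (simp add: valid_output_def)
  qed
  moreover have "u + 12 \<le> time_bound N"
  proof -
    have "real M * ln (real M) \<le> 2 * real N * ln (2 * real N + 2)"
    proof (cases "M = 0")
      case False
      have "real M \<le> 2 * real N" using N4 by (simp add: M_def)
      then show ?thesis using False by (intro mult_mono) auto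
    qed simp
    then have "76800 * real (log_bound N + 2) * (real M * ln (real M)) \<le>
        76800 * real (log_bound N + 2) * (2 * real N * ln (2 * real N + 2))"
      by (rule mult_left_mono) simp
    then have "cost L M \<le> 76800 * real (log_bound N + 2) * (2 * real N * ln (2 * real N + 2))"
      unfolding cost_def L_def by (simp only: add.assoc one_add_one)
    moreover have "real u \<le> real t" using u(1) by simp
    moreover have "real m \<le> real N" using N4 by simp
    ultimately have "real (u + 12) \<le> 400 * real N + 214 +
        76800 * real (log_bound N + 2) * (2 * real N * ln (2 * real N + 2))"
      using t by simp
    then show ?thesis unfolding time_bound_def by (rule le_nat_floor)
  qed
  ultimately show ?thesis using run by metis
qed

theorem theorem5:
  shows "(\<forall>R B :: point set.
            finite R \<and> finite B \<and> R \<inter> B = {} \<and> general_position (R \<union> B) \<and>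
            (card R = 3 * card B \<or> card B = 3 * card R) \<longrightarrow>
            K13_coverable R B) \<and>
         (\<exists>T :: nat \<Rightarrow> nat.
            (\<lambda>N. real (T N)) \<in> O(\<lambda>N. real N powr (4 / 3) * ln (real N) ^ 3) \<and>
            K13_computable_in_time T)"
proof (intro conjI allI impI)
  fix R B :: "point set"
  assume *: "finite R \<and> finite B \<and> R \<inter> B = {} \<and> general_position (R \<union> B) \<and>
    (card R = 3 * card B \<or> card B = 3 * card R)"
  \<comment> \<open>Existence is read off the output of the program on any listing of the two
    sets.\<close>
  obtain rs bs where rs: "set rs = R" "distinct rs" and bs: "set bs = B" "distinct bs"
    using * finite_distinct_list by metis
  have "K13_instance (set rs) (set bs)" using * rs bs by (simp add: K13_instance_def)
  from program_correct[OF rs(2) bs(2) this refl] rs(1) bs(1) show "K13_coverable R B"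
    unfolding valid_output_def K13_coverable_def by blast
next
  have "K13_computable_in_time time_bound"
    unfolding K13_computable_in_time_def Let_def using program_correct by blast
  then show "\<exists>T :: nat \<Rightarrow> nat.
      (\<lambda>N. real (T N)) \<in> O(\<lambda>N. real N powr (4 / 3) * ln (real N) ^ 3) \<and> K13_computable_in_time T"
    using time_bound_bigo by blast
qed

end
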